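(* Let $n\ge 1$, $\mathbb{T}^n=\mathbb{R}^n/\mathbb{Z}^n$, and let $p\ge 4$. Let $b\in C^\infty(\mathbb{T}^n\times[0,\infty);\mathbb{R}^n)$. Let $W_t$ be a standard $n$-dimensional Brownian motion. For $\varepsilon>0$ let $(X^\varepsilon_t,V^\varepsilon_t)$ solve $$dX^\varepsilon_t=V^\varepsilon_t\,dt,\qquad dV^\varepsilon_t=\frac1\varepsilon\big(b(X^\varepsilon_t,t)-V^\varepsilon_t\big)\,dt+\sqrt{\frac2\varepsilon}\,dW_t,$$ and let $Z^\varepsilon_t$ solve $$dZ^\varepsilon_t=F(Z^\varepsilon_t,t)\,dt+\sqrt{2\varepsilon}\,dW_t,\qquad F(x,t)=b(x,t)-\varepsilon\big(\partial_t b(x,t)+D_xb(x,t)\,b(x,t)\big),$$ driven by the same $W$. Assume $X^\varepsilon_0=Z^\varepsilon_0=x$ for a deterministic point $x$, and that $\tilde V^\varepsilon_0:=V^\varepsilon_0-b(X^\varepsilon_0,0)$ satisfies $\mathbf{E}\,\tilde V^\varepsilon_0=0$ and $\mathbf{E}|\tilde V^\varepsilon_0|^p<\infty$. Then for each $T>0$ there exist $C,\varepsilon_0>0$ depending on $T$ such that for all $\varepsilon<\varepsilon_0$, $$\sup_{t\in[0,T]}\mathbf{E}\,|X^\varepsilon_t-Z^\varepsilon_t|^p\le C(1+T)\varepsilon^p .$$ Furthermore, for every $\varphi\in C^\infty(\mathbb{T}^n)$ there exists a constant $C$ (independent of $\varepsilon$) such that $$\sup_{t\in[0,T]}\big|\mathbf{E}\big(\varphi(X^\varepsilon_t)-\varphi(Z^\varepsilon_t)\big)\big|\le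 C\varepsilon^2 .$$
   Context: $D_xb$ denotes the $n\times n$ Jacobian matrix of $b$ in $x$. The function $b$ is regarded as a function on $\mathbb{R}^n\times[0,\infty)$ that is $\mathbb{Z}^n$-periodic in $x$, and positions $X^\varepsilon_t,Z^\varepsilon_t$ are lifted to $\mathbb{R}^n$ (so $|X^\varepsilon_t-Z^\varepsilon_t|$ is the Euclidean norm of the difference of the lifts); $\varphi\in C^\infty(\mathbb{T}^n)$ is viewed as a $\mathbb{Z}^n$-periodic function on $\mathbb{R}^n$. The initial velocity $V^\varepsilon_0$ is a random variable measurable with respect to the initial sigma-algebra of the filtration of $W$ (hence independent of $W$).
   Formalization: The p-th moment of the initial velocity fluctuation is assumed bounded uniformly in ε (without this the claim fails); b is taken smooth for all real times (Seeley extension recovers [0,∞)); the weak bound is stated for ε<ε₀ (larger ε follow since φ is bounded). *)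

theory Defs
  imports "HOL-Probability.Probability"
begin

coinductive smooth :: "('a::euclidean_space \<Rightarrow> 'b::real_normed_vector) \<Rightarrow> bool" where
  "(\<forall>y. f differentiable (at y)) \<Longrightarrow>
   (\<forall>e\<in>Basis. smooth (\<lambda>y. frechet_derivative f (at y) e)) \<Longrightarrow> smooth f"

text \<open>Z^n-periodicity in the space variable (functions on the torus).\<close>
definition zperiodic :: "(real^'n \<Rightarrow> 'b) \<Rightarrow> bool" where
  "zperiodic f \<longleftrightarrow> (\<forall>(k::'n \<Rightarrow> int) y. f (y + (\<chi> i. of_int (k i))) = f y)"

definition zperiodic_t :: "(real^'n \<Rightarrow> real \<Rightarrow> 'b) \<Rightarrow> bool" where
  "zperiodic_t b \<longleftrightarrow> (\<forall>t. zperiodic (\<lambda>y. b y t))"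

definition unc :: "(real^'n \<Rightarrow> real \<Rightarrow> real^'n) \<Rightarrow> (real^'n) \<times> real \<Rightarrow> real^'n" where
  "unc b z = b (fst z) (snd z)"

definition eff_drift :: "(real^'n \<Rightarrow> real \<Rightarrow> real^'n) \<Rightarrow> real \<Rightarrow> real^'n \<Rightarrow> real \<Rightarrow> real^'n" where
  "eff_drift b eps y t = b y t - eps *\<^sub>R
     (frechet_derivative (unc b) (at (y, t)) (0, 1)
      + frechet_derivative (unc b) (at (y, t)) (b y t, 0))"

definition filtration :: "'a measure \<Rightarrow> (real \<Rightarrow> 'a set set) \<Rightarrow> bool" where
  "filtration M F \<longleftrightarrow>
     (\<forall>t\<ge>0. sigma_algebra (space M) (F t) \<and> F t \<subseteq> sets M) \<and>
     (\<forall>s t. 0 \<le> s \<and> s \<le> t \<longrightarrow> F s \<subseteq> F t)"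

definition meas_wrt :: "'a measure \<Rightarrow> 'a set set \<Rightarrow> ('a \<Rightarrow> 'b::topological_space) \<Rightarrow> bool" where
  "meas_wrt M G Y \<longleftrightarrow> (\<forall>B\<in>sets borel. {\<omega>\<in>space M. Y \<omega> \<in> B} \<in> G)"

definition brownian_motion :: "'a measure \<Rightarrow> (real \<Rightarrow> 'a set set) \<Rightarrow> (real \<Rightarrow> 'a \<Rightarrow> real^'n) \<Rightarrow> bool" where
  "brownian_motion M F W \<longleftrightarrow>
     prob_space M \<and> filtration M F \<and>
     (\<forall>\<omega>\<in>space M. W 0 \<omega> = 0 \<and> continuous_on {0..} (\<lambda>t. W t \<omega>)) \<and>
     (\<forall>t\<ge>0. meas_wrt M (F t) (W t)) \<and>
     (\<forall>s t. 0 \<le> s \<and> s < t \<longrightarrow>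
        distributed M lborel (\<lambda>\<omega>. W t \<omega> - W s \<omega>)
          (\<lambda>y. ennreal (\<Prod>i\<in>UNIV. normal_density 0 (sqrt (t - s)) (y $ i))) \<and>
        (\<forall>A\<in>F s. \<forall>B\<in>sets borel.
           measure M (A \<inter> {\<omega>\<in>space M. W t \<omega> - W s \<omega> \<in> B})
             = measure M A * measure M {\<omega>\<in>space M. W t \<omega> - W s \<omega> \<in> B}))"

text \<open>The coupled system: (X,V) solves the underdamped Langevin equation and Z the
  effective overdamped equation, driven by the same W, written in (pathwise) integral form,
  which is exact since the noise is additive. X_0 = Z_0 = x, V_0 is F_0-measurable.\<close>
definition langevin_coupling ::
  "real \<Rightarrow> (real^'n \<Rightarrow> real \<Rightarrow> real^'n) \<Rightarrow> real^'n \<Rightarrow> 'a measure \<Rightarrow> (real \<Rightarrow> 'a set set)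
   \<Rightarrow> (real \<Rightarrow> 'a \<Rightarrow> real^'n) \<Rightarrow> (real \<Rightarrow> 'a \<Rightarrow> real^'n) \<Rightarrow> (real \<Rightarrow> 'a \<Rightarrow> real^'n)
   \<Rightarrow> (real \<Rightarrow> 'a \<Rightarrow> real^'n) \<Rightarrow> bool" where
  "langevin_coupling eps b x M F W X V Z \<longleftrightarrow>
     brownian_motion M F W \<and>
     meas_wrt M (F 0) (V 0) \<and>
     (\<forall>t\<ge>0. X t \<in> borel_measurable M \<and> V t \<in> borel_measurable M \<and> Z t \<in> borel_measurable M) \<and>
     (AE \<omega> in M.
        continuous_on {0..} (\<lambda>t. X t \<omega>) \<and> continuous_on {0..} (\<lambda>t. V t \<omega>) \<and>
        continuous_on {0..} (\<lambda>t. Z t \<omega>) \<and>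
        (\<forall>t\<ge>0.
          X t \<omega> = x + integral {0..t} (\<lambda>s. V s \<omega>) \<and>
          V t \<omega> = V 0 \<omega> + integral {0..t} (\<lambda>s. (1 / eps) *\<^sub>R (b (X s \<omega>) s - V s \<omega>))
                   + sqrt (2 / eps) *\<^sub>R W t \<omega> \<and>
          Z t \<omega> = x + integral {0..t} (\<lambda>s. eff_drift b eps (Z s \<omega>) s)
                   + sqrt (2 * eps) *\<^sub>R W t \<omega>))"

end

theory Submission imports Defs begin

text \<open>
  Integrating the velocity equation gives, pathwise, \<open>X + \<epsilon> (V - V\<^sub>0) = x + \<integral> b(X) ds + sqrt (2 \<epsilon>) W\<close>, so that the noise
  cancels in \<open>D = X - Z\<close>. Since \<open>V\<close> is bounded in \<open>L\<^sup>p\<close>, Gronwall's lemma yields \<open>D = O(\<epsilon>)\<close> in \<open>L\<^sup>p\<close>.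

  For the weak error no stochastic calculus is needed either, because the noise is additive. Let \<open>z = E Z\<close>; then
  \<open>Z - z = O(sqrt \<epsilon>)\<close>, and by Taylor expansion around \<open>z\<close> everything reduces to \<open>E D = O(\<epsilon>\<^sup>2)\<close> and
  \<open>E [(Z - z) \<otimes> D] = O(\<epsilon>\<^sup>2)\<close>. Both satisfy linear integral equations along \<open>z\<close>. Their sources contain the velocity
  fluctuation \<open>V - b(X)\<close> only inside expectations against \<open>1\<close> or \<open>W\<close>: the memory of \<open>V\<^sub>0\<close> drops out since \<open>V\<^sub>0 - b(x, 0)\<close>
  is centered and independent of \<open>W\<close>, and what remains decorrelates within time \<open>\<epsilon>\<close>. The rest of the source of \<open>E D\<close>
  is of second order because the drift correction is the time derivative of \<open>b\<close> along the path.
\<close>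

section \<open>Bounds in \<open>L\<^sup>q\<close>\<close>

text \<open>The weak rate hinges on counting half powers of \<epsilon>. Since \<open>vel\<close> is
  of order one, \<open>D\<close> is of size \<epsilon>, while \<open>zeta\<close> is of size sqrt
  \<epsilon>; Cauchy-Schwarz therefore bounds E[zeta D] only by \<epsilon>^(3/2). The missing half
  power is gained by a bootstrap: testing the equation of \<open>D\<close> against a Brownian
  coordinate gives \<epsilon>^(3/2) for E[W D], and in the equation of \<open>zeta\<close> the noise
  W carries one more factor sqrt \<epsilon>. The two time arguments of these mixed moments are
  independent of each other, so each Gronwall argument runs in one of them while the other is
  frozen, and no product rule is required. Fourth moments enter because remainders quadratic in
  \<open>D\<close> or \<open>zeta\<close> are bounded in L^2 before they are paired with another L^2
  factor. All constants are built from the dimension, T, a common bound B on the coefficients, and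
  moment bounds \<kappa> and c. They are defined inside a locale that has \<epsilon> and the
  probability space among its parameters, so their independence of both can be read off the
  arguments of the exported constants.\<close>

lemma powr_tangent_le:
  fixes u q :: real
  assumes "q \<ge> 1" "u \<ge> 0"
  shows "1 + q * (u - 1) \<le> u powr q"
proof (cases "u = 0")
  case True
  thus ?thesis using assms by simp
next
  case False
  \<comment> \<open>Young's inequality for u^q and 1 with weights 1/q and 1 - 1/q; solved for u^q it
    is the tangent at 1.\<close>
  have "(u powr q) powr (1/q) * 1 powr (1 - 1/q) \<le> (1/q) * (u powr q) + (1 - 1/q) * 1"
    by (rule Youngs_inequality_0) (use assms False in \<open>auto simp: field_simps\<close>)
  hence "u \<le> (1/q) * (u powr q) + (1 - 1/q)"
    using assms by (simp add: powr_powr)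
  hence "q * u \<le> q * ((1/q) * (u powr q) + (1 - 1/q))"
    using assms by (intro mult_left_mono) auto
  thus ?thesis using assms by (simp add: algebra_simps)
qed

text \<open>Both u^q and v^q lie above the tangent at m = \<theta> u + (1 - \<theta>) v, and the
  weighted sum of the two tangent values is m^q. Division by m reduces this to the tangent at
  1.\<close>

lemma powr_convex_combination:
  fixes u v q \<theta> :: real
  assumes "q \<ge> 1" "u \<ge> 0" "v \<ge> 0" "0 \<le> \<theta>" "\<theta> \<le> 1"
  shows "(\<theta> * u + (1 - \<theta>) * v) powr q \<le> \<theta> * u powr q + (1 - \<theta>) * v powr q"
proof -
  define m where "m = \<theta> * u + (1 - \<theta>) * v"
  have m0: "m \<ge> 0" using assms by (simp add: m_def)
  show ?thesis
  proof (cases "m = 0")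
    case True
    thus ?thesis using assms by (simp add: m_def[symmetric])
  next
    case False
    with m0 have m: "m > 0" by simp
    have "\<theta> * (1 + q * (u/m - 1)) + (1 - \<theta>) * (1 + q * (v/m - 1)) \<le> \<theta> * (u/m) powr q + (1 - \<theta>) * (v/m) powr q"
      using assms m by (intro add_mono mult_left_mono powr_tangent_le) auto
    moreover have "\<theta> * (1 + q * (u/m - 1)) + (1 - \<theta>) * (1 + q * (v/m - 1)) = 1 + q * ((\<theta> * u + (1 - \<theta>) * v) / m - 1)"
      using m by (simp add: field_simps)
    moreover have "\<dots> = 1" using m by (simp add: m_def[symmetric])
    ultimately have "1 \<le> \<theta> * (u/m) powr q + (1 - \<theta>) * (v/m) powr q" by simp
    hence "m powr q * 1 \<le> m powr q * (\<theta> * (u/m) powr q + (1 - \<theta>) * (v/m) powr q)"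
      by (intro mult_left_mono) auto
    also have "\<dots> = \<theta> * u powr q + (1 - \<theta>) * v powr q"
      using m assms by (simp add: powr_divide field_simps)
    finally show ?thesis by (simp add: m_def)
  qed
qed

text \<open>The L^q norm as an upper bound rather than a number, so that constants compose directly.
  The nonnegative integral makes integrability a consequence instead of an assumption, and strict
  positivity of a permits the normalisations by a in the proofs below.\<close>

definition Lp_le :: "'a measure \<Rightarrow> real \<Rightarrow> ('a \<Rightarrow> 'b::euclidean_space) \<Rightarrow> real \<Rightarrow> bool" where
  "Lp_le M q f a \<longleftrightarrow> f \<in> borel_measurable M \<and> 0 < a \<and>
     (\<integral>\<^sup>+\<omega>. ennreal (norm (f \<omega>) powr q) \<partial>M) \<le> ennreal (a powr q)"

lemma Lp_le_pos: "Lp_le M q f a \<Longrightarrow> 0 < a"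
  by (simp add: Lp_le_def)

lemma Lp_le_mono: "Lp_le M q f a \<Longrightarrow> a \<le> a' \<Longrightarrow> 0 \<le> q \<Longrightarrow> Lp_le M q f a'"
  unfolding Lp_le_def by (meson ennreal_leI less_imp_le order_trans less_le_trans powr_mono2)

lemma Lp_le_dominated:
  fixes f :: "'a \<Rightarrow> 'b::euclidean_space" and g :: "'a \<Rightarrow> 'c::euclidean_space"
  assumes "Lp_le M q f a" "g \<in> borel_measurable M" "AE \<omega> in M. norm (g \<omega>) \<le> norm (f \<omega>)" "0 \<le> q"
  shows "Lp_le M q g a"
proof -
  have "(\<integral>\<^sup>+\<omega>. ennreal (norm (g \<omega>) powr q) \<partial>M) \<le> (\<integral>\<^sup>+\<omega>. ennreal (norm (f \<omega>) powr q) \<partial>M)"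
    using assms(3) by (intro nn_integral_mono_AE) (auto elim!: eventually_mono intro!: ennreal_leI powr_mono2 assms(4))
  thus ?thesis using assms(1,2) unfolding Lp_le_def by (auto intro: order_trans)
qed

lemma Lp_le_cong_AE:
  assumes "Lp_le M q f a" "g \<in> borel_measurable M" "AE \<omega> in M. g \<omega> = f \<omega>" "0 \<le> q"
  shows "Lp_le M q g a"
  using assms(3) by (intro Lp_le_dominated[OF assms(1,2) _ assms(4)]) auto

lemma Lp_le_scaleR:
  assumes "Lp_le M q f a" "\<bar>c\<bar> * a \<le> a'" "0 < a'" "0 \<le> q"
  shows "Lp_le M q (\<lambda>\<omega>. c *\<^sub>R f \<omega>) a'"
proof -
  have [measurable]: "f \<in> borel_measurable M" and a: "a > 0"
    using assms(1) by (auto simp: Lp_le_def)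
  have "(\<integral>\<^sup>+\<omega>. ennreal (norm (c *\<^sub>R f \<omega>) powr q) \<partial>M) = (\<integral>\<^sup>+\<omega>. ennreal (\<bar>c\<bar> powr q) * ennreal (norm (f \<omega>) powr q) \<partial>M)"
    by (intro nn_integral_cong) (simp add: powr_mult ennreal_mult)
  also have "\<dots> = ennreal (\<bar>c\<bar> powr q) * (\<integral>\<^sup>+\<omega>. ennreal (norm (f \<omega>) powr q) \<partial>M)"
    by (intro nn_integral_cmult) measurable
  also have "\<dots> \<le> ennreal (\<bar>c\<bar> powr q) * ennreal (a powr q)"
    using assms(1) by (intro mult_left_mono) (auto simp: Lp_le_def)
  also have "\<dots> = ennreal ((\<bar>c\<bar> * a) powr q)" using a by (simp add: powr_mult ennreal_mult)
  also have "\<dots> \<le> ennreal (a' powr q)" using assms a by (intro ennreal_leI powr_mono2) auto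
  finally show ?thesis using assms(3) by (auto simp: Lp_le_def)
qed

lemma Lp_le_uminus: "Lp_le M q (\<lambda>\<omega>. - f \<omega>) a \<longleftrightarrow> Lp_le M q f a"
  by (auto simp: Lp_le_def borel_measurable_uminus_eq)

text \<open>Minkowski by convexity: norm f + norm g is (a + b) times the convex combination of norm
  f / a and norm g / b with weight a / (a + b). The pointwise convexity inequality then integrates
  to exactly (a + b)^q.\<close>

lemma Lp_le_add:
  fixes f g :: "'a \<Rightarrow> 'b::euclidean_space"
  assumes "Lp_le M q f a" "Lp_le M q g b" "1 \<le> q"
  shows "Lp_le M q (\<lambda>\<omega>. f \<omega> + g \<omega>) (a + b)"
proof -
  have [measurable]: "f \<in> borel_measurable M" "g \<in> borel_measurable M" and ab: "a > 0" "b > 0"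
    and I: "(\<integral>\<^sup>+\<omega>. ennreal (norm (f \<omega>) powr q) \<partial>M) \<le> ennreal (a powr q)" "(\<integral>\<^sup>+\<omega>. ennreal (norm (g \<omega>) powr q) \<partial>M) \<le> ennreal (b powr q)"
    using assms by (auto simp: Lp_le_def)
  define \<theta> where "\<theta> = a / (a + b)"
  have th: "0 < \<theta>" "\<theta> < 1" "1 - \<theta> = b / (a + b)" using ab by (auto simp: \<theta>_def field_simps)
  define A B where "A = \<theta> * (a + b) powr q / a powr q" and "B = (1 - \<theta>) * (a + b) powr q / b powr q"
  have AB: "A \<ge> 0" "B \<ge> 0" using th(1,2) ab by (simp_all add: A_def B_def)
  have pt: "norm (f \<omega> + g \<omega>) powr q \<le> A * norm (f \<omega>) powr q + B * norm (g \<omega>) powr q" for \<omega>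
  proof -
    have "norm (f \<omega> + g \<omega>) powr q \<le> ((a + b) * (\<theta> * (norm (f \<omega>) / a) + (1 - \<theta>) * (norm (g \<omega>) / b))) powr q"
    proof (intro powr_mono2)
      have "(a + b) * (\<theta> * (norm (f \<omega>) / a) + (1 - \<theta>) * (norm (g \<omega>) / b)) = norm (f \<omega>) + norm (g \<omega>)"
        using ab unfolding th(3) by (simp add: \<theta>_def distrib_left)
      thus "norm (f \<omega> + g \<omega>) \<le> (a + b) * (\<theta> * (norm (f \<omega>) / a) + (1 - \<theta>) * (norm (g \<omega>) / b))"
        using norm_triangle_ineq[of "f \<omega>" "g \<omega>"] by simp
    qed (use assms in auto)
    also have "\<dots> = (a + b) powr q * (\<theta> * (norm (f \<omega>) / a) + (1 - \<theta>) * (norm (g \<omega>) / b)) powr q"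
      by (rule powr_mult)
    also have "\<dots> \<le> (a + b) powr q * (\<theta> * (norm (f \<omega>) / a) powr q + (1 - \<theta>) * (norm (g \<omega>) / b) powr q)"
      using ab th assms by (intro mult_left_mono powr_convex_combination) auto
    also have "\<dots> = A * norm (f \<omega>) powr q + B * norm (g \<omega>) powr q"
      using ab by (simp add: A_def B_def powr_divide field_simps)
    finally show ?thesis .
  qed
  have "(\<integral>\<^sup>+\<omega>. ennreal (norm (f \<omega> + g \<omega>) powr q) \<partial>M) \<le> (\<integral>\<^sup>+\<omega>. ennreal A * ennreal (norm (f \<omega>) powr q) + ennreal B * ennreal (norm (g \<omega>) powr q) \<partial>M)"
    using pt AB by (intro nn_integral_mono) (simp add: ennreal_mult[symmetric] ennreal_plus[symmetric] ennreal_leI del: ennreal_plus)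
  also have "\<dots> = ennreal A * (\<integral>\<^sup>+\<omega>. ennreal (norm (f \<omega>) powr q) \<partial>M) + ennreal B * (\<integral>\<^sup>+\<omega>. ennreal (norm (g \<omega>) powr q) \<partial>M)"
    by (simp add: nn_integral_add nn_integral_cmult)
  also have "\<dots> \<le> ennreal A * ennreal (a powr q) + ennreal B * ennreal (b powr q)"
    by (intro add_mono mult_left_mono I) auto
  also have "\<dots> = ennreal (A * a powr q + B * b powr q)" using AB by (simp add: ennreal_mult)
  also have "A * a powr q + B * b powr q = \<theta> * (a + b) powr q + (1 - \<theta>) * (a + b) powr q"
    using ab by (simp add: A_def B_def)
  also have "\<dots> = (a + b) powr q" by (simp add: algebra_simps)
  finally show ?thesis using ab by (auto simp: Lp_le_def)
qed

lemma Lp_le_diff: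
  fixes f g :: "'a \<Rightarrow> 'b::euclidean_space"
  assumes "Lp_le M q f a" "Lp_le M q g b" "1 \<le> q"
  shows "Lp_le M q (\<lambda>\<omega>. f \<omega> - g \<omega>) (a + b)"
  using Lp_le_add[of M q f a "\<lambda>\<omega>. - g \<omega>" b] assms by (simp add: Lp_le_uminus)

lemma Lp_le_sum:
  fixes f :: "'i \<Rightarrow> 'a \<Rightarrow> 'b::euclidean_space"
  assumes "finite I" "I \<noteq> {}" "\<And>i. i \<in> I \<Longrightarrow> Lp_le M q (f i) (a i)" "1 \<le> q"
  shows "Lp_le M q (\<lambda>\<omega>. \<Sum>i\<in>I. f i \<omega>) (\<Sum>i\<in>I. a i)"
  using assms(1,2,3)
  by (induction I rule: finite_ne_induct) (auto intro!: Lp_le_add assms(4))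

text \<open>Cauchy-Schwarz from L^(2q) times L^(2q) into L^q. Both factors are normalised by their
  bounds before 2 x y \<le> x^2 + y^2 is applied, so that each square contributes at most half of (a
  b)^q. The function h is only dominated by the product, which covers scalar multiples and quadratic
  remainders alike.\<close>

lemma Lp_le_product:
  assumes f: "Lp_le M (2 * q) f a" and g: "Lp_le M (2 * q) g b" and q: "0 < q"
    and h[measurable]: "h \<in> borel_measurable M" and le: "AE \<omega> in M. norm (h \<omega>) \<le> norm (f \<omega>) * norm (g \<omega>)"
  shows "Lp_le M q h (a * b)"
proof -
  have [measurable]: "f \<in> borel_measurable M" "g \<in> borel_measurable M" and ab: "a > 0" "b > 0"
    using assms by (auto simp: Lp_le_def)
  define A B where "A = b powr q / a powr q / 2" and "B = a powr q / b powr q / 2"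
  have AB: "A \<ge> 0" "B \<ge> 0" by (auto simp: A_def B_def)
  have pt: "norm h \<le> norm u * norm v \<Longrightarrow> norm h powr q \<le> A * norm u powr (2 * q) + B * norm v powr (2 * q)"
    for h :: 'd and u :: 'b and v :: 'c
  proof -
    assume le: "norm h \<le> norm u * norm v"
    have "norm h powr q \<le> (norm u * norm v) powr q" using le q by (intro powr_mono2) auto
    also have "\<dots> = norm u powr q * norm v powr q" by (simp add: powr_mult)
    also have "\<dots> \<le> A * (norm u powr q)\<^sup>2 + B * (norm v powr q)\<^sup>2"
    proof -
      define x y where "x = norm u powr q / a powr q" and "y = norm v powr q / b powr q"
      have "2 * (x * y) \<le> x\<^sup>2 + y\<^sup>2" using sum_squares_bound[of x y] by simp
      hence "(a powr q * b powr q / 2) * (2 * (x * y)) \<le> (a powr q * b powr q / 2) * (x\<^sup>2 + y\<^sup>2)"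
        by (intro mult_left_mono) auto
      also have "(a powr q * b powr q / 2) * (2 * (x * y)) = norm u powr q * norm v powr q"
        using ab by (simp add: x_def y_def)
      also have "(a powr q * b powr q / 2) * (x\<^sup>2 + y\<^sup>2) = A * (norm u powr q)\<^sup>2 + B * (norm v powr q)\<^sup>2"
        using ab by (simp add: x_def y_def A_def B_def field_simps power2_eq_square)
      finally show ?thesis .
    qed
    also have "\<dots> = A * norm u powr (2 * q) + B * norm v powr (2 * q)"
      by (simp add: power2_eq_square powr_add[symmetric])
    finally show ?thesis .
  qed
  have "(\<integral>\<^sup>+\<omega>. ennreal (norm (h \<omega>) powr q) \<partial>M) \<le> (\<integral>\<^sup>+\<omega>. ennreal A * ennreal (norm (f \<omega>) powr (2 * q)) + ennreal B * ennreal (norm (g \<omega>) powr (2 * q)) \<partial>M)"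
    using le AB by (intro nn_integral_mono_AE) (auto elim!: eventually_mono simp: ennreal_mult[symmetric] ennreal_plus[symmetric] simp del: ennreal_plus intro!: ennreal_leI pt)
  also have "\<dots> = ennreal A * (\<integral>\<^sup>+\<omega>. ennreal (norm (f \<omega>) powr (2 * q)) \<partial>M) + ennreal B * (\<integral>\<^sup>+\<omega>. ennreal (norm (g \<omega>) powr (2 * q)) \<partial>M)"
    by (simp add: nn_integral_add nn_integral_cmult)
  also have "\<dots> \<le> ennreal A * ennreal (a powr (2 * q)) + ennreal B * ennreal (b powr (2 * q))"
    using f g by (intro add_mono mult_left_mono) (auto simp: Lp_le_def)
  also have "\<dots> = ennreal (A * a powr (2 * q) + B * b powr (2 * q))" using AB by (simp add: ennreal_mult)
  also have "A * a powr (2 * q) + B * b powr (2 * q) = (a * b) powr q"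
  proof -
    have "a powr (2 * q) = a powr q * a powr q" "b powr (2 * q) = b powr q * b powr q"
      by (simp_all add: powr_add[symmetric])
    moreover have "y / x / 2 * (x * x) + x / y / 2 * (y * y) = x * y" if "x > 0" "y > 0" for x y :: real
      using that by (simp add: field_simps)
    ultimately show ?thesis using ab by (simp add: A_def B_def powr_mult)
  qed
  finally show ?thesis using ab by (auto simp: Lp_le_def)
qed

section \<open>L^q bounds on a probability space\<close>

context prob_space
begin

lemma Lp_le_bounded:
  assumes "f \<in> borel_measurable M" "AE \<omega> in M. norm (f \<omega>) \<le> a" "0 < a" "0 \<le> q"
  shows "Lp_le M q f a"
proof -
  have "(\<integral>\<^sup>+\<omega>. ennreal (norm (f \<omega>) powr q) \<partial>M) \<le> (\<integral>\<^sup>+\<omega>. ennreal (a powr q) \<partial>M)"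
    using assms(2) by (intro nn_integral_mono_AE) (auto elim!: eventually_mono intro!: ennreal_leI powr_mono2 assms)
  thus ?thesis using assms by (simp add: Lp_le_def emeasure_space_1)
qed

lemma Lp_le_const: "norm c \<le> a \<Longrightarrow> 0 < a \<Longrightarrow> 0 \<le> q \<Longrightarrow> Lp_le M q (\<lambda>_. c) a"
  by (intro Lp_le_bounded) auto

text \<open>Monotonicity of L^q norms in q. After division by a, Young's inequality with \<theta> =
  r / q bounds the r-th power by \<theta> times the q-th power plus 1 - \<theta>, and the total mass
  is 1.\<close>

lemma Lp_le_exponent:
  assumes "Lp_le M q f a" "1 \<le> r" "r \<le> q"
  shows "Lp_le M r f a"
proof -
  have [measurable]: "f \<in> borel_measurable M" and a: "a > 0"
    using assms by (auto simp: Lp_le_def)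
  define \<theta> where "\<theta> = r / q"
  have th: "0 < \<theta>" "\<theta> \<le> 1" using assms by (auto simp: \<theta>_def)
  define A B where "A = \<theta> * a powr r / a powr q" and "B = (1 - \<theta>) * a powr r"
  have AB: "A \<ge> 0" "B \<ge> 0" using th by (auto simp: A_def B_def)
  have pt: "norm u powr r \<le> A * norm u powr q + B" for u :: 'b
  proof (cases "u = 0")
    case True
    thus ?thesis using AB by simp
  next
    case False
    have "((norm u / a) powr q) powr \<theta> * 1 powr (1 - \<theta>) \<le> \<theta> * (norm u / a) powr q + (1 - \<theta>) * 1"
      by (rule Youngs_inequality_0) (use th a False in auto)
    hence "(norm u / a) powr r \<le> \<theta> * (norm u / a) powr q + (1 - \<theta>)"
      using assms by (simp add: powr_powr \<theta>_def)
    hence "a powr r * (norm u / a) powr r \<le> a powr r * (\<theta> * (norm u / a) powr q + (1 - \<theta>))"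
      by (intro mult_left_mono) auto
    thus ?thesis using a by (simp add: powr_divide A_def B_def field_simps)
  qed
  have "(\<integral>\<^sup>+\<omega>. ennreal (norm (f \<omega>) powr r) \<partial>M) \<le> (\<integral>\<^sup>+\<omega>. ennreal A * ennreal (norm (f \<omega>) powr q) + ennreal B \<partial>M)"
    using pt AB by (intro nn_integral_mono) (simp add: ennreal_mult[symmetric] ennreal_plus[symmetric] ennreal_leI del: ennreal_plus)
  also have "\<dots> = ennreal A * (\<integral>\<^sup>+\<omega>. ennreal (norm (f \<omega>) powr q) \<partial>M) + ennreal B"
    by (simp add: nn_integral_add nn_integral_cmult emeasure_space_1)
  also have "\<dots> \<le> ennreal A * ennreal (a powr q) + ennreal B"
    using assms(1) by (intro add_mono mult_left_mono) (auto simp: Lp_le_def)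
  also have "\<dots> = ennreal (A * a powr q + B)" using AB by (simp add: ennreal_mult)
  also have "A * a powr q + B = a powr r" using a by (simp add: A_def B_def algebra_simps)
  finally show ?thesis using a by (auto simp: Lp_le_def)
qed

lemma Lp_le_integrable:
  assumes "Lp_le M q f a" "1 \<le> q"
  shows "integrable M f"
proof -
  have "Lp_le M 1 f a" by (rule Lp_le_exponent[OF assms(1)]) (use assms in auto)
  hence *: "(\<integral>\<^sup>+\<omega>. ennreal (norm (f \<omega>)) \<partial>M) \<le> ennreal a" and [measurable]: "f \<in> borel_measurable M"
    by (auto simp: Lp_le_def)
  show ?thesis by (rule integrableI_bounded) (use * in \<open>auto simp: less_top intro: le_less_trans\<close>)
qed

lemma Lp_le_expectation:
  assumes "Lp_le M q f a" "1 \<le> q"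
  shows "norm (\<integral>\<omega>. f \<omega> \<partial>M) \<le> a"
proof -
  have "Lp_le M 1 f a" by (rule Lp_le_exponent[OF assms(1)]) (use assms in auto)
  hence *: "(\<integral>\<^sup>+\<omega>. ennreal (norm (f \<omega>)) \<partial>M) \<le> ennreal a" and a: "0 < a"
    by (auto simp: Lp_le_def)
  have "ennreal (norm (\<integral>\<omega>. f \<omega> \<partial>M)) \<le> (\<integral>\<^sup>+\<omega>. ennreal (norm (f \<omega>)) \<partial>M)"
    by (rule integral_norm_bound_ennreal[OF Lp_le_integrable[OF assms]])
  also note *
  finally show ?thesis using a by simp
qed

text \<open>The mean differs from the constant c by at most a, so centering at the mean costs a
  factor 2.\<close>

lemma Lp_le_centered:
  assumes "Lp_le M q (\<lambda>\<omega>. f \<omega> - c) a" "1 \<le> q"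
  shows "Lp_le M q (\<lambda>\<omega>. f \<omega> - (\<integral>\<omega>. f \<omega> \<partial>M)) (2 * a)"
proof -
  have i: "integrable M f"
    using Lp_le_integrable[OF assms] Bochner_Integration.integrable_add[of M "\<lambda>\<omega>. f \<omega> - c" "\<lambda>_. c"] by simp
  have e: "norm ((\<integral>\<omega>. f \<omega> \<partial>M) - c) \<le> a"
    using Lp_le_expectation[OF assms] i by (simp add: Bochner_Integration.integral_diff prob_space)
  have "Lp_le M q (\<lambda>\<omega>. (f \<omega> - c) - ((\<integral>\<omega>. f \<omega> \<partial>M) - c)) (a + a)"
    by (intro Lp_le_diff assms Lp_le_const e Lp_le_pos[OF assms(1)]) (use assms in auto)
  thus ?thesis by simp
qed

lemma Lp_le_scaleR_fun:
  fixes \<xi> :: "'a \<Rightarrow> real"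
  assumes "Lp_le M 2 \<xi> a" "Lp_le M 2 f b"
  shows "Lp_le M 1 (\<lambda>\<omega>. \<xi> \<omega> *\<^sub>R f \<omega>) (a * b)"
  by (rule Lp_le_product[of _ _ \<xi> _ f]) (use assms in \<open>auto simp: Lp_le_def\<close>)

end

text \<open>Jensen's inequality for the measure with density w, whose mass is at most c: the power
  is bounded below by its tangent at m = Y / c, where Y is the weighted integral of norm g.\<close>

lemma norm_weighted_integral_powr_le:
  fixes g :: "real \<Rightarrow> 'b::euclidean_space"
  assumes [measurable]: "g \<in> borel_measurable borel" "w \<in> borel_measurable borel"
    and w: "\<And>s. 0 \<le> w s" "(\<integral>\<^sup>+s. ennreal (w s) \<partial>lborel) \<le> ennreal c" and c: "0 < c" and q: "1 \<le> q"
  shows "ennreal (norm (\<integral>s. w s *\<^sub>R g s \<partial>lborel) powr q)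
     \<le> ennreal (c powr (q - 1)) * (\<integral>\<^sup>+s. ennreal (w s * norm (g s) powr q) \<partial>lborel)"
proof (cases "(\<integral>\<^sup>+s. ennreal (w s * norm (g s) powr q) \<partial>lborel) = \<infinity>")
  case True
  thus ?thesis using c by (simp add: ennreal_mult_eq_top_iff)
next
  case False
  have iw: "integrable lborel w"
    using w by (intro integrableI_nonneg) (auto simp: less_top intro: le_less_trans)
  have ip: "integrable lborel (\<lambda>s. w s * norm (g s) powr q)"
    using w(1) False by (intro integrableI_nonneg) (auto simp: less_top)
  \<comment> \<open>Dominates w times norm g by two integrable functions, so that Y is a genuine
    integral.\<close>
  have pw: "u \<le> 1 + u powr q" if "u \<ge> 0" for u :: real
  proof (cases "u \<le> 1")
    case False
    hence "u powr 1 \<le> u powr q" using q by (intro powr_mono) auto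
    thus ?thesis using False by simp
  qed (simp add: add_increasing2)
  have i1: "integrable lborel (\<lambda>s. w s * norm (g s))"
  proof (rule Bochner_Integration.integrable_bound[OF Bochner_Integration.integrable_add[OF iw ip]])
    show "AE s in lborel. norm (w s * norm (g s)) \<le> norm (w s + w s * norm (g s) powr q)"
    proof (rule AE_I2)
      fix s
      have "w s * norm (g s) \<le> w s * (1 + norm (g s) powr q)" by (intro mult_left_mono pw w) auto
      thus "norm (w s * norm (g s)) \<le> norm (w s + w s * norm (g s) powr q)"
        using w(1)[of s] by (simp add: algebra_simps)
    qed
  qed measurable
  define Y where "Y = (\<integral>s. w s * norm (g s) \<partial>lborel)"
  define J where "J = (\<integral>s. w s * norm (g s) powr q \<partial>lborel)"
  have Y0: "Y \<ge> 0" unfolding Y_def using w by (intro integral_nonneg_AE) auto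
  have J0: "J \<ge> 0" unfolding J_def using w by (intro integral_nonneg_AE) auto
  have W0: "(\<integral>s. w s \<partial>lborel) \<le> c"
    using w(2) nn_integral_eq_integral[OF iw] w(1) c by (auto simp: ennreal_le_iff)
  have nY: "norm (\<integral>s. w s *\<^sub>R g s \<partial>lborel) \<le> Y"
    unfolding Y_def using integral_norm_bound[of lborel "\<lambda>s. w s *\<^sub>R g s"] w(1) by simp
  have key: "Y powr q \<le> c powr (q - 1) * J"
  proof (cases "Y = 0")
    case True
    thus ?thesis using J0 by simp
  next
    case False
    define m where "m = Y / c"
    have m: "m > 0" using False Y0 c by (simp add: m_def)
    have "(\<integral>s. (m powr q * (1 - q)) * w s + (q * m powr (q - 1)) * (w s * norm (g s)) \<partial>lborel) \<le> J"
      unfolding J_def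
    proof (intro integral_mono)
      fix s
      have "1 + q * (norm (g s) / m - 1) \<le> (norm (g s) / m) powr q"
        by (rule powr_tangent_le) (use q m in auto)
      hence "(w s * m powr q) * (1 + q * (norm (g s) / m - 1)) \<le> (w s * m powr q) * (norm (g s) / m) powr q"
        using w(1) by (intro mult_left_mono) auto
      also have "\<dots> = w s * norm (g s) powr q" using m by (simp add: powr_divide)
      also have "(w s * m powr q) * (1 + q * (norm (g s) / m - 1)) = (m powr q * (1 - q)) * w s + (q * m powr (q - 1)) * (w s * norm (g s))"
        using m by (simp add: powr_diff field_simps)
      finally show "(m powr q * (1 - q)) * w s + (q * m powr (q - 1)) * (w s * norm (g s)) \<le> w s * norm (g s) powr q" .
    qed (intro Bochner_Integration.integrable_add integrable_mult_right iw i1 ip)+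
    also have "(\<integral>s. (m powr q * (1 - q)) * w s + (q * m powr (q - 1)) * (w s * norm (g s)) \<partial>lborel)
      = (m powr q * (1 - q)) * (\<integral>s. w s \<partial>lborel) + (q * m powr (q - 1)) * Y"
      unfolding Y_def using iw i1 by simp
    finally have A: "(m powr q * (1 - q)) * (\<integral>s. w s \<partial>lborel) + (q * m powr (q - 1)) * Y \<le> J" .
    \<comment> \<open>The coefficient 1 - q is nonpositive, so enlarging the mass of w to c only
      lowers the left side.\<close>
    have B: "(m powr q * (1 - q)) * c \<le> (m powr q * (1 - q)) * (\<integral>s. w s \<partial>lborel)"
      using W0 q by (intro mult_left_mono_neg) (auto simp: mult_nonneg_nonpos)
    have C: "(q * m powr (q - 1)) * Y = q * m powr q * c"
      using m c by (simp add: m_def powr_diff field_simps)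
    have "(m powr q * (1 - q)) * c + q * m powr q * c \<le> J" using A B unfolding C by linarith
    hence "c * m powr q \<le> J" by (simp add: algebra_simps)
    hence "c powr (q - 1) * (c * m powr q) \<le> c powr (q - 1) * J" by (intro mult_left_mono) auto
    also have "c powr (q - 1) * (c * m powr q) = (c * m) powr q"
      using c by (simp add: powr_diff powr_mult)
    also have "c * m = Y" using c by (simp add: m_def)
    finally show ?thesis .
  qed
  have "ennreal (norm (\<integral>s. w s *\<^sub>R g s \<partial>lborel) powr q) \<le> ennreal (c powr (q - 1) * J)"
    using nY key q by (intro ennreal_leI) (meson norm_ge_zero order_trans powr_mono2 zero_le_one)
  also have "\<dots> = ennreal (c powr (q - 1)) * (\<integral>\<^sup>+s. ennreal (w s * norm (g s) powr q) \<partial>lborel)"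
    unfolding J_def using nn_integral_eq_integral[OF ip] w(1) J0[unfolded J_def] by (simp add: ennreal_mult)
  finally show ?thesis .
qed

section \<open>Time integrals in L^q and Gronwall's lemma\<close>

context prob_space
begin

lemma lborel_pair_cong: "f \<in> borel_measurable (borel \<Otimes>\<^sub>M M) \<Longrightarrow> f \<in> borel_measurable (lborel \<Otimes>\<^sub>M M)"
  by (subst measurable_cong_sets[OF sets_pair_measure_cong[of lborel borel M M] refl]) auto

text \<open>Minkowski's integral inequality for a family bounded uniformly in L^q: Jensen for each
  \<omega>, then Tonelli. The bound on f s is demanded only where w is nonzero, so that the weight
  may carry the indicator of a time interval. Tonelli is the reason for joint measurability.\<close>

lemma Lp_le_weighted_integral:
  fixes f :: "real \<Rightarrow> 'a \<Rightarrow> 'b::euclidean_space"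
  assumes [measurable]: "case_prod f \<in> borel_measurable (borel \<Otimes>\<^sub>M M)" "w \<in> borel_measurable borel"
    and w: "\<And>s. 0 \<le> w s" "(\<integral>\<^sup>+s. ennreal (w s) \<partial>lborel) \<le> ennreal c" and c: "0 < c" "0 < a" and q: "1 \<le> q"
    and f: "\<And>s. w s \<noteq> 0 \<Longrightarrow> Lp_le M q (f s) a"
  shows "Lp_le M q (\<lambda>\<omega>. \<integral>s. w s *\<^sub>R f s \<omega> \<partial>lborel) (c * a)"
proof -
  interpret P: pair_sigma_finite lborel M ..
  note [measurable] = lborel_pair_cong[OF assms(1)]
  have "(\<integral>\<^sup>+\<omega>. ennreal (norm (\<integral>s. w s *\<^sub>R f s \<omega> \<partial>lborel) powr q) \<partial>M)
    \<le> (\<integral>\<^sup>+\<omega>. ennreal (c powr (q - 1)) * (\<integral>\<^sup>+s. ennreal (w s * norm (f s \<omega>) powr q) \<partial>lborel) \<partial>M)"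
    by (intro nn_integral_mono norm_weighted_integral_powr_le w c q) measurable
  also have "\<dots> = ennreal (c powr (q - 1)) * (\<integral>\<^sup>+\<omega>. (\<integral>\<^sup>+s. ennreal (w s * norm (f s \<omega>) powr q) \<partial>lborel) \<partial>M)"
    by (intro nn_integral_cmult) measurable
  also have "(\<integral>\<^sup>+\<omega>. (\<integral>\<^sup>+s. ennreal (w s * norm (f s \<omega>) powr q) \<partial>lborel) \<partial>M)
     = (\<integral>\<^sup>+s. (\<integral>\<^sup>+\<omega>. ennreal (w s * norm (f s \<omega>) powr q) \<partial>M) \<partial>lborel)"
    by (rule P.Fubini') measurable
  also have "\<dots> \<le> (\<integral>\<^sup>+s. ennreal (w s) * ennreal (a powr q) \<partial>lborel)"
  proof (intro nn_integral_mono)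
    fix s
    show "(\<integral>\<^sup>+\<omega>. ennreal (w s * norm (f s \<omega>) powr q) \<partial>M) \<le> ennreal (w s) * ennreal (a powr q)"
    proof (cases "w s = 0")
      case False
      have "(\<integral>\<^sup>+\<omega>. ennreal (w s * norm (f s \<omega>) powr q) \<partial>M) = ennreal (w s) * (\<integral>\<^sup>+\<omega>. ennreal (norm (f s \<omega>) powr q) \<partial>M)"
        using w(1) by (subst nn_integral_cmult[symmetric]) (auto simp: ennreal_mult)
      also have "\<dots> \<le> ennreal (w s) * ennreal (a powr q)"
        using f[OF False] by (intro mult_left_mono) (auto simp: Lp_le_def)
      finally show ?thesis .
    qed auto
  qed
  also have "\<dots> = (\<integral>\<^sup>+s. ennreal (w s) \<partial>lborel) * ennreal (a powr q)"
    by (intro nn_integral_multc) measurable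
  also have "\<dots> \<le> ennreal c * ennreal (a powr q)"
    by (intro mult_right_mono w) auto
  finally have "(\<integral>\<^sup>+\<omega>. ennreal (norm (\<integral>s. w s *\<^sub>R f s \<omega> \<partial>lborel) powr q) \<partial>M)
      \<le> ennreal (c powr (q - 1)) * (ennreal c * ennreal (a powr q))"
    by (simp add: mult_left_mono)
  also have "\<dots> = ennreal (c powr (q - 1) * c * a powr q)"
    using c by (simp add: ennreal_mult mult.assoc)
  also have "c powr (q - 1) * c * a powr q = (c * a) powr q"
    using c by (simp add: powr_mult powr_diff)
  finally show ?thesis using c by (simp add: Lp_le_def)
qed

lemma Lp_le_interval_integral:
  fixes f :: "real \<Rightarrow> 'a \<Rightarrow> 'b::euclidean_space"
  assumes [measurable]: "case_prod f \<in> borel_measurable (borel \<Otimes>\<^sub>M M)"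
    and c: "t - s \<le> c" "0 < c" "0 < a" and q: "1 \<le> q"
    and f: "\<And>r. s \<le> r \<Longrightarrow> r \<le> t \<Longrightarrow> Lp_le M q (f r) a"
  shows "Lp_le M q (\<lambda>\<omega>. LBINT r:{s..t}. f r \<omega>) (c * a)"
  unfolding set_lebesgue_integral_def
proof (rule Lp_le_weighted_integral)
  have "(\<integral>\<^sup>+ r. ennreal (indicator {s..t} r) \<partial>lborel) = emeasure lborel {s..t}"
    by (subst nn_integral_indicator[symmetric]) (auto simp: ennreal_indicator)
  also have "\<dots> \<le> ennreal c" using c by (cases "s \<le> t") (auto intro!: ennreal_leI)
  finally show "(\<integral>\<^sup>+ r. ennreal (indicator {s..t} r) \<partial>lborel) \<le> ennreal c" .
qed (use assms in \<open>auto simp: indicator_def split: if_splits\<close>)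

text \<open>Fubini; the uniform L^1 bound and the finite mass of w give integrability on the product
  space.\<close>

lemma expectation_weighted_integral:
  fixes f :: "real \<Rightarrow> 'a \<Rightarrow> 'b::euclidean_space"
  assumes [measurable]: "case_prod f \<in> borel_measurable (borel \<Otimes>\<^sub>M M)" "w \<in> borel_measurable borel"
    and w: "\<And>s. 0 \<le> w s" "(\<integral>\<^sup>+s. ennreal (w s) \<partial>lborel) < \<infinity>"
    and f: "\<And>s. w s \<noteq> 0 \<Longrightarrow> Lp_le M 1 (f s) a"
  shows "(\<integral>\<omega>. (\<integral>s. w s *\<^sub>R f s \<omega> \<partial>lborel) \<partial>M) = (\<integral>s. w s *\<^sub>R (\<integral>\<omega>. f s \<omega> \<partial>M) \<partial>lborel)"
proof -
  interpret P: pair_sigma_finite lborel M ..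
  note [measurable] = lborel_pair_cong[OF assms(1)]
  have "(\<integral>\<^sup>+s. (\<integral>\<^sup>+\<omega>. norm (w s *\<^sub>R f s \<omega>) \<partial>M) \<partial>lborel) \<le> (\<integral>\<^sup>+s. ennreal (w s) * ennreal a \<partial>lborel)"
  proof (intro nn_integral_mono)
    fix s
    show "(\<integral>\<^sup>+\<omega>. norm (w s *\<^sub>R f s \<omega>) \<partial>M) \<le> ennreal (w s) * ennreal a"
    proof (cases "w s = 0")
      case False
      have "(\<integral>\<^sup>+\<omega>. norm (w s *\<^sub>R f s \<omega>) \<partial>M) = ennreal (w s) * (\<integral>\<^sup>+\<omega>. norm (f s \<omega>) \<partial>M)"
        using w(1) by (subst nn_integral_cmult[symmetric]) (auto simp: ennreal_mult)
      also have "\<dots> \<le> ennreal (w s) * ennreal a"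
        using f[OF False] by (intro mult_left_mono) (auto simp: Lp_le_def)
      finally show ?thesis .
    qed auto
  qed
  also have "\<dots> = (\<integral>\<^sup>+s. ennreal (w s) \<partial>lborel) * ennreal a"
    by (intro nn_integral_multc) measurable
  also have "\<dots> < \<infinity>" using w(2) by (auto simp: ennreal_mult_less_top less_top)
  finally have fin: "(\<integral>\<^sup>+s. (\<integral>\<^sup>+\<omega>. norm (w s *\<^sub>R f s \<omega>) \<partial>M) \<partial>lborel) < \<infinity>" .
  have "integrable (lborel \<Otimes>\<^sub>M M) (\<lambda>(s, \<omega>). w s *\<^sub>R f s \<omega>)"
  proof (rule integrableI_bounded)
    have "(\<integral>\<^sup>+x. ennreal (norm (case x of (s, \<omega>) \<Rightarrow> w s *\<^sub>R f s \<omega>)) \<partial>(lborel \<Otimes>\<^sub>M M))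
       = (\<integral>\<^sup>+s. (\<integral>\<^sup>+\<omega>. norm (w s *\<^sub>R f s \<omega>) \<partial>M) \<partial>lborel)"
      by (subst nn_integral_fst[symmetric]) auto
    thus "(\<integral>\<^sup>+x. ennreal (norm (case x of (s, \<omega>) \<Rightarrow> w s *\<^sub>R f s \<omega>)) \<partial>(lborel \<Otimes>\<^sub>M M)) < \<infinity>"
      using fin by simp
  qed measurable
  from P.Fubini_integral[OF this] show ?thesis by simp
qed

lemma expectation_interval_integral:
  fixes f :: "real \<Rightarrow> 'a \<Rightarrow> 'b::euclidean_space"
  assumes [measurable]: "case_prod f \<in> borel_measurable (borel \<Otimes>\<^sub>M M)"
    and f: "\<And>r. s \<le> r \<Longrightarrow> r \<le> t \<Longrightarrow> Lp_le M q (f r) a" and q: "1 \<le> q"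
  shows "(\<integral>\<omega>. (LBINT r:{s..t}. f r \<omega>) \<partial>M) = (LBINT r:{s..t}. (\<integral>\<omega>. f r \<omega> \<partial>M))"
  unfolding set_lebesgue_integral_def
proof (rule expectation_weighted_integral)
  have "(\<integral>\<^sup>+ r. ennreal (indicator {s..t} r) \<partial>lborel) = emeasure lborel {s..t}"
    by (subst nn_integral_indicator[symmetric]) (auto simp: ennreal_indicator)
  also have "\<dots> < \<infinity>" by (cases "s \<le> t") auto
  finally show "(\<integral>\<^sup>+ r. ennreal (indicator {s..t} r) \<partial>lborel) < \<infinity>" .
  show "Lp_le M 1 (f r) a" if "indicator {s..t} r \<noteq> (0::real)" for r
    using that q by (intro Lp_le_exponent[OF f]) (auto simp: indicator_def split: if_splits)
qed (use assms in auto)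

text \<open>The bound \<open>a * exp (2 * L * t)\<close> reproduces itself with \<open>a\<close> replaced by \<open>3/2 * r + a/2\<close>, so any a priori
  bound can be iterated down to order \<open>r\<close>; no regularity of the bound in time is needed.\<close>

lemma Lp_le_gronwall:
  fixes D :: "real \<Rightarrow> 'a \<Rightarrow> 'b::euclidean_space"
  assumes [measurable]: "case_prod A \<in> borel_measurable (borel \<Otimes>\<^sub>M M)"
    and q: "1 \<le> q" and L: "1 \<le> L" and T: "0 \<le> T" and r: "0 < r"
    and apriori: "\<And>t. 0 \<le> t \<Longrightarrow> t \<le> T \<Longrightarrow> Lp_le M q (D t) a0"
    and A: "\<And>s a. 0 \<le> s \<Longrightarrow> s \<le> T \<Longrightarrow> Lp_le M q (D s) a \<Longrightarrow> Lp_le M q (A s) (L * a + r)"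
    and R: "\<And>t. 0 \<le> t \<Longrightarrow> t \<le> T \<Longrightarrow> Lp_le M q (\<lambda>\<omega>. D t \<omega> - (LBINT s:{0..t}. A s \<omega>)) r"
    and t: "0 \<le> t" "t \<le> T"
  shows "Lp_le M q (D t) (4 * r * exp (2 * L * T))"
proof -
  have a0: "a0 > 0" using apriori[of 0] T by (auto intro: Lp_le_pos)
  have q0: "0 \<le> q" using q by simp
  have step: "Lp_le M q (D t) ((3/2 * r + a/2) * exp (2 * L * t))"
    if a: "a > 0" and IH: "\<And>t. 0 \<le> t \<Longrightarrow> t \<le> T \<Longrightarrow> Lp_le M q (D t) (a * exp (2 * L * t))"
      and t: "0 \<le> t" "t \<le> T" for a t
  proof -
    \<comment> \<open>The growth exp (2 L s) allowed by \<open>IH\<close> is moved into the weight,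
      whose mass is at most exp (2 L t) / (2 L); the rescaled integrand then has the uniform bound L
      a + r.\<close>
    let ?w = "\<lambda>s. indicator {0..t} s * exp (2 * L * s)"
    let ?f = "\<lambda>s \<omega>. exp (- (2 * L * s)) *\<^sub>R A s \<omega>"
    have "Lp_le M q (\<lambda>\<omega>. \<integral>s. ?w s *\<^sub>R ?f s \<omega> \<partial>lborel) (exp (2 * L * t) / (2 * L) * (L * a + r))"
    proof (rule Lp_le_weighted_integral)
      have "((\<lambda>s. exp (2 * L * s)) has_integral (exp (2 * L * t) / (2 * L) - exp (2 * L * 0) / (2 * L))) {0..t}"
        using t L by (intro fundamental_theorem_of_calculus)
          (auto intro!: derivative_eq_intros simp: has_real_derivative_iff_has_vector_derivative[symmetric])
      hence "(\<integral>\<^sup>+s. ennreal (indicator {0..t} s * exp (2 * L * s)) \<partial>lborel) = ennreal (exp (2 * L * t) / (2 * L) - 1 / (2 * L))"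
        by (intro nn_integral_has_integral_lebesgue) auto
      also have "\<dots> \<le> ennreal (exp (2 * L * t) / (2 * L))" using L by (intro ennreal_leI) auto
      finally show "(\<integral>\<^sup>+s. ennreal (?w s) \<partial>lborel) \<le> ennreal (exp (2 * L * t) / (2 * L))" .
      fix s assume "?w s \<noteq> 0"
      hence s: "0 \<le> s" "s \<le> t" by (auto simp: indicator_def split: if_splits)
      have "Lp_le M q (A s) (L * (a * exp (2 * L * s)) + r)"
        using s t by (intro A IH) auto
      hence "Lp_le M q (A s) (exp (2 * L * s) * (L * a + r))"
        by (rule Lp_le_mono) (use L s q r in \<open>auto simp: algebra_simps\<close>)
      thus "Lp_le M q (?f s) (L * a + r)"
        by (rule Lp_le_scaleR) (use L a r q in \<open>auto simp: exp_minus field_simps add_pos_pos\<close>)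
    qed (use L a r q in \<open>auto intro!: add_pos_pos\<close>)
    also have "(\<lambda>\<omega>. \<integral>s. ?w s *\<^sub>R ?f s \<omega> \<partial>lborel) = (\<lambda>\<omega>. LBINT s:{0..t}. A s \<omega>)"
      by (auto simp: set_lebesgue_integral_def exp_minus intro!: Bochner_Integration.integral_cong)
    finally have "Lp_le M q (\<lambda>\<omega>. (D t \<omega> - (LBINT s:{0..t}. A s \<omega>)) + (LBINT s:{0..t}. A s \<omega>))
       (r + exp (2 * L * t) / (2 * L) * (L * a + r))"
      by (rule Lp_le_add[OF R[OF t] _ q])
    hence "Lp_le M q (D t) (r + exp (2 * L * t) / (2 * L) * (L * a + r))" by simp
    thus ?thesis
    proof (rule Lp_le_mono)
      have "r * 1 \<le> r * exp (2 * L * t)" using r L t by (intro mult_left_mono) auto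
      moreover have "exp (2 * L * t) / (2 * L) * (L * a + r) = exp (2 * L * t) * (a / 2 + r / (2 * L))"
        using L by (simp add: field_simps)
      moreover have "\<dots> \<le> exp (2 * L * t) * (a / 2 + r / 2)"
        using L r by (intro mult_left_mono add_left_mono divide_left_mono) auto
      ultimately show "r + exp (2 * L * t) / (2 * L) * (L * a + r) \<le> (3/2 * r + a/2) * exp (2 * L * t)"
        by (simp add: algebra_simps)
    qed (use q in auto)
  qed
  \<comment> \<open>3 r is the fixed point of a \<mapsto> 3/2 r + a/2, and each application halves
    the excess over it.\<close>
  have iter: "Lp_le M q (D t) ((3 * r + a0 / 2 ^ n) * exp (2 * L * t))" if "0 \<le> t" "t \<le> T" for n t
    using that
  proof (induction n arbitrary: t)
    case 0
    have "a0 * 1 \<le> (3 * r + a0) * exp (2 * L * t)"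
      using a0 r L 0 by (intro mult_mono) auto
    thus ?case using Lp_le_mono[OF apriori[OF 0] _ q0] by simp
  next
    case (Suc n)
    have "Lp_le M q (D t) ((3/2 * r + (3 * r + a0 / 2 ^ n)/2) * exp (2 * L * t))"
      by (rule step) (use Suc r a0 in \<open>auto simp: add_pos_pos\<close>)
    thus ?case by (simp add: field_simps)
  qed
  \<comment> \<open>Enough iterations to bring the excess below r; together with 3 r this makes the
    factor 4.\<close>
  obtain n where n: "a0 / r < 2 ^ n" using real_arch_pow[of 2 "a0 / r"] by auto
  have "a0 / 2 ^ n \<le> r" using n r by (simp add: field_simps)
  hence "(3 * r + a0 / 2 ^ n) * exp (2 * L * t) \<le> (4 * r) * exp (2 * L * T)"
    using r t L a0 by (intro mult_mono) auto
  thus ?thesis using Lp_le_mono[OF iter[OF t] _ q0] by simp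
qed

end

section \<open>Smooth periodic functions\<close>

lemma smooth_has_derivative:
  assumes "smooth f"
  shows "(f has_derivative frechet_derivative f (at y)) (at y)"
  using assms by (cases rule: smooth.cases) (simp add: frechet_derivative_works[symmetric])

lemma smooth_partial:
  assumes "smooth f" "e \<in> Basis"
  shows "smooth (\<lambda>y. frechet_derivative f (at y) e)"
  using assms by (cases rule: smooth.cases) simp

lemma smooth_continuous_on: "smooth f \<Longrightarrow> continuous_on S f"
  by (meson smooth_has_derivative continuous_at_imp_continuous_on has_derivative_continuous)

lemma linear_frechet_derivative_smooth:
  "smooth f \<Longrightarrow> linear (frechet_derivative f (at y))"
  using smooth_has_derivative has_derivative_linear by blast

lemma smooth_zero: "smooth (\<lambda>_. 0 :: 'b::real_normed_vector)"
  by (coinduction) auto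

text \<open>Turns a test function on the torus into a time-independent function on space-time, so
  that one Taylor estimate serves it and the drift. The coinductive invariant is the set of all such
  lifts; derivatives in directions of the second factor are lifts of the zero function.\<close>

lemma smooth_comp_fst:
  fixes f :: "'a::euclidean_space \<Rightarrow> 'c::real_normed_vector"
  assumes "smooth f"
  shows "smooth (\<lambda>z :: 'a \<times> 'b::euclidean_space. f (fst z))"
proof -
  define P where "P g \<longleftrightarrow> (\<exists>f. smooth f \<and> g = (\<lambda>z :: 'a \<times> 'b. f (fst z)))"
    for g :: "'a \<times> 'b \<Rightarrow> 'c"
  have "P (\<lambda>z. f (fst z))" using assms by (auto simp: P_def)
  thus ?thesis
  proof (rule smooth.coinduct[of P])
    fix g assume "P g"
    then obtain f where f: "smooth f" and g: "g = (\<lambda>z :: 'a \<times> 'b. f (fst z))"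
      by (auto simp: P_def)
    have der: "(g has_derivative (\<lambda>v. frechet_derivative f (at (fst z)) (fst v))) (at z)" for z
      unfolding g by (rule has_derivative_compose[OF _ smooth_has_derivative[OF f]])
        (auto intro!: derivative_eq_intros)
    have fr: "frechet_derivative g (at z) = (\<lambda>v. frechet_derivative f (at (fst z)) (fst v))" for z
      using frechet_derivative_at[OF der] by simp
    have "P (\<lambda>y. frechet_derivative g (at y) e)" if e: "e \<in> Basis" for e
    proof (cases "fst e \<in> Basis")
      case True
      thus ?thesis unfolding P_def fr
        by (intro exI[of _ "\<lambda>y. frechet_derivative f (at y) (fst e)"] conjI smooth_partial[OF f]) auto
    next
      case False
      hence "fst e = 0" using e by (auto simp: Basis_prod_def)
      thus ?thesis unfolding P_def fr
        using linear_0[OF linear_frechet_derivative_smooth[OF f]]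
        by (intro exI[of _ "\<lambda>_. 0"] conjI smooth_zero) auto
    qed
    thus "\<exists>f. g = f \<and> (\<forall>y. f differentiable at y) \<and>
        (\<forall>e\<in>Basis. P (\<lambda>y. frechet_derivative f (at y) e) \<or> smooth (\<lambda>y. frechet_derivative f (at y) e))"
      using der by (intro exI[of _ g]) (simp add: differentiable_def, blast)
  qed
qed

lemma linear_norm_le_Basis_bound:
  fixes f :: "'a::euclidean_space \<Rightarrow> 'b::real_normed_vector"
  assumes "linear f" "\<And>e. e \<in> Basis \<Longrightarrow> norm (f e) \<le> C"
  shows "norm (f v) \<le> real DIM('a) * C * norm v"
proof -
  have "f v = f (\<Sum>e\<in>Basis. (v \<bullet> e) *\<^sub>R e)" by (simp add: euclidean_representation)
  also have "\<dots> = (\<Sum>e\<in>Basis. (v \<bullet> e) *\<^sub>R f e)"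
    using assms(1) by (simp add: linear_sum linear_cmul)
  also have "norm \<dots> \<le> (\<Sum>e\<in>(Basis :: 'a set). norm v * C)"
    by (intro sum_norm_le) (auto intro!: mult_mono assms Basis_le_norm)
  finally show ?thesis by (simp add: mult_ac)
qed

section \<open>Periodic smooth functions on slabs R^n x [0, T]\<close>

definition xperiodic :: "((real^'n) \<times> real \<Rightarrow> 'c) \<Rightarrow> bool" where
  "xperiodic g \<longleftrightarrow> (\<forall>(k::'n \<Rightarrow> int) y t. g (y + (\<chi> i. of_int (k i)), t) = g (y, t))"

text \<open>Subtracting integer parts moves y into the unit cube, and the cube times [0, T] is
  compact. The normalisation C \<ge> 1, here and below, keeps positivity conditions trivial.\<close>

lemma xperiodic_bounded:
  fixes g :: "(real^'n) \<times> real \<Rightarrow> 'c::real_normed_vector"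
  assumes "xperiodic g" "continuous_on UNIV g"
  obtains C where "C \<ge> 1" "\<And>y t. t \<in> {0..T} \<Longrightarrow> norm (g (y, t)) \<le> C"
proof -
  have "bounded (g ` (cbox 0 (\<chi> i. 1) \<times> {0..T}))"
    by (intro compact_imp_bounded compact_continuous_image compact_Times continuous_on_subset[OF assms(2)]) auto
  then obtain C where C: "\<And>z. z \<in> cbox 0 (\<chi> i. 1) \<times> {0..T} \<Longrightarrow> norm (g z) \<le> C"
    unfolding bounded_iff by blast
  have "norm (g (y, t)) \<le> max 1 C" if t: "t \<in> {0..T}" for y t
  proof -
    define y' :: "real^'n" where "y' = y + (\<chi> i. of_int (- \<lfloor>y $ i\<rfloor>))"
    have "y' \<in> cbox 0 (\<chi> i. 1)"
      unfolding mem_box_cart y'_def by (auto simp: floor_le_iff) linarith+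
    hence "norm (g (y', t)) \<le> C" using C t by auto
    moreover have "g (y', t) = g (y, t)" 
      using assms(1)[unfolded xperiodic_def, rule_format, of y "\<lambda>i. - \<lfloor>y $ i\<rfloor>" t] unfolding y'_def by simp
    ultimately show ?thesis by simp
  qed
  thus ?thesis by (intro that[of "max 1 C"]) auto
qed

text \<open>g coincides with its translate by (a, 0), so uniqueness of the derivative identifies the
  derivatives at the two points.\<close>

lemma xperiodic_partial:
  fixes g :: "(real^'n) \<times> real \<Rightarrow> 'c::real_normed_vector"
  assumes "xperiodic g" "smooth g"
  shows "xperiodic (\<lambda>z. frechet_derivative g (at z) e)"
  unfolding xperiodic_def
proof (intro allI)
  fix k :: "'n \<Rightarrow> int" and y :: "real^'n" and t :: real
  define a :: "real^'n" where "a = (\<chi> i. of_int (k i))"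
  have "((\<lambda>z. g (z + (a, 0))) has_derivative frechet_derivative g (at ((y, t) + (a, 0)))) (at (y, t))"
    by (rule has_derivative_compose[OF _ smooth_has_derivative[OF assms(2)], THEN has_derivative_eq_rhs])
       (auto intro!: derivative_eq_intros)
  moreover have "(\<lambda>z. g (z + (a, 0))) = g"
    using assms(1) by (auto simp: xperiodic_def a_def fun_eq_iff)
  ultimately have "frechet_derivative g (at ((y, t) + (a, 0))) = frechet_derivative g (at (y, t))"
    by (metis frechet_derivative_at)
  thus "frechet_derivative g (at (y + (\<chi> i. of_int (k i)), t)) e = frechet_derivative g (at (y, t)) e"
    by (simp add: a_def)
qed

lemma smooth_xperiodic_derivative_bounded:
  fixes g :: "(real^'n) \<times> real \<Rightarrow> 'c::real_normed_vector"
  assumes "xperiodic g" "smooth g"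
  obtains C where "C \<ge> 1" "\<And>y t v. t \<in> {0..T} \<Longrightarrow> norm (frechet_derivative g (at (y, t)) v) \<le> C * norm v"
proof -
  have "\<exists>C\<ge>1. \<forall>y. \<forall>t\<in>{0..T}. norm (frechet_derivative g (at (y, t)) e) \<le> C" if "e \<in> Basis" for e
    using xperiodic_bounded[OF xperiodic_partial[OF assms] smooth_continuous_on[OF smooth_partial[OF assms(2) that]]]
    by metis
  then obtain C where C: "\<And>e. e \<in> Basis \<Longrightarrow> C e \<ge> 1"
      "\<And>e y t. e \<in> Basis \<Longrightarrow> t \<in> {0..T} \<Longrightarrow> norm (frechet_derivative g (at (y, t)) e) \<le> C e"
    by metis
  define C' where "C' = Max (C ` Basis)"
  have C': "C e \<le> C'" if "e \<in> Basis" for e using that by (auto simp: C'_def)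
  obtain e :: "(real^'n) \<times> real" where "e \<in> Basis" using nonempty_Basis by blast
  hence "1 \<le> C'" using C(1)[of e] C'[of e] by linarith
  show ?thesis
  proof (rule that)
    have "1 * 1 \<le> real DIM((real^'n) \<times> real) * C'"
      using \<open>1 \<le> C'\<close> by (intro mult_mono) (auto simp: Suc_le_eq)
    thus "1 \<le> real DIM((real^'n) \<times> real) * C'" by simp
    show "norm (frechet_derivative g (at (y, t)) v) \<le> real DIM((real^'n) \<times> real) * C' * norm v"
      if "t \<in> {0..T}" for y t v
      using C' C(2)[OF _ that]
      by (intro linear_norm_le_Basis_bound linear_frechet_derivative_smooth assms) (meson order_trans)
  qed
qed

lemma smooth_xperiodic_lipschitz:
  fixes g :: "(real^'n) \<times> real \<Rightarrow> 'c::real_normed_vector"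
  assumes "xperiodic g" "smooth g"
  obtains C where "C \<ge> 1"
    "\<And>y t y' t'. t \<in> {0..T} \<Longrightarrow> t' \<in> {0..T} \<Longrightarrow> norm (g (y, t) - g (y', t')) \<le> C * norm ((y, t) - (y', t'))"
proof -
  obtain C where C: "C \<ge> 1" "\<And>y t v. t \<in> {0..T} \<Longrightarrow> norm (frechet_derivative g (at (y, t)) v) \<le> C * norm v"
    using smooth_xperiodic_derivative_bounded[OF assms] by metis
  have "norm (g (y, t) - g (y', t')) \<le> C * norm ((y, t) - (y', t'))"
    if "t \<in> {0..T}" "t' \<in> {0..T}" for y t y' t'
  proof (rule differentiable_bound)
    show "convex ((UNIV :: (real^'n) set) \<times> {0..T})" by (intro convex_Times) auto
    show "(g has_derivative frechet_derivative g (at z)) (at z within UNIV \<times> {0..T})" for z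
      by (rule has_derivative_at_withinI[OF smooth_has_derivative[OF assms(2)]])
    show "onorm (frechet_derivative g (at z)) \<le> C" if "z \<in> UNIV \<times> {0..T}" for z
      using that C by (cases z) (auto intro!: onorm_le)
  qed (use that in auto)
  thus ?thesis using C that by metis
qed

text \<open>A quantitative C^2 class in space, uniform on [0, T]: one constant bounds f, its spatial
  derivative and the second-order Taylor remainder. The quadratic remainder forces f' to be the
  spatial derivative, while no second derivative appears, so sums and products remain in the class
  by algebra alone.\<close>

definition C2_le :: "real \<Rightarrow> real \<Rightarrow> (real^'n \<Rightarrow> real \<Rightarrow> 'c::euclidean_space) \<Rightarrow> (real^'n \<Rightarrow> real \<Rightarrow> real^'n \<Rightarrow> 'c) \<Rightarrow> bool" where
  "C2_le T C f f' \<longleftrightarrow> (\<forall>t\<in>{0..T}. \<forall>y. linear (f' y t) \<and> norm (f y t) \<le> C \<and>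
     (\<forall>h. norm (f' y t h) \<le> C * norm h \<and> norm (f (y + h) t - f y t - f' y t h) \<le> C * (norm h)\<^sup>2))"

lemma C2_le_mono: "C2_le T C f f' \<Longrightarrow> C \<le> C' \<Longrightarrow> C2_le T C' f f'"
  unfolding C2_le_def by (meson mult_right_mono norm_ge_zero order_trans zero_le_power2)

text \<open>For norm h \<le> 1 the Taylor bound gives C + C; for larger h the sup bound gives 2 C
  \<le> 2 C norm h. This is the origin of the Lipschitz constant 2 B in the later estimates.\<close>

lemma C2_le_lipschitz:
  assumes "C2_le T C f f'" "t \<in> {0..T}"
  shows "norm (f y t - f z t) \<le> 2 * C * norm (y - z)"
proof -
  define h where "h = y - z"
  have C: "0 \<le> C" using assms norm_ge_zero order_trans unfolding C2_le_def by blast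
  have b: "norm (f y t) \<le> C" "norm (f z t) \<le> C"
    and d: "norm (f' z t h) \<le> C * norm h" "norm (f y t - f z t - f' z t h) \<le> C * (norm h)\<^sup>2"
    using assms(1)[unfolded C2_le_def, rule_format, OF assms(2)] by (simp_all add: h_def) (metis add.commute diff_add_cancel)
  show ?thesis
  proof (cases "norm h \<le> 1")
    case True
    have "norm (f y t - f z t) \<le> norm (f y t - f z t - f' z t h) + norm (f' z t h)"
      using norm_triangle_sub[of "f y t - f z t" "f' z t h"] by simp
    also have "\<dots> \<le> C * (norm h * norm h) + C * norm h" using d by (simp add: power2_eq_square)
    also have "\<dots> \<le> C * (1 * norm h) + C * norm h"
      using True C by (intro add_right_mono mult_left_mono mult_right_mono) auto
    finally show ?thesis by (simp add: h_def)
  next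
    case False
    have "norm (f y t - f z t) \<le> C + C" by (rule norm_triangle_ineq4[THEN order_trans]) (use b in simp)
    also have "\<dots> \<le> (2 * C) * norm h" using False C mult_left_mono[of 1 "norm h" "2 * C"] by simp
    finally show ?thesis by (simp add: h_def)
  qed
qed

text \<open>The partial derivatives are again smooth and periodic, hence Lipschitz on the slab;
  linearising along the segment from y to y + h converts this into a quadratic remainder.\<close>

lemma smooth_xperiodic_C2_le:
  fixes g :: "(real^'n) \<times> real \<Rightarrow> 'c::euclidean_space"
  assumes "xperiodic g" "smooth g"
  obtains C where "C \<ge> 1" "C2_le T C (\<lambda>y t. g (y, t)) (\<lambda>y t h. frechet_derivative g (at (y, t)) (h, 0))"
proof -
  obtain C0 where C0: "C0 \<ge> 1" "\<And>y t. t \<in> {0..T} \<Longrightarrow> norm (g (y, t)) \<le> C0"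
    using xperiodic_bounded[OF assms(1) smooth_continuous_on[OF assms(2)]] by metis
  obtain C1 where C1: "C1 \<ge> 1" "\<And>y t v. t \<in> {0..T} \<Longrightarrow> norm (frechet_derivative g (at (y, t)) v) \<le> C1 * norm v"
    using smooth_xperiodic_derivative_bounded[OF assms] by metis
  have "\<exists>C\<ge>1. \<forall>y y'. \<forall>t\<in>{0..T}. \<forall>t'\<in>{0..T}. norm (frechet_derivative g (at (y, t)) e - frechet_derivative g (at (y', t')) e)
          \<le> C * norm ((y, t) - (y', t'))" if "e \<in> Basis" for e
    using smooth_xperiodic_lipschitz[OF xperiodic_partial[OF assms] smooth_partial[OF assms(2) that]] by metis
  then obtain C where C: "\<And>e. e \<in> Basis \<Longrightarrow> C e \<ge> 1"
      "\<And>e y y' t t'. e \<in> Basis \<Longrightarrow> t \<in> {0..T} \<Longrightarrow> t' \<in> {0..T} \<Longrightarrow>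
         norm (frechet_derivative g (at (y, t)) e - frechet_derivative g (at (y', t')) e) \<le> C e * norm ((y, t) - (y', t'))"
    by metis
  define C2 where "C2 = Max (C ` Basis)"
  have C2: "C e \<le> C2" if "e \<in> Basis" for e using that by (auto simp: C2_def)
  \<comment> \<open>A Lipschitz constant for the full derivative: the number of coordinates of
    space-time times the largest Lipschitz constant of a partial derivative.\<close>
  define D where "D = real DIM((real^'n) \<times> real) * C2"
  have taylor: "norm (g (y + h, t) - g (y, t) - frechet_derivative g (at (y, t)) (h, 0)) \<le> D * (norm h)\<^sup>2"
    if t: "t \<in> {0..T}" for y h t
  proof -
    let ?S = "closed_segment (y, t) (y + h, t)"
    have S: "z \<in> ?S \<Longrightarrow> \<exists>y'. z = (y', t) \<and> norm (y' - y) \<le> norm h" for z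
    proof -
      assume "z \<in> ?S"
      then obtain u where u: "0 \<le> u" "u \<le> 1" "z = (1 - u) *\<^sub>R (y, t) + u *\<^sub>R (y + h, t)"
        by (auto simp: closed_segment_def)
      hence "z = (y + u *\<^sub>R h, t)" by (simp add: algebra_simps)
      thus ?thesis using u by (intro exI[of _ "y + u *\<^sub>R h"]) (simp add: mult_left_le_one_le)
    qed
    have "norm (g (y + h, t) - g (y, t) - frechet_derivative g (at (y, t)) ((y + h, t) - (y, t)))
       \<le> norm ((y + h, t) - (y, t)) * (D * norm h)"
    proof (rule differentiable_bound_linearization)
      show "(y, t) + u *\<^sub>R ((y + h, t) - (y, t)) \<in> ?S" if "u \<in> {0..1}" for u
        using that unfolding closed_segment_def by (auto simp: algebra_simps intro!: exI[of _ u])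
      show "(g has_derivative frechet_derivative g (at z)) (at z within ?S)" for z
        by (rule has_derivative_at_withinI[OF smooth_has_derivative[OF assms(2)]])
      show "onorm (frechet_derivative g (at z) - frechet_derivative g (at (y, t))) \<le> D * norm h" if "z \<in> ?S" for z
      proof -
        obtain y' where z: "z = (y', t)" and y': "norm (y' - y) \<le> norm h" using S[OF \<open>z \<in> ?S\<close>] by blast
        have "norm (frechet_derivative g (at (y', t)) v - frechet_derivative g (at (y, t)) v)
           \<le> real DIM((real^'n) \<times> real) * (C2 * norm h) * norm v" for v
        proof (rule linear_norm_le_Basis_bound)
          show "linear (\<lambda>v. frechet_derivative g (at (y', t)) v - frechet_derivative g (at (y, t)) v)"
            by (intro linear_compose_sub linear_frechet_derivative_smooth assms)
          fix e :: "(real^'n) \<times> real" assume e: "e \<in> Basis"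
          have "norm (frechet_derivative g (at (y', t)) e - frechet_derivative g (at (y, t)) e) \<le> C e * norm ((y', t) - (y, t))"
            by (rule C(2)[OF e t t])
          also have "\<dots> \<le> C2 * norm h" using C2[OF e] C(1)[OF e] y' by (intro mult_mono) auto
          finally show "norm (frechet_derivative g (at (y', t)) e - frechet_derivative g (at (y, t)) e) \<le> C2 * norm h" .
        qed
        thus ?thesis unfolding z D_def by (intro onorm_le) (simp add: mult_ac)
      qed
    qed auto
    thus ?thesis by (simp add: power2_eq_square mult_ac)
  qed
  have C0': "0 \<le> C0" "0 \<le> C1" using C0(1) C1(1) by auto
  show ?thesis
  proof (rule that)
    show "1 \<le> max C0 (max C1 D)" using C0 by auto
    show "C2_le T (max C0 (max C1 D)) (\<lambda>y t. g (y, t)) (\<lambda>y t h. frechet_derivative g (at (y, t)) (h, 0))"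
      unfolding C2_le_def
    proof (intro ballI allI conjI)
      fix t y assume t: "t \<in> {0..T}"
      have "linear (frechet_derivative g (at (y, t)) \<circ> (\<lambda>h. (h, 0)))"
        by (intro linear_compose linear_frechet_derivative_smooth assms) (auto intro!: linearI)
      thus "linear (\<lambda>h. frechet_derivative g (at (y, t)) (h, 0))" by (simp add: o_def)
      show "norm (g (y, t)) \<le> max C0 (max C1 D)" using C0(2)[OF t, of y] by auto
      fix h
      have "norm (frechet_derivative g (at (y, t)) (h, 0)) \<le> C1 * norm h" using C1(2)[OF t, of y "(h, 0)"] by simp
      also have "\<dots> \<le> max C0 (max C1 D) * norm h" by (intro mult_right_mono) auto
      finally show "norm (frechet_derivative g (at (y, t)) (h, 0)) \<le> max C0 (max C1 D) * norm h" .
      have "D * (norm h)\<^sup>2 \<le> max C0 (max C1 D) * (norm h)\<^sup>2" by (intro mult_right_mono) auto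
      thus "norm (g (y + h, t) - g (y, t) - frechet_derivative g (at (y, t)) (h, 0)) \<le> max C0 (max C1 D) * (norm h)\<^sup>2"
        using taylor[OF t, of y h] by simp
    qed
  qed
qed

lemma C2_le_add:
  assumes "C2_le T C f f'" "C2_le T D g g'"
  shows "C2_le T (C + D) (\<lambda>y t. f y t + g y t) (\<lambda>y t h. f' y t h + g' y t h)"
  unfolding C2_le_def
proof (intro ballI allI conjI)
  fix t y assume t: "t \<in> {0..T}"
  note F = assms(1)[unfolded C2_le_def, rule_format, OF t] and G = assms(2)[unfolded C2_le_def, rule_format, OF t]
  show "linear (\<lambda>h. f' y t h + g' y t h)" using F[of y] G[of y] by (intro linear_compose_add) auto
  show "norm (f y t + g y t) \<le> C + D" using F[of y] G[of y] by (intro norm_triangle_mono) auto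
  fix h
  show "norm (f' y t h + g' y t h) \<le> (C + D) * norm h"
    unfolding distrib_right using F[of y] G[of y] by (intro norm_triangle_mono) auto
  have "norm ((f (y + h) t - f y t - f' y t h) + (g (y + h) t - g y t - g' y t h)) \<le> C * (norm h)\<^sup>2 + D * (norm h)\<^sup>2"
    using F[of y] G[of y] by (intro norm_triangle_mono) auto
  thus "norm (f (y + h) t + g (y + h) t - (f y t + g y t) - (f' y t h + g' y t h)) \<le> (C + D) * (norm h)\<^sup>2"
    by (simp add: algebra_simps)
qed

lemma C2_le_component:
  fixes f :: "real^'n \<Rightarrow> real \<Rightarrow> real^'m"
  assumes "C2_le T C f f'"
  shows "C2_le T C (\<lambda>y t. f y t $ i) (\<lambda>y t h. f' y t h $ i)"
  unfolding C2_le_def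
proof (intro ballI allI conjI)
  fix t y assume t: "t \<in> {0..T}"
  note F = assms(1)[unfolded C2_le_def, rule_format, OF t]
  show "linear (\<lambda>h. f' y t h $ i)"
    using F[of y] by (auto intro!: linearI simp: linear_add linear_cmul)
  have c: "norm (v $ i) \<le> norm v" for v :: "real^'m" using component_le_norm_cart[of v i] by simp
  show "norm (f y t $ i) \<le> C" using F[of y] c[of "f y t"] by auto
  fix h
  show "norm (f' y t h $ i) \<le> C * norm h" using F[of y] c[of "f' y t h"] by (meson order_trans)
  show "norm (f (y + h) t $ i - f y t $ i - f' y t h $ i) \<le> C * (norm h)\<^sup>2"
    using F[of y] c[of "f (y + h) t - f y t - f' y t h"] by (auto intro: order_trans)
qed

text \<open>Product rule. The remainder splits into f(y + h) times the remainder of g, the increment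
  of f times g' h, and the remainder of f times g. With the Lipschitz constant 2 C of f these
  contribute C D, 2 C D and C D, whence the factor 4.\<close>

lemma C2_le_scaleR:
  fixes f :: "real^'n \<Rightarrow> real \<Rightarrow> real"
  assumes "C2_le T C f f'" "C2_le T D g g'"
  shows "C2_le T (4 * C * D) (\<lambda>y t. f y t *\<^sub>R g y t) (\<lambda>y t h. f' y t h *\<^sub>R g y t + f y t *\<^sub>R g' y t h)"
  unfolding C2_le_def
proof (intro ballI allI conjI)
  fix t y assume t: "t \<in> {0..T}"
  note F = assms(1)[unfolded C2_le_def, rule_format, OF t] and G = assms(2)[unfolded C2_le_def, rule_format, OF t]
  have CD: "0 \<le> C" "0 \<le> D" using F[of y] G[of y] norm_ge_zero order_trans by blast+
  show "linear (\<lambda>h. f' y t h *\<^sub>R g y t + f y t *\<^sub>R g' y t h)"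
    using F[of y] G[of y] by (auto intro!: linearI simp: linear_add linear_cmul algebra_simps)
  have "norm (f y t *\<^sub>R g y t) \<le> C * D" using F[of y] G[of y] CD by (auto intro!: mult_mono)
  also have "\<dots> \<le> 4 * C * D" using CD by simp
  finally show "norm (f y t *\<^sub>R g y t) \<le> 4 * C * D" .
  fix h
  have "norm (f' y t h *\<^sub>R g y t + f y t *\<^sub>R g' y t h) \<le> (C * norm h) * D + C * (D * norm h)"
    using F[of y] G[of y] CD by (intro norm_triangle_mono) (auto intro!: mult_mono)
  also have "\<dots> \<le> 4 * C * D * norm h" using CD by (simp add: algebra_simps)
  finally show "norm (f' y t h *\<^sub>R g y t + f y t *\<^sub>R g' y t h) \<le> 4 * C * D * norm h" .
  have "norm (f (y + h) t *\<^sub>R (g (y + h) t - g y t - g' y t h) + (f (y + h) t - f y t) *\<^sub>R g' y t h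
      + (f (y + h) t - f y t - f' y t h) *\<^sub>R g y t)
    \<le> C * (D * (norm h)\<^sup>2) + (2 * C * norm h) * (D * norm h) + (C * (norm h)\<^sup>2) * D"
  proof (intro norm_triangle_mono)
    show "norm (f (y + h) t *\<^sub>R (g (y + h) t - g y t - g' y t h)) \<le> C * (D * (norm h)\<^sup>2)"
      unfolding norm_scaleR using F[of "y + h"] G[of y] CD by (intro mult_mono) auto
    show "norm ((f (y + h) t - f y t) *\<^sub>R g' y t h) \<le> (2 * C * norm h) * (D * norm h)"
      unfolding norm_scaleR using C2_le_lipschitz[OF assms(1) t, of "y + h" y] G[of y] CD by (intro mult_mono) auto
    show "norm ((f (y + h) t - f y t - f' y t h) *\<^sub>R g y t) \<le> (C * (norm h)\<^sup>2) * D"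
      unfolding norm_scaleR using F[of y] G[of y] CD by (intro mult_mono) auto
  qed
  also have "\<dots> = 4 * C * D * (norm h)\<^sup>2" by (simp add: power2_eq_square algebra_simps)
  also have "f (y + h) t *\<^sub>R (g (y + h) t - g y t - g' y t h) + (f (y + h) t - f y t) *\<^sub>R g' y t h
      + (f (y + h) t - f y t - f' y t h) *\<^sub>R g y t
    = f (y + h) t *\<^sub>R g (y + h) t - f y t *\<^sub>R g y t - (f' y t h *\<^sub>R g y t + f y t *\<^sub>R g' y t h)"
    by (simp only: scaleR_diff_left scaleR_diff_right) simp
  finally show "norm (f (y + h) t *\<^sub>R g (y + h) t - f y t *\<^sub>R g y t - (f' y t h *\<^sub>R g y t + f y t *\<^sub>R g' y t h))
      \<le> 4 * C * D * (norm h)\<^sup>2" .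
qed

lemma C2_le_sum_ex:
  fixes f :: "'i \<Rightarrow> real^'n \<Rightarrow> real \<Rightarrow> 'c::euclidean_space"
  assumes "finite I" "\<And>i. i \<in> I \<Longrightarrow> \<exists>C f'. C2_le T C (f i) f'"
  shows "\<exists>C f'. C2_le T C (\<lambda>y t. \<Sum>i\<in>I. f i y t) f'"
  using assms
proof (induction I rule: finite_induct)
  case empty
  show ?case by (intro exI[of _ 0] exI[of _ "\<lambda>_ _ _. 0"]) (auto simp: C2_le_def linear_zero)
next
  case (insert i I)
  then obtain C f' D g' where "C2_le T C (f i) f'" "C2_le T D (\<lambda>y t. \<Sum>i\<in>I. f i y t) g'" by blast
  from C2_le_add[OF this] insert(1,2) show ?case by auto
qed

text \<open>One order more than \<open>C2_le\<close>, expressed through the coordinate partial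
  derivatives. It is called for because the weak estimate evaluates the derivative of f at
  \<open>Z\<close> and then expands it in turn around the mean path.\<close>

definition C3_le :: "real \<Rightarrow> real \<Rightarrow> (real^'n \<Rightarrow> real \<Rightarrow> 'c::euclidean_space) \<Rightarrow> (real^'n \<Rightarrow> real \<Rightarrow> real^'n \<Rightarrow> 'c) \<Rightarrow> bool" where
  "C3_le T C f f' \<longleftrightarrow> C2_le T C f f' \<and> continuous_on UNIV (\<lambda>z. f (fst z) (snd z)) \<and>
     (\<forall>i. continuous_on UNIV (\<lambda>z. f' (fst z) (snd z) (axis i 1)) \<and> (\<exists>f''. C2_le T C (\<lambda>y t. f' y t (axis i 1)) f''))"

lemma C3_le_mono: "C3_le T C f f' \<Longrightarrow> C \<le> C' \<Longrightarrow> C3_le T C' f f'"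
  unfolding C3_le_def by (meson C2_le_mono)

lemma smooth_xperiodic_C3_le:
  fixes g :: "(real^'n) \<times> real \<Rightarrow> 'c::euclidean_space"
  assumes "xperiodic g" "smooth g"
  obtains C where "C \<ge> 1" "C3_le T C (\<lambda>y t. g (y, t)) (\<lambda>y t h. frechet_derivative g (at (y, t)) (h, 0))"
proof -
  obtain C0 where C0: "C0 \<ge> 1" "C2_le T C0 (\<lambda>y t. g (y, t)) (\<lambda>y t h. frechet_derivative g (at (y, t)) (h, 0))"
    using smooth_xperiodic_C2_le[OF assms] by metis
  define d where "d i = (\<lambda>z. frechet_derivative g (at z) (axis i 1, 0))" for i
  have d: "smooth (d i)" "xperiodic (d i)" for i
  proof -
    have "(axis i 1, 0) \<in> (Basis :: ((real^'n) \<times> real) set)" by (auto simp: Basis_prod_def)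
    thus "smooth (d i)" unfolding d_def by (rule smooth_partial[OF assms(2)])
    show "xperiodic (d i)" unfolding d_def by (rule xperiodic_partial[OF assms])
  qed
  have "\<exists>C f'. C \<ge> 1 \<and> C2_le T C (\<lambda>y t. d i (y, t)) f'" for i
    using smooth_xperiodic_C2_le[OF d(2) d(1)] by metis
  then obtain C f' where C: "\<And>i. C i \<ge> 1" "\<And>i. C2_le T (C i) (\<lambda>y t. d i (y, t)) (f' i)" by metis
  define m where "m = Max (insert C0 (range C))"
  have m: "C0 \<le> m" "C i \<le> m" for i unfolding m_def by (intro Max_ge; simp)+
  show ?thesis
  proof (rule that)
    show "1 \<le> m" using m(1) C0(1) by simp
    show "C3_le T m (\<lambda>y t. g (y, t)) (\<lambda>y t h. frechet_derivative g (at (y, t)) (h, 0))"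
      unfolding C3_le_def
    proof (intro conjI allI exI)
      show "C2_le T m (\<lambda>y t. g (y, t)) (\<lambda>y t h. frechet_derivative g (at (y, t)) (h, 0))"
        by (rule C2_le_mono[OF C0(2) m(1)])
      show "continuous_on UNIV (\<lambda>z. g (fst z, snd z))" using smooth_continuous_on[OF assms(2)] by simp
      show "continuous_on UNIV (\<lambda>z. frechet_derivative g (at (fst z, snd z)) (axis i 1, 0))" for i
        using smooth_continuous_on[OF d(1)[of i]] by (simp add: d_def)
      show "C2_le T m (\<lambda>y t. frechet_derivative g (at (y, t)) (axis i 1, 0)) (f' i)" for i
        using C2_le_mono[OF C(2) m(2)] by (simp add: d_def)
    qed
  qed
qed

lemma linear_axis_expansion:
  fixes L :: "real^'n \<Rightarrow> 'c::euclidean_space"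
  assumes "linear L"
  shows "L h = (\<Sum>i\<in>UNIV. h $ i *\<^sub>R L (axis i 1))"
proof -
  have "h = (\<Sum>i\<in>UNIV. h $ i *\<^sub>R axis i 1)"
    by (simp add: vec_eq_iff axis_def if_distrib cong: if_cong)
  hence "L h = L (\<Sum>i\<in>UNIV. h $ i *\<^sub>R axis i 1)" by simp
  thus ?thesis using assms by (simp add: linear_sum linear_cmul)
qed

section \<open>The drift and its correction term\<close>

definition space_deriv :: "(real^'n \<Rightarrow> real \<Rightarrow> real^'n) \<Rightarrow> real^'n \<Rightarrow> real \<Rightarrow> real^'n \<Rightarrow> real^'n" where
  "space_deriv b y t h = frechet_derivative (unc b) (at (y, t)) (h, 0)"

definition time_deriv :: "(real^'n \<Rightarrow> real \<Rightarrow> real^'n) \<Rightarrow> real^'n \<Rightarrow> real \<Rightarrow> real^'n" where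
  "time_deriv b y t = frechet_derivative (unc b) (at (y, t)) (0, 1)"

definition drift_correction :: "(real^'n \<Rightarrow> real \<Rightarrow> real^'n) \<Rightarrow> real^'n \<Rightarrow> real \<Rightarrow> real^'n" where
  "drift_correction b y t = time_deriv b y t + space_deriv b y t (b y t)"

lemma eff_drift_eq: "eff_drift b eps y t = b y t - eps *\<^sub>R drift_correction b y t"
  by (simp add: eff_drift_def drift_correction_def time_deriv_def space_deriv_def)

lemma xperiodic_unc: "zperiodic_t b \<Longrightarrow> xperiodic (unc b)"
  by (auto simp: zperiodic_t_def zperiodic_def xperiodic_def unc_def)

lemma unc_has_derivative:
  assumes "smooth (unc b)"
  shows "((\<lambda>z. b (fst z) (snd z)) has_derivative (\<lambda>v. space_deriv b y t (fst v) + snd v *\<^sub>R time_deriv b y t)) (at (y, t))"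
proof -
  have "frechet_derivative (unc b) (at (y, t)) v = space_deriv b y t (fst v) + snd v *\<^sub>R time_deriv b y t" for v
  proof -
    have "v = (fst v, 0) + snd v *\<^sub>R (0, 1)" by (simp add: prod_eq_iff)
    hence "frechet_derivative (unc b) (at (y, t)) v = frechet_derivative (unc b) (at (y, t)) ((fst v, 0) + snd v *\<^sub>R (0, 1))"
      by simp
    also have "\<dots> = space_deriv b y t (fst v) + snd v *\<^sub>R time_deriv b y t"
      unfolding space_deriv_def time_deriv_def
      by (simp only: linear_add[OF linear_frechet_derivative_smooth[OF assms]] linear_cmul[OF linear_frechet_derivative_smooth[OF assms]])
    finally show ?thesis .
  qed
  moreover have "unc b = (\<lambda>z. b (fst z) (snd z))" by (simp add: unc_def fun_eq_iff)
  ultimately show ?thesis using smooth_has_derivative[OF assms, of "(y, t)"] by (metis (no_types, lifting) has_derivative_eq_rhs ext)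
qed

text \<open>The correction is the time derivative plus the sum over i of b_i times the i-th partial
  derivative of b, so the closure of \<open>C2_le\<close> under components, products and sums
  applies.\<close>

lemma drift_correction_regular:
  fixes b :: "real^'n \<Rightarrow> real \<Rightarrow> real^'n"
  assumes b: "smooth (unc b)" "zperiodic_t b"
  shows "\<exists>C G'. C2_le T C (drift_correction b) G'"
    and "continuous_on UNIV (\<lambda>z. drift_correction b (fst z) (snd z))"
proof -
  note per = xperiodic_unc[OF b(2)]
  have "(0, 1) \<in> (Basis :: ((real^'n) \<times> real) set)" by (auto simp: Basis_prod_def)
  note t = smooth_partial[OF b(1) this] xperiodic_partial[OF per b(1), of "(0, 1)"]
  have "(axis i 1, 0) \<in> (Basis :: ((real^'n) \<times> real) set)" for i by (auto simp: Basis_prod_def)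
  note s = smooth_partial[OF b(1) this] xperiodic_partial[OF per b(1)]
  have lin: "linear (space_deriv b y t)" for y t
  proof -
    have "linear (frechet_derivative (unc b) (at (y, t)) \<circ> (\<lambda>h. (h, 0)))"
      by (intro linear_compose linear_frechet_derivative_smooth b) (auto intro!: linearI)
    thus ?thesis by (simp add: o_def space_deriv_def[abs_def])
  qed
  have G: "drift_correction b = (\<lambda>y t. time_deriv b y t + (\<Sum>i\<in>UNIV. b y t $ i *\<^sub>R space_deriv b y t (axis i 1)))"
    unfolding drift_correction_def
    by (intro ext arg_cong2[where f = "(+)"] refl linear_axis_expansion[OF lin])
  obtain C0 where C0: "C2_le T C0 (time_deriv b) (\<lambda>y t h. frechet_derivative (\<lambda>z. frechet_derivative (unc b) (at z) (0, 1)) (at (y, t)) (h, 0))"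
    using smooth_xperiodic_C2_le[OF t(2) t(1)] unfolding time_deriv_def[abs_def] by metis
  obtain C1 f' where C1: "C2_le T C1 b f'"
    using smooth_xperiodic_C2_le[OF per b(1)] by (simp add: unc_def) metis
  have "\<exists>C f'. C2_le T C (\<lambda>y t. \<Sum>i\<in>UNIV. b y t $ i *\<^sub>R space_deriv b y t (axis i 1)) f'"
  proof (rule C2_le_sum_ex)
    fix i :: 'n
    obtain C2 g' where "C2_le T C2 (\<lambda>y t. space_deriv b y t (axis i 1)) g'"
      using smooth_xperiodic_C2_le[OF s(2) s(1)[of i]] unfolding space_deriv_def by metis
    from C2_le_scaleR[OF C2_le_component[OF C1, of i] this]
    show "\<exists>C f'. C2_le T C (\<lambda>y t. b y t $ i *\<^sub>R space_deriv b y t (axis i 1)) f'" by blast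
  qed auto
  then obtain C2 g' where "C2_le T C2 (\<lambda>y t. \<Sum>i\<in>UNIV. b y t $ i *\<^sub>R space_deriv b y t (axis i 1)) g'" by blast
  from C2_le_add[OF C0 this] show "\<exists>C G'. C2_le T C (drift_correction b) G'" unfolding G by blast
  have c0: "continuous_on UNIV (\<lambda>z. b (fst z) (snd z))" using smooth_continuous_on[OF b(1)] by (simp add: unc_def[abs_def])
  have c1: "continuous_on UNIV (\<lambda>z. time_deriv b (fst z) (snd z))" using smooth_continuous_on[OF t(1)] by (simp add: time_deriv_def)
  have c2: "continuous_on UNIV (\<lambda>z. space_deriv b (fst z) (snd z) (axis i 1))" for i
    using smooth_continuous_on[OF s(1)[of i]] by (simp add: space_deriv_def)
  show "continuous_on UNIV (\<lambda>z. drift_correction b (fst z) (snd z))"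
    unfolding G by (intro continuous_intros c0 c1 c2)
qed

text \<open>Merges all regularity constants of the drift into one, which becomes a lower bound for
  the parameter \<open>B\<close> of the locale \<open>kinetic\<close>.\<close>

lemma drift_regular:
  fixes b :: "real^'n \<Rightarrow> real \<Rightarrow> real^'n"
  assumes b: "smooth (unc b)" "zperiodic_t b"
  obtains C G' where "C \<ge> 1" "C3_le T C b (space_deriv b)" "C2_le T C (drift_correction b) G'"
    "\<And>y y' t t'. t \<in> {0..T} \<Longrightarrow> t' \<in> {0..T} \<Longrightarrow> norm (b y t - b y' t') \<le> C * (norm (y - y') + \<bar>t - t'\<bar>)"
proof -
  note per = xperiodic_unc[OF b(2)]
  obtain C0 where C0: "C0 \<ge> 1" "C3_le T C0 b (space_deriv b)"
    using smooth_xperiodic_C3_le[OF per b(1), of T] unfolding space_deriv_def[abs_def] by (auto simp: unc_def)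
  obtain C1 G' where C1: "C2_le T C1 (drift_correction b) G'" using drift_correction_regular(1)[OF b] by blast
  obtain C2 where C2: "C2 \<ge> 1"
    "\<And>y t y' t'. t \<in> {0..T} \<Longrightarrow> t' \<in> {0..T} \<Longrightarrow> norm (unc b (y, t) - unc b (y', t')) \<le> C2 * norm ((y, t) - (y', t'))"
    using smooth_xperiodic_lipschitz[OF per b(1)] by metis
  let ?C = "max C0 (max C1 C2)"
  show ?thesis
  proof (rule that)
    show "?C \<ge> 1" using C0 by simp
    show "C3_le T ?C b (space_deriv b)" by (rule C3_le_mono[OF C0(2)]) simp
    show "C2_le T ?C (drift_correction b) G'" by (rule C2_le_mono[OF C1]) simp
    fix y y' t t' assume t: "t \<in> {0..T}" "t' \<in> {0..T}"
    have "norm (b y t - b y' t') \<le> C2 * norm ((y - y', t - t'))" using C2(2)[OF t] by (simp add: unc_def)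
    also have "\<dots> \<le> ?C * (norm (y - y') + \<bar>t - t'\<bar>)"
      using C2(1) norm_Pair_le[of "y - y'" "t - t'"] by (intro mult_mono) auto
    finally show "norm (b y t - b y' t') \<le> ?C * (norm (y - y') + \<bar>t - t'\<bar>)" .
  qed
qed

section \<open>Brownian increments\<close>

text \<open>The exponential of an absolute value is at most the sum of the two exponentials, and
  completing the square turns exp (y / \<sigma>) times the centered density into exp (1/2) times the
  density with mean \<sigma>.\<close>

lemma nn_integral_exp_normal_density:
  assumes "\<sigma> > 0"
  shows "(\<integral>\<^sup>+y. ennreal (exp (\<bar>y\<bar> / \<sigma>) * normal_density 0 \<sigma> y) \<partial>lborel) \<le> ennreal (2 * exp (1/2))"
proof -
  have sq: "exp (y / \<sigma>) * normal_density 0 \<sigma> y = exp (1/2) * normal_density \<sigma> \<sigma> y" 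
    "exp (- y / \<sigma>) * normal_density 0 \<sigma> y = exp (1/2) * normal_density (-\<sigma>) \<sigma> y" for y
    using assms unfolding normal_density_def
    by (simp_all add: exp_add[symmetric] field_simps power2_eq_square)
  have I: "(\<integral>\<^sup>+y. ennreal (normal_density m \<sigma> y) \<partial>lborel) = 1" for m
    using prob_space.emeasure_space_1[OF prob_space_normal_density[OF assms, of m]]
    by (simp add: emeasure_density)
  have "(\<integral>\<^sup>+y. ennreal (exp (\<bar>y\<bar> / \<sigma>) * normal_density 0 \<sigma> y) \<partial>lborel)
     \<le> (\<integral>\<^sup>+y. ennreal (exp (1/2)) * ennreal (normal_density \<sigma> \<sigma> y) + ennreal (exp (1/2)) * ennreal (normal_density (-\<sigma>) \<sigma> y) \<partial>lborel)"
  proof (intro nn_integral_mono)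
    fix y
    have "exp (\<bar>y\<bar> / \<sigma>) * normal_density 0 \<sigma> y \<le> (exp (y / \<sigma>) + exp (- y / \<sigma>)) * normal_density 0 \<sigma> y"
      by (intro mult_right_mono) (auto simp: abs_if)
    also have "\<dots> = exp (1/2) * normal_density \<sigma> \<sigma> y + exp (1/2) * normal_density (-\<sigma>) \<sigma> y"
      by (simp only: distrib_right sq)
    finally show "ennreal (exp (\<bar>y\<bar> / \<sigma>) * normal_density 0 \<sigma> y) \<le> ennreal (exp (1/2)) * ennreal (normal_density \<sigma> \<sigma> y) + ennreal (exp (1/2)) * ennreal (normal_density (-\<sigma>) \<sigma> y)"
      by (simp add: ennreal_mult[symmetric] ennreal_plus[symmetric] ennreal_leI del: ennreal_plus)
  qed
  also have "\<dots> = ennreal (2 * exp (1/2))"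
    by (simp add: nn_integral_add nn_integral_cmult I ennreal_plus[symmetric] del: ennreal_plus)
  finally show ?thesis .
qed

lemma powr_le_exp:
  fixes u q :: real
  assumes "0 \<le> u" "0 < q"
  shows "u powr q \<le> q powr q * exp u"
proof -
  have "u / q \<le> exp (u / q)" using exp_ge_add_one_self[of "u/q"] by linarith
  hence "(u / q) powr q \<le> exp (u / q) powr q" using assms by (intro powr_mono2) auto
  also have "\<dots> = exp u" using assms by (simp add: powr_def)
  finally have "(u / q) powr q * q powr q \<le> exp u * q powr q" by (rule mult_right_mono) auto
  thus ?thesis using assms by (simp add: powr_divide mult.commute)
qed

text \<open>The q-th root of the bound proved below for the q-th moment of a standard Gaussian
  vector in dimension n: q^q comes from trading a power for an exponential, and 2 exp (1/2) per
  coordinate from the exponential moment.\<close>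

definition gauss_const :: "nat \<Rightarrow> real \<Rightarrow> real" where
  "gauss_const n q = (q powr q * (2 * exp (1/2)) ^ n) powr (1 / q)"

lemma gauss_const_pos: "0 < q \<Longrightarrow> 0 < gauss_const n q"
  by (simp add: gauss_const_def)

text \<open>The power of the norm is traded for the exponential of the l1 norm, which factorises
  over the coordinates like the density; what remains are n one-dimensional integrals. Measuring y
  in units of \<sigma> gives the linear scaling in \<sigma>.\<close>

lemma gaussian_moment:
  fixes Y :: "'a \<Rightarrow> real^'n"
  assumes Y: "distributed M lborel Y (\<lambda>y. ennreal (\<Prod>i\<in>UNIV. normal_density 0 \<sigma> (y $ i)))"
    and s: "0 < \<sigma>" and q: "1 \<le> q"
  shows "Lp_le M q Y (gauss_const CARD('n) q * \<sigma>)"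
proof -
  have [measurable]: "Y \<in> borel_measurable M" using Y by (auto simp: distributed_def)
  let ?c = "q powr q * \<sigma> powr q"
  let ?f = "\<lambda>y. ennreal (exp (\<bar>y\<bar> / \<sigma>) * normal_density 0 \<sigma> y)"
  have basis: "(\<Prod>e\<in>Basis. g (y \<bullet> e)) = (\<Prod>i\<in>UNIV. g (y $ i))" for g :: "real \<Rightarrow> 'z::comm_monoid_mult" and y :: "real^'n"
  proof -
    have B: "(Basis :: (real^'n) set) = range (\<lambda>i. axis i 1)" by (auto simp: Basis_vec_def)
    have "inj (\<lambda>i::'n. axis i (1::real))" by (auto simp: inj_on_def axis_eq_axis)
    thus ?thesis unfolding B by (simp add: prod.reindex inner_axis)
  qed
  have "(\<integral>\<^sup>+\<omega>. ennreal (norm (Y \<omega>) powr q) \<partial>M)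
     = (\<integral>\<^sup>+(y::real^'n). ennreal (\<Prod>i\<in>UNIV. normal_density 0 \<sigma> (y $ i)) * ennreal (norm y powr q) \<partial>lborel)"
    using distributed_nn_integral[OF Y, of "\<lambda>y. ennreal (norm y powr q)"] by simp
  also have "\<dots> \<le> (\<integral>\<^sup>+(y::real^'n). ennreal ?c * (\<Prod>e\<in>Basis. ?f (y \<bullet> e)) \<partial>lborel)"
  proof (intro nn_integral_mono)
    fix y :: "real^'n"
    have "norm y powr q = \<sigma> powr q * (norm y / \<sigma>) powr q" using s by (simp add: powr_divide)
    also have "\<dots> \<le> \<sigma> powr q * (q powr q * exp (norm y / \<sigma>))"
      using s q by (intro mult_left_mono powr_le_exp) auto
    also have "\<dots> \<le> \<sigma> powr q * (q powr q * exp (\<Sum>i\<in>UNIV. \<bar>y $ i\<bar> / \<sigma>))"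
      using s norm_le_l1_cart[of y] by (intro mult_left_mono) (auto simp: sum_divide_distrib[symmetric] intro!: divide_right_mono)
    also have "\<dots> = ?c * (\<Prod>i\<in>UNIV. exp (\<bar>y $ i\<bar> / \<sigma>))" by (simp add: exp_sum)
    finally have "(\<Prod>i\<in>UNIV. normal_density 0 \<sigma> (y $ i)) * norm y powr q
        \<le> (\<Prod>i\<in>UNIV. normal_density 0 \<sigma> (y $ i)) * (?c * (\<Prod>i\<in>UNIV. exp (\<bar>y $ i\<bar> / \<sigma>)))"
      by (intro mult_left_mono prod_nonneg) auto
    also have "\<dots> = ?c * (\<Prod>i\<in>UNIV. exp (\<bar>y $ i\<bar> / \<sigma>) * normal_density 0 \<sigma> (y $ i))"
      by (simp add: prod.distrib)
    finally show "ennreal (\<Prod>i\<in>UNIV. normal_density 0 \<sigma> (y $ i)) * ennreal (norm y powr q) \<le> ennreal ?c * (\<Prod>e\<in>Basis. ?f (y \<bullet> e))"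
      unfolding basis[of ?f y] by (simp add: prod_ennreal prod_nonneg ennreal_mult[symmetric] ennreal_leI)
  qed
  also have "\<dots> = ennreal ?c * (\<Prod>e\<in>(Basis :: (real^'n) set). (\<integral>\<^sup>+y. ?f y \<partial>lborel))"
    using nn_integral_lborel_prod[of "\<lambda>_ :: real^'n. ?f"] by (subst nn_integral_cmult) simp_all
  also have "\<dots> \<le> ennreal (?c * (2 * exp (1/2)) ^ CARD('n))"
  proof -
    obtain j where j: "(\<integral>\<^sup>+y. ?f y \<partial>lborel) = ennreal j" "0 \<le> j" "j \<le> 2 * exp (1/2)"
      using nn_integral_exp_normal_density[OF s] by (cases "\<integral>\<^sup>+y. ?f y \<partial>lborel") (auto simp: top_unique)
    have "?c * j ^ CARD('n) \<le> ?c * (2 * exp (1/2)) ^ CARD('n)"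
      using j by (intro mult_left_mono power_mono) auto
    thus ?thesis using j by (simp add: ennreal_power ennreal_mult[symmetric] ennreal_leI)
  qed
  also have "?c * (2 * exp (1/2)) ^ CARD('n) = (gauss_const CARD('n) q * \<sigma>) powr q"
    using q s by (simp add: gauss_const_def powr_mult powr_powr)
  finally show ?thesis using s q gauss_const_pos[of q "CARD('n)"] by (auto simp: Lp_le_def)
qed

text \<open>The density is even and Lebesgue measure is invariant under y \<mapsto> - y, so the mean
  equals its negative.\<close>

lemma gaussian_mean_zero:
  fixes Y :: "'a \<Rightarrow> real^'n"
  assumes Y: "distributed M lborel Y (\<lambda>y. ennreal (\<Prod>i\<in>UNIV. normal_density 0 \<sigma> (y $ i)))"
  shows "(\<integral>\<omega>. Y \<omega> \<partial>M) = 0"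
proof -
  define \<rho> :: "real^'n \<Rightarrow> real" where "\<rho> y = (\<Prod>i\<in>UNIV. normal_density 0 \<sigma> (y $ i))" for y
  have [measurable]: "\<rho> \<in> borel_measurable borel"
    unfolding \<rho>_def by measurable
  have r: "0 \<le> \<rho> y" "\<rho> (- y) = \<rho> y" for y unfolding \<rho>_def by (auto intro!: prod_nonneg prod.cong simp: normal_density_def)
  have [measurable]: "Y \<in> borel_measurable M" using Y by (auto simp: distributed_def)
  have "(\<integral>\<omega>. Y \<omega> \<partial>M) = (\<integral>y. y \<partial>distr M lborel Y)"
    by (subst integral_distr) auto
  also have "\<dots> = (\<integral>y. y \<partial>density lborel \<rho>)" using Y by (simp add: distributed_def \<rho>_def)
  also have "\<dots> = (\<integral>y. \<rho> y *\<^sub>R y \<partial>lborel)" using r by (subst integral_density) auto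
  finally have E: "(\<integral>\<omega>. Y \<omega> \<partial>M) = (\<integral>y. \<rho> y *\<^sub>R y \<partial>lborel)" .
  also have "\<dots> = (\<integral>y. \<rho> (0 + (-1) *\<^sub>R y) *\<^sub>R (0 + (-1) *\<^sub>R y) \<partial>lborel)"
  proof -
    have "(lborel :: (real^'n) measure) = density (distr lborel borel (\<lambda>x. 0 + (-1) *\<^sub>R x)) (\<lambda>_. \<bar>-1::real\<bar> ^ DIM(real^'n))"
      by (rule lborel_affine) simp
    hence "(lborel :: (real^'n) measure) = distr lborel borel (\<lambda>x. 0 + (-1) *\<^sub>R x)"
      by (simp add: density_1)
    thus ?thesis by (subst (1) \<open>lborel = distr lborel borel _\<close>) (subst integral_distr; simp)
  qed
  also have "\<dots> = - (\<integral>y. \<rho> y *\<^sub>R y \<partial>lborel)" by (simp add: r)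
  also note E[symmetric]
  finally have "(\<integral>\<omega>. Y \<omega> \<partial>M) = - (\<integral>\<omega>. Y \<omega> \<partial>M)" .
  thus ?thesis by (simp add: eq_neg_iff_add_eq_0 scaleR_2[symmetric])
qed

text \<open>Independence is given as a product formula between events of G and events of Y. It is
  converted into \<open>indep_var\<close> for \<xi> and each coordinate of Y, and the coordinates
  are reassembled at the end.\<close>

lemma (in prob_space) expectation_scaleR_independent:
  fixes \<xi> :: "'a \<Rightarrow> real" and Y :: "'a \<Rightarrow> real^'n"
  assumes xi: "meas_wrt M G \<xi>" and G: "G \<subseteq> sets M"
    and [measurable]: "Y \<in> borel_measurable M"
    and ind: "\<And>A B. A \<in> G \<Longrightarrow> B \<in> sets borel \<Longrightarrow>
       prob (A \<inter> {\<omega>\<in>space M. Y \<omega> \<in> B}) = prob A * prob {\<omega>\<in>space M. Y \<omega> \<in> B}"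
    and i: "integrable M \<xi>" "integrable M Y"
  shows "(\<integral>\<omega>. \<xi> \<omega> *\<^sub>R Y \<omega> \<partial>M) = (\<integral>\<omega>. \<xi> \<omega> \<partial>M) *\<^sub>R (\<integral>\<omega>. Y \<omega> \<partial>M)"
proof -
  have vim: "f -` B \<inter> space M = {\<omega>\<in>space M. f \<omega> \<in> B}" for f :: "'a \<Rightarrow> 'z" and B by auto
  have [measurable]: "\<xi> \<in> borel_measurable M"
    using xi G by (auto simp: measurable_def vim meas_wrt_def)
  have ss: "sigma_sets (space M) {f -` B \<inter> space M |B. B \<in> sets borel} = {f -` B \<inter> space M |B. B \<in> sets borel}"
    for f :: "'a \<Rightarrow> 'z::topological_space"
    using sets_vimage_algebra2[of f "space M" borel] sets_vimage_algebra[of "space M" f borel] by simp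
  have [measurable]: "(\<lambda>v::real^'n. v $ j) \<in> borel_measurable borel" for j
    by (intro borel_measurable_continuous_onI continuous_intros)
  have ii: "(\<integral>\<omega>. \<xi> \<omega> * Y \<omega> $ j \<partial>M) = (\<integral>\<omega>. \<xi> \<omega> \<partial>M) * (\<integral>\<omega>. Y \<omega> $ j \<partial>M)"
     "integrable M (\<lambda>\<omega>. \<xi> \<omega> * Y \<omega> $ j)" for j
  proof -
    have "indep_var borel \<xi> borel (\<lambda>\<omega>. Y \<omega> $ j)"
      unfolding indep_var_eq ss
    proof (intro conjI indep_setI)
      fix a b assume "a \<in> {\<xi> -` B \<inter> space M |B. B \<in> sets borel}" "b \<in> {(\<lambda>\<omega>. Y \<omega> $ j) -` B \<inter> space M |B. B \<in> sets borel}"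
      then obtain A B where A: "a = \<xi> -` A \<inter> space M" "A \<in> sets borel" and b: "b = (\<lambda>\<omega>. Y \<omega> $ j) -` B \<inter> space M"
        and [measurable]: "B \<in> sets borel" by blast
      have "(\<lambda>v::real^'n. v $ j) -` B \<inter> space borel \<in> sets borel" by measurable
      from ind[OF _ this, of a] show "prob (a \<inter> b) = prob a * prob b"
        using xi A by (simp add: vim meas_wrt_def b)
    qed (auto intro!: measurable_sets)
    moreover have "integrable M (\<lambda>\<omega>. Y \<omega> $ j)" by (rule integrable_bounded_linear[OF bounded_linear_vec_nth i(2)])
    ultimately show "(\<integral>\<omega>. \<xi> \<omega> * Y \<omega> $ j \<partial>M) = (\<integral>\<omega>. \<xi> \<omega> \<partial>M) * (\<integral>\<omega>. Y \<omega> $ j \<partial>M)"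
     "integrable M (\<lambda>\<omega>. \<xi> \<omega> * Y \<omega> $ j)"
      using i(1) by (auto intro: indep_var_lebesgue_integral indep_var_integrable)
  qed
  have "integrable M (\<lambda>\<omega>. \<Sum>j\<in>UNIV. (\<xi> \<omega> * Y \<omega> $ j) *\<^sub>R (axis j 1 :: real^'n))"
    by (intro Bochner_Integration.integrable_sum integrable_scaleR_left ii)
  moreover have "(\<lambda>\<omega>. \<Sum>j\<in>UNIV. (\<xi> \<omega> * Y \<omega> $ j) *\<^sub>R (axis j 1 :: real^'n)) = (\<lambda>\<omega>. \<xi> \<omega> *\<^sub>R Y \<omega>)"
    by (auto simp: vec_eq_iff axis_def if_distrib cong: if_cong)
  ultimately have int: "integrable M (\<lambda>\<omega>. \<xi> \<omega> *\<^sub>R Y \<omega>)" by simp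
  show ?thesis
    using ii(1) integral_bounded_linear[OF bounded_linear_vec_nth int, symmetric] integral_bounded_linear[OF bounded_linear_vec_nth i(2), symmetric]
    by (auto simp: vec_eq_iff)
qed


text \<open>Expresses measurability with respect to a set system through a measure space, so that
  the measurability calculus applies to adapted variables.\<close>

lemma meas_wrt_iff:
  assumes "sigma_algebra (space M) G"
  shows "meas_wrt M G Y \<longleftrightarrow> Y \<in> borel_measurable (sigma (space M) G)"
proof -
  have "sets (sigma (space M) G) = G" "space (sigma (space M) G) = space M"
    using assms by (auto simp: sigma_algebra.sets_measure_of_eq space_measure_of_conv)
  moreover have "Y -` B \<inter> space M = {\<omega>\<in>space M. Y \<omega> \<in> B}" for B by auto
  ultimately show ?thesis by (auto simp: meas_wrt_def measurable_def)
qed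

lemma meas_wrt_borel:
  assumes "meas_wrt M G Y" "G \<subseteq> sets M"
  shows "Y \<in> borel_measurable M"
proof -
  have "Y -` B \<inter> space M = {\<omega>\<in>space M. Y \<omega> \<in> B}" for B by auto
  thus ?thesis using assms by (auto simp: meas_wrt_def measurable_def)
qed

lemma Lp_le_component:
  fixes f :: "'a \<Rightarrow> real^'n"
  assumes "Lp_le M q f a" "0 \<le> q"
  shows "Lp_le M q (\<lambda>\<omega>. f \<omega> $ i) a"
proof (rule Lp_le_dominated[OF assms(1)])
  have [measurable]: "f \<in> borel_measurable M" using assms by (auto simp: Lp_le_def)
  have [measurable]: "(\<lambda>v::real^'n. v $ i) \<in> borel_measurable borel"
    by (intro borel_measurable_continuous_onI continuous_intros)
  show "(\<lambda>\<omega>. f \<omega> $ i) \<in> borel_measurable M" by measurable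
  show "AE \<omega> in M. norm (f \<omega> $ i) \<le> norm (f \<omega>)"
    by (intro AE_I2) (simp add: component_le_norm_cart)
qed (rule assms)

locale brownian =
  fixes M :: "'a measure" and F and W :: "real \<Rightarrow> 'a \<Rightarrow> real^'n"
  assumes bm: "brownian_motion M F W"

sublocale brownian \<subseteq> prob_space M
  using bm by (simp add: brownian_motion_def)

section \<open>Moments and correlations of Brownian increments\<close>

context brownian
begin

lemma W_0: "\<omega> \<in> space M \<Longrightarrow> W 0 \<omega> = 0"
  and W_adapted: "0 \<le> t \<Longrightarrow> meas_wrt M (F t) (W t)"
  and F_sigma_algebra: "0 \<le> t \<Longrightarrow> sigma_algebra (space M) (F t)"
  and F_sets: "0 \<le> t \<Longrightarrow> F t \<subseteq> sets M"
  and F_mono: "0 \<le> s \<Longrightarrow> s \<le> t \<Longrightarrow> F s \<subseteq> F t"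
  using bm unfolding brownian_motion_def filtration_def by blast+

lemma W_borel[measurable]: "0 \<le> t \<Longrightarrow> W t \<in> borel_measurable M"
  using W_adapted F_sets meas_wrt_borel by blast

lemma meas_wrt_F_mono: "0 \<le> s \<Longrightarrow> s \<le> t \<Longrightarrow> meas_wrt M (F s) Y \<Longrightarrow> meas_wrt M (F t) Y"
  using F_mono unfolding meas_wrt_def by blast

text \<open>Stated for an arbitrary upper bound a > 0 in order to include s = t, where the natural
  bound is 0 and hence excluded by \<open>Lp_le\<close>.\<close>

lemma Lp_le_increment:
  assumes "0 \<le> s" "s \<le> t" "1 \<le> q" "gauss_const CARD('n) q * sqrt (t - s) \<le> a" "0 < a"
  shows "Lp_le M q (\<lambda>\<omega>. W t \<omega> - W s \<omega>) a"
proof (cases "s = t")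
  case True
  thus ?thesis using assms by (simp add: Lp_le_const)
next
  case False
  have "Lp_le M q (\<lambda>\<omega>. W t \<omega> - W s \<omega>) (gauss_const CARD('n) q * sqrt (t - s))"
    by (rule gaussian_moment) (use assms False bm in \<open>auto simp: brownian_motion_def\<close>)
  thus ?thesis by (rule Lp_le_mono) (use assms in auto)
qed

lemma increment_Lp2:
  assumes "0 \<le> s" "s \<le> t"
  shows "\<exists>a. Lp_le M 2 (\<lambda>\<omega>. W t \<omega> - W s \<omega>) a"
  using Lp_le_increment[OF assms, of 2 "1 + gauss_const CARD('n) 2 * sqrt (t - s)"] gauss_const_pos[of 2 "CARD('n)"] assms
  by (auto simp: add_pos_nonneg)

lemma W_Lp2: "0 \<le> t \<Longrightarrow> \<exists>a. Lp_le M 2 (W t) a"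
  using increment_Lp2[of 0 t] Lp_le_cong_AE[of M 2 "\<lambda>\<omega>. W t \<omega> - W 0 \<omega>" _ "W t"]
  by (auto simp: W_0)

lemma expectation_increment:
  assumes "0 \<le> s" "s \<le> t"
  shows "(\<integral>\<omega>. W t \<omega> - W s \<omega> \<partial>M) = 0"
proof (cases "s = t")
  case False
  show ?thesis
    by (rule gaussian_mean_zero[where \<sigma> = "sqrt (t - s)"]) (use assms False bm in \<open>auto simp: brownian_motion_def\<close>)
qed simp

lemma expectation_past_scaleR_increment:
  fixes \<xi> :: "'a \<Rightarrow> real"
  assumes "0 \<le> s" "s \<le> t" "meas_wrt M (F s) \<xi>" "integrable M \<xi>"
  shows "(\<integral>\<omega>. \<xi> \<omega> *\<^sub>R (W t \<omega> - W s \<omega>) \<partial>M) = 0"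
proof (cases "s = t")
  case False
  have "(\<integral>\<omega>. \<xi> \<omega> *\<^sub>R (W t \<omega> - W s \<omega>) \<partial>M) = (\<integral>\<omega>. \<xi> \<omega> \<partial>M) *\<^sub>R (\<integral>\<omega>. W t \<omega> - W s \<omega> \<partial>M)"
  proof (rule expectation_scaleR_independent[OF assms(3) F_sets])
    show "prob (A \<inter> {\<omega> \<in> space M. W t \<omega> - W s \<omega> \<in> B}) = prob A * prob {\<omega> \<in> space M. W t \<omega> - W s \<omega> \<in> B}"
      if "A \<in> F s" "B \<in> sets borel" for A B
      using that assms False bm by (auto simp: brownian_motion_def)
    show "integrable M (\<lambda>\<omega>. W t \<omega> - W s \<omega>)"
      using increment_Lp2[OF assms(1,2)] Lp_le_integrable[of 2] by fastforce
  qed (use assms in auto)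
  thus ?thesis using assms by (simp add: expectation_increment)
qed simp

text \<open>The transposed orthogonality, with the scalar taken from the increment: entry j of this
  vector is entry i of E[Y_j (W_t - W_s)], which the preceding lemma annihilates.\<close>

lemma expectation_increment_scaleR_past:
  fixes Y :: "'a \<Rightarrow> real^'n"
  assumes "0 \<le> s" "s \<le> t" "meas_wrt M (F s) Y" "Lp_le M 2 Y a"
  shows "(\<integral>\<omega>. (W t \<omega> - W s \<omega>) $ i *\<^sub>R Y \<omega> \<partial>M) = 0"
proof -
  obtain c where c: "Lp_le M 2 (\<lambda>\<omega>. W t \<omega> - W s \<omega>) c" using increment_Lp2[OF assms(1,2)] by blast
  have int: "integrable M (\<lambda>\<omega>. (W t \<omega> - W s \<omega>) $ i *\<^sub>R Y \<omega>)"
    by (rule Lp_le_integrable[OF Lp_le_scaleR_fun[OF Lp_le_component[OF c] assms(4)]]) auto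
  have "(\<integral>\<omega>. (W t \<omega> - W s \<omega>) $ i * Y \<omega> $ j \<partial>M) = 0" for j
  proof -
    have Yj: "Lp_le M 2 (\<lambda>\<omega>. Y \<omega> $ j) a" by (rule Lp_le_component[OF assms(4)]) simp
    have int2: "integrable M (\<lambda>\<omega>. Y \<omega> $ j *\<^sub>R (W t \<omega> - W s \<omega>))"
      by (rule Lp_le_integrable[OF Lp_le_scaleR_fun[OF Yj c]]) auto
    have [measurable]: "(\<lambda>v::real^'n. v $ j) \<in> borel_measurable borel"
      by (intro borel_measurable_continuous_onI continuous_intros)
    have "(\<lambda>\<omega>. Y \<omega> $ j) \<in> borel_measurable (sigma (space M) (F s))"
      using assms(3) unfolding meas_wrt_iff[OF F_sigma_algebra[OF assms(1)]] by measurable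
    hence "(\<integral>\<omega>. Y \<omega> $ j *\<^sub>R (W t \<omega> - W s \<omega>) \<partial>M) = 0"
      using assms Lp_le_integrable[OF Yj]
      by (intro expectation_past_scaleR_increment) (auto simp: meas_wrt_iff[OF F_sigma_algebra[OF assms(1)]])
    hence "(\<integral>\<omega>. Y \<omega> $ j *\<^sub>R (W t \<omega> - W s \<omega>) \<partial>M) $ i = 0" by simp
    thus ?thesis
      using integral_bounded_linear[OF bounded_linear_vec_nth[of i] int2] by (simp add: mult.commute)
  qed
  thus ?thesis using integral_bounded_linear[OF bounded_linear_vec_nth int, symmetric]
    by (simp add: vec_eq_iff)
qed

text \<open>The bound has to be linear in t - s and uniform in r, which may lie before, inside or
  after [s, t]. Only the part of \<open>W r\<close> accumulated within [s, t] correlates with the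
  increment, and it contributes at most a second moment.\<close>

lemma norm_expectation_W_increment:
  assumes "0 \<le> s" "s \<le> t" "0 \<le> r"
  shows "norm (\<integral>\<omega>. W r \<omega> $ i *\<^sub>R (W t \<omega> - W s \<omega>) \<partial>M) \<le> (gauss_const CARD('n) 2)\<^sup>2 * (t - s)"
proof -
  have int: "integrable M (\<lambda>\<omega>. f \<omega> $ i *\<^sub>R g \<omega>)" if "\<exists>a. Lp_le M 2 f a" "\<exists>b. Lp_le M 2 g b" for f g :: "'a \<Rightarrow> real^'n"
    using that Lp_le_integrable[OF Lp_le_scaleR_fun[OF Lp_le_component]] by fastforce
  have wm: "meas_wrt M (F r) (\<lambda>\<omega>. W r \<omega> $ i)" if "0 \<le> r" for r
  proof -
    have [measurable]: "(\<lambda>v::real^'n. v $ i) \<in> borel_measurable borel"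
      by (intro borel_measurable_continuous_onI continuous_intros)
    show ?thesis using W_adapted[OF that] unfolding meas_wrt_iff[OF F_sigma_algebra[OF that]] by measurable
  qed
  have past: "(\<integral>\<omega>. W u \<omega> $ i *\<^sub>R (W t \<omega> - W s \<omega>) \<partial>M) = 0" if "0 \<le> u" "u \<le> s" "s \<le> t" for u s t
  proof (rule expectation_past_scaleR_increment)
    show "meas_wrt M (F s) (\<lambda>\<omega>. W u \<omega> $ i)" using wm[of u] meas_wrt_F_mono that by blast
    obtain a where "Lp_le M 2 (W u) a" using W_Lp2[OF \<open>0 \<le> u\<close>] by blast
    thus "integrable M (\<lambda>\<omega>. W u \<omega> $ i)" by (intro Lp_le_integrable[OF Lp_le_component]) auto
  qed (use that in auto)
  have square: "norm (\<integral>\<omega>. (W t \<omega> - W s \<omega>) $ i *\<^sub>R (W t \<omega> - W s \<omega>) \<partial>M) \<le> (gauss_const CARD('n) 2)\<^sup>2 * (t - s)" if "0 \<le> s" "s \<le> t" for s t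
  proof (cases "s = t")
    case False
    have L: "Lp_le M 2 (\<lambda>\<omega>. W t \<omega> - W s \<omega>) (gauss_const CARD('n) 2 * sqrt (t - s))"
      by (rule Lp_le_increment) (use that False gauss_const_pos[of 2 "CARD('n)"] in auto)
    have "norm (\<integral>\<omega>. (W t \<omega> - W s \<omega>) $ i *\<^sub>R (W t \<omega> - W s \<omega>) \<partial>M) \<le> (gauss_const CARD('n) 2 * sqrt (t - s)) * (gauss_const CARD('n) 2 * sqrt (t - s))"
      by (rule Lp_le_expectation[OF Lp_le_scaleR_fun[OF Lp_le_component[OF L] L]]) auto
    also have "\<dots> = (gauss_const CARD('n) 2)\<^sup>2 * (sqrt (t - s))\<^sup>2" by (simp add: power2_eq_square)
    finally show ?thesis using that by simp
  qed simp
  consider "r \<le> s" | "s \<le> r" "r \<le> t" | "t \<le> r" by linarith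
  thus ?thesis
  proof cases
    case 1
    thus ?thesis using past[of r s t] assms by simp
  next
    case 2
    \<comment> \<open>The increment is split at r. Its later piece is orthogonal to
      \<open>W r\<close>; for the earlier piece \<open>W r\<close> is split at s, which leaves the
      square of \<open>W r - W s\<close>.\<close>
    have "(\<integral>\<omega>. W r \<omega> $ i *\<^sub>R (W t \<omega> - W s \<omega>) \<partial>M) = (\<integral>\<omega>. (W r \<omega> $ i *\<^sub>R (W t \<omega> - W r \<omega>) +
        (W r \<omega> - W s \<omega>) $ i *\<^sub>R (W r \<omega> - W s \<omega>)) + W s \<omega> $ i *\<^sub>R (W r \<omega> - W s \<omega>) \<partial>M)"
      by (intro Bochner_Integration.integral_cong) (auto simp: algebra_simps)
    also have "\<dots> = (\<integral>\<omega>. (W r \<omega> - W s \<omega>) $ i *\<^sub>R (W r \<omega> - W s \<omega>) \<partial>M)"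
      using 2 assms by (simp only: Bochner_Integration.integral_add int Bochner_Integration.integrable_add W_Lp2 increment_Lp2 past) (simp add: past)
    also have "norm \<dots> \<le> (gauss_const CARD('n) 2)\<^sup>2 * (r - s)" using 2 assms by (intro square) auto
    also have "\<dots> \<le> (gauss_const CARD('n) 2)\<^sup>2 * (t - s)" using 2 by (intro mult_left_mono) auto
    finally show ?thesis .
  next
    case 3
    obtain a where a: "Lp_le M 2 (\<lambda>\<omega>. W t \<omega> - W s \<omega>) a" using increment_Lp2[OF assms(1,2)] by blast
    have t0: "0 \<le> t" using assms by simp
    note iff = meas_wrt_iff[OF F_sigma_algebra[OF t0]]
    have "W t \<in> borel_measurable (sigma (space M) (F t))" "W s \<in> borel_measurable (sigma (space M) (F t))"
      using W_adapted[OF t0] meas_wrt_F_mono[OF assms(1,2) W_adapted[OF assms(1)]] unfolding iff by auto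
    hence "meas_wrt M (F t) (\<lambda>\<omega>. W t \<omega> - W s \<omega>)" unfolding iff by (rule borel_measurable_diff)
    hence z: "(\<integral>\<omega>. (W r \<omega> - W t \<omega>) $ i *\<^sub>R (W t \<omega> - W s \<omega>) \<partial>M) = 0"
      using 3 assms a by (intro expectation_increment_scaleR_past[where a = a]) auto
    \<comment> \<open>Now \<open>W r\<close> is split at t and at s; the outer two pieces are
      orthogonal to the increment.\<close>
    have "(\<integral>\<omega>. W r \<omega> $ i *\<^sub>R (W t \<omega> - W s \<omega>) \<partial>M) = (\<integral>\<omega>. ((W r \<omega> - W t \<omega>) $ i *\<^sub>R (W t \<omega> - W s \<omega>) +
        (W t \<omega> - W s \<omega>) $ i *\<^sub>R (W t \<omega> - W s \<omega>)) + W s \<omega> $ i *\<^sub>R (W t \<omega> - W s \<omega>) \<partial>M)"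
      by (intro Bochner_Integration.integral_cong) (auto simp: algebra_simps)
    also have "\<dots> = (\<integral>\<omega>. (W t \<omega> - W s \<omega>) $ i *\<^sub>R (W t \<omega> - W s \<omega>) \<partial>M)"
      using 3 assms by (simp only: Bochner_Integration.integral_add int Bochner_Integration.integrable_add W_Lp2 increment_Lp2 past z) (simp add: past z)
    also have "norm \<dots> \<le> (gauss_const CARD('n) 2)\<^sup>2 * (t - s)" by (rule square[OF assms(1,2)])
    finally show ?thesis .
  qed
qed

end

section \<open>Strong error\<close>

lemma integral_eq_LBINT:
  fixes f :: "real \<Rightarrow> 'b::euclidean_space"
  assumes "continuous_on {a..b} f"
  shows "integral {a..b} f = (LBINT s:{a..b}. f s)"
  using set_borel_integral_eq_integral(2)[OF borel_integrable_atLeastAtMost'[OF assms]] by simp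

text \<open>Variation of constants centered at the terminal values. The path w need not be
  differentiable, but y - c w is; with k = f t - c w t, the derivative of exp (s / \<epsilon>) (y s
  - c w s - k) is exp (s / \<epsilon>) / \<epsilon> times the increment of f and noise between s and
  t. This pathwise formula takes the place of a stochastic convolution.\<close>

lemma relaxation_formula:
  fixes f y w :: "real \<Rightarrow> 'b::euclidean_space"
  assumes cont: "continuous_on {0..t} f" "continuous_on {0..t} y" "continuous_on {0..t} w"
    and eps: "0 < \<epsilon>" and t: "0 \<le> t" and w0: "w 0 = 0"
    and y: "\<And>s. 0 \<le> s \<Longrightarrow> s \<le> t \<Longrightarrow> y s = y 0 + integral {0..s} (\<lambda>r. (1 / \<epsilon>) *\<^sub>R (f r - y r)) + c *\<^sub>R w s"
  shows "y t - f t = exp (- t / \<epsilon>) *\<^sub>R (y 0 - f 0) + exp (- t / \<epsilon>) *\<^sub>R (f 0 - f t + c *\<^sub>R (w t - w 0))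
     + (LBINT s:{0..t}. (exp (- (t - s) / \<epsilon>) / \<epsilon>) *\<^sub>R (f s - f t + c *\<^sub>R (w t - w s)))"
proof -
  define k where "k = f t - c *\<^sub>R w t"
  define g where "g s = exp (s / \<epsilon>) *\<^sub>R (y 0 + integral {0..s} (\<lambda>r. (1 / \<epsilon>) *\<^sub>R (f r - y r)) - k)" for s
  define h where "h s = f s - f t + c *\<^sub>R (w t - w s)" for s
  have "((\<lambda>s. (exp (s / \<epsilon>) / \<epsilon>) *\<^sub>R h s) has_integral (g t - g 0)) {0..t}"
  proof (rule fundamental_theorem_of_calculus[OF t])
    fix s assume s: "s \<in> {0..t}"
    have "((\<lambda>u. integral {0..u} (\<lambda>r. (1 / \<epsilon>) *\<^sub>R (f r - y r))) has_vector_derivative (1 / \<epsilon>) *\<^sub>R (f s - y s)) (at s within {0..t})"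
      by (rule integral_has_vector_derivative[OF _ s]) (intro continuous_intros cont)
    hence i: "((\<lambda>u. y 0 + integral {0..u} (\<lambda>r. (1 / \<epsilon>) *\<^sub>R (f r - y r)) - k) has_vector_derivative (1 / \<epsilon>) *\<^sub>R (f s - y s)) (at s within {0..t})"
      by (simp only: has_vector_derivative_diff_const has_vector_derivative_add_const add.commute[of "y 0"])
    have "((\<lambda>s. exp (s / \<epsilon>)) has_field_derivative exp (s / \<epsilon>) / \<epsilon>) (at s within {0..t})"
      using eps by (auto intro!: derivative_eq_intros)
    from has_vector_derivative_scaleR[OF this i]
    have "(g has_vector_derivative (exp (s / \<epsilon>) *\<^sub>R ((1 / \<epsilon>) *\<^sub>R (f s - y s))
        + (exp (s / \<epsilon>) / \<epsilon>) *\<^sub>R (y 0 + integral {0..s} (\<lambda>r. (1 / \<epsilon>) *\<^sub>R (f r - y r)) - k))) (at s within {0..t})"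
      unfolding g_def .
    also have "exp (s / \<epsilon>) *\<^sub>R ((1 / \<epsilon>) *\<^sub>R (f s - y s))
        + (exp (s / \<epsilon>) / \<epsilon>) *\<^sub>R (y 0 + integral {0..s} (\<lambda>r. (1 / \<epsilon>) *\<^sub>R (f r - y r)) - k)
       = (exp (s / \<epsilon>) / \<epsilon>) *\<^sub>R ((f s - y s) + (y 0 + integral {0..s} (\<lambda>r. (1 / \<epsilon>) *\<^sub>R (f r - y r)) - k))"
      by (simp add: scaleR_add_right)
    also have "(f s - y s) + (y 0 + integral {0..s} (\<lambda>r. (1 / \<epsilon>) *\<^sub>R (f r - y r)) - k) = h s"
      using y[of s] s by (simp add: h_def k_def algebra_simps)
    finally show "(g has_vector_derivative (exp (s / \<epsilon>) / \<epsilon>) *\<^sub>R h s) (at s within {0..t})" .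
  qed
  moreover have "continuous_on {0..t} (\<lambda>s. (exp (s / \<epsilon>) / \<epsilon>) *\<^sub>R h s)"
    unfolding h_def using eps by (intro continuous_intros cont) auto
  ultimately have "(LBINT s:{0..t}. (exp (s / \<epsilon>) / \<epsilon>) *\<^sub>R h s) = g t - g 0"
    using integral_eq_LBINT[of 0 t "\<lambda>s. (exp (s / \<epsilon>) / \<epsilon>) *\<^sub>R h s"] by (simp add: integral_unique)
  hence "exp (- t / \<epsilon>) *\<^sub>R (LBINT s:{0..t}. (exp (s / \<epsilon>) / \<epsilon>) *\<^sub>R h s) = exp (- t / \<epsilon>) *\<^sub>R (g t - g 0)" by simp
  also have "exp (- t / \<epsilon>) *\<^sub>R (LBINT s:{0..t}. (exp (s / \<epsilon>) / \<epsilon>) *\<^sub>R h s)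
     = (LBINT s:{0..t}. (exp (- (t - s) / \<epsilon>) / \<epsilon>) *\<^sub>R h s)"
    unfolding set_integral_scaleR_right[symmetric]
    by (intro set_lebesgue_integral_cong) (auto simp: exp_add[symmetric] diff_divide_distrib)
  also have "exp (- t / \<epsilon>) *\<^sub>R (g t - g 0) = (y t - f t) - exp (- t / \<epsilon>) *\<^sub>R (y 0 - k)"
  proof -
    have "g t = exp (t / \<epsilon>) *\<^sub>R (y t - f t)" using y[of t] t by (simp add: g_def k_def algebra_simps)
    moreover have "exp (- t / \<epsilon>) * exp (t / \<epsilon>) = 1" by (simp add: exp_add[symmetric])
    moreover have "g 0 = y 0 - k" by (simp add: g_def)
    moreover have "\<alpha> *\<^sub>R (\<beta> *\<^sub>R u - v) = u - \<alpha> *\<^sub>R v" if "\<alpha> * \<beta> = 1" for \<alpha> \<beta> :: real and u v :: 'b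
      using that by (simp add: scaleR_diff_right[of \<alpha> "\<beta> *\<^sub>R u"])
    ultimately show ?thesis by simp
  qed
  finally show ?thesis using w0 by (simp add: h_def k_def algebra_simps)
qed

text \<open>A non-integrable integrand has integral 0 by convention, so the bound holds for
  arbitrary g and spares measurability obligations.\<close>

lemma norm_weighted_integral_le:
  fixes g :: "real \<Rightarrow> 'b::euclidean_space"
  assumes w: "w \<in> borel_measurable borel" "\<And>s. 0 \<le> w s" "(\<integral>\<^sup>+s. ennreal (w s) \<partial>lborel) \<le> ennreal c" and h: "0 \<le> h"
    and g: "\<And>s. w s \<noteq> 0 \<Longrightarrow> norm (g s) \<le> h" and c: "0 \<le> c"
  shows "norm (\<integral>s. w s *\<^sub>R g s \<partial>lborel) \<le> c * h"
proof (cases "integrable lborel (\<lambda>s. w s *\<^sub>R g s)")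
  case True
  have "ennreal (norm (\<integral>s. w s *\<^sub>R g s \<partial>lborel)) \<le> (\<integral>\<^sup>+s. ennreal (norm (w s *\<^sub>R g s)) \<partial>lborel)"
    by (rule integral_norm_bound_ennreal[OF True])
  also have "\<dots> \<le> (\<integral>\<^sup>+s. ennreal (w s) * ennreal h \<partial>lborel)"
  proof (intro nn_integral_mono)
    fix s
    have "w s * norm (g s) \<le> w s * h" using w(2)[of s] g[of s] by (cases "w s = 0") (auto intro: mult_left_mono)
    thus "ennreal (norm (w s *\<^sub>R g s)) \<le> ennreal (w s) * ennreal h"
      using w(2)[of s] h by (simp add: ennreal_mult[symmetric] ennreal_leI)
  qed
  also have "\<dots> = (\<integral>\<^sup>+s. ennreal (w s) \<partial>lborel) * ennreal h"
    using w(1) by (intro nn_integral_multc) auto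
  also have "\<dots> \<le> ennreal c * ennreal h" by (intro mult_right_mono w) auto
  also have "\<dots> = ennreal (c * h)" using c h by (simp add: ennreal_mult)
  finally show ?thesis using c h by (simp add: ennreal_le_iff)
next
  case False
  thus ?thesis using c h by (simp add: not_integrable_integral_eq)
qed

lemma norm_interval_integral_le:
  fixes g :: "real \<Rightarrow> 'b::euclidean_space"
  assumes "\<And>r. s \<le> r \<Longrightarrow> r \<le> t \<Longrightarrow> norm (g r) \<le> h" "t - s \<le> c" "0 \<le> c" "0 \<le> h"
  shows "norm (LBINT r:{s..t}. g r) \<le> c * h"
  unfolding set_lebesgue_integral_def
proof (rule norm_weighted_integral_le)
  have "(\<integral>\<^sup>+ r. ennreal (indicator {s..t} r) \<partial>lborel) = emeasure lborel {s..t}"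
    by (subst nn_integral_indicator[symmetric]) (auto simp: ennreal_indicator)
  also have "\<dots> \<le> ennreal c" using assms by (cases "s \<le> t") (auto intro!: ennreal_leI)
  finally show "(\<integral>\<^sup>+ r. ennreal (indicator {s..t} r) \<partial>lborel) \<le> ennreal c" .
qed (use assms in \<open>auto simp: indicator_def split: if_splits\<close>)

text \<open>The mass is 2 (1 - exp (- t / (2 \<epsilon>))), hence at most 2 uniformly in t and
  \<epsilon>.\<close>

lemma nn_integral_kernel_le:
  assumes "0 < \<epsilon>" "0 \<le> t"
  shows "(\<integral>\<^sup>+s. ennreal (indicator {0..t} s * (exp (- (t - s) / (2 * \<epsilon>)) / \<epsilon>)) \<partial>lborel) \<le> ennreal 2"
proof -
  have "((\<lambda>s. exp (- (t - s) / (2 * \<epsilon>)) / \<epsilon>) has_integral (2 * exp (- (t - t) / (2 * \<epsilon>)) - 2 * exp (- (t - 0) / (2 * \<epsilon>)))) {0..t}"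
    using assms by (intro fundamental_theorem_of_calculus)
      (auto intro!: derivative_eq_intros simp: has_real_derivative_iff_has_vector_derivative[symmetric] field_simps)
  hence "(\<integral>\<^sup>+s. ennreal (indicator {0..t} s * (exp (- (t - s) / (2 * \<epsilon>)) / \<epsilon>)) \<partial>lborel)
     = ennreal (2 * exp (- (t - t) / (2 * \<epsilon>)) - 2 * exp (- (t - 0) / (2 * \<epsilon>)))"
    using assms by (intro nn_integral_has_integral_lebesgue) auto
  also have "\<dots> \<le> ennreal 2" by (intro ennreal_leI) simp
  finally show ?thesis .
qed

lemma borel_measurable_curried:
  fixes f :: "'a::second_countable_topology \<Rightarrow> 'b::second_countable_topology \<Rightarrow> 'c::topological_space"
  assumes "continuous_on UNIV (\<lambda>z. f (fst z) (snd z))" "g \<in> borel_measurable N" "h \<in> borel_measurable N"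
  shows "(\<lambda>x. f (g x) (h x)) \<in> borel_measurable N"
proof -
  have "(\<lambda>x. (g x, h x)) \<in> borel_measurable N" using assms(2,3) by (rule borel_measurable_Pair)
  from measurable_compose[OF this borel_measurable_continuous_onI[OF assms(1)]] show ?thesis by simp
qed

lemma continuous_on_Icc_of_nonneg: "continuous_on {0..} f \<Longrightarrow> 0 \<le> a \<Longrightarrow> continuous_on {a..e} (f :: real \<Rightarrow> 'z::topological_space)"
  by (erule continuous_on_subset) auto

lemma set_integral_borel_measurable[measurable (raw)]:
  fixes f :: "'x \<Rightarrow> real \<Rightarrow> 'b::euclidean_space"
  assumes [measurable]: "case_prod f \<in> borel_measurable (N \<Otimes>\<^sub>M lborel)"
  shows "(\<lambda>\<omega>. LBINT s:{a..e}. f \<omega> s) \<in> borel_measurable N"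
  unfolding set_lebesgue_integral_def by measurable

lemma set_integrable_bounded:
  fixes f :: "real \<Rightarrow> 'b::euclidean_space"
  assumes [measurable]: "f \<in> borel_measurable borel" and b: "\<And>r. s \<le> r \<Longrightarrow> r \<le> t \<Longrightarrow> norm (f r) \<le> h"
  shows "set_integrable lborel {s..t} f"
  unfolding set_integrable_def
proof (rule integrableI_bounded_set_indicator)
  show "emeasure lborel {s..t} < \<infinity>" by (cases "s \<le> t") auto
  show "AE r in lborel. r \<in> {s..t} \<longrightarrow> norm (f r) \<le> h" using b by auto
qed auto

lemma (in prob_space) expectation_scaleR_interval_integral:
  fixes A :: "real \<Rightarrow> 'a \<Rightarrow> 'b::euclidean_space"
  assumes [measurable]: "case_prod A \<in> borel_measurable (borel \<Otimes>\<^sub>M M)"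
    and xi: "Lp_le M 2 \<xi> k" and A: "\<And>r. s \<le> r \<Longrightarrow> r \<le> t \<Longrightarrow> Lp_le M 2 (A r) a"
  shows "(\<integral>\<omega>. \<xi> \<omega> *\<^sub>R (LBINT r:{s..t}. A r \<omega>) \<partial>M) = (LBINT r:{s..t}. (\<integral>\<omega>. \<xi> \<omega> *\<^sub>R A r \<omega> \<partial>M))"
proof -
  have [measurable]: "\<xi> \<in> borel_measurable M" using xi by (simp add: Lp_le_def)
  have "(\<integral>\<omega>. \<xi> \<omega> *\<^sub>R (LBINT r:{s..t}. A r \<omega>) \<partial>M) = (\<integral>\<omega>. (LBINT r:{s..t}. \<xi> \<omega> *\<^sub>R A r \<omega>) \<partial>M)"
    by simp
  also have "\<dots> = (LBINT r:{s..t}. (\<integral>\<omega>. \<xi> \<omega> *\<^sub>R A r \<omega> \<partial>M))"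
    by (rule expectation_interval_integral[where q = 1 and a = "k * a"]) (auto intro: Lp_le_scaleR_fun[OF xi A])
  finally show ?thesis .
qed

lemma (in prob_space) expectation_scaleR_add:
  assumes "Lp_le M 2 \<xi> k" "Lp_le M 2 f a" "Lp_le M 2 g b"
  shows "(\<integral>\<omega>. \<xi> \<omega> *\<^sub>R (f \<omega> + g \<omega>) \<partial>M) = (\<integral>\<omega>. \<xi> \<omega> *\<^sub>R f \<omega> \<partial>M) + (\<integral>\<omega>. \<xi> \<omega> *\<^sub>R g \<omega> \<partial>M)"
  unfolding scaleR_add_right
  by (intro Bochner_Integration.integral_add Lp_le_integrable[OF Lp_le_scaleR_fun[OF assms(1,2)]]
      Lp_le_integrable[OF Lp_le_scaleR_fun[OF assms(1,3)]] order_refl)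

lemma (in prob_space) norm_expectation_scaleR_le:
  assumes "Lp_le M 2 \<xi> k" "Lp_le M 2 f a"
  shows "norm (\<integral>\<omega>. \<xi> \<omega> *\<^sub>R f \<omega> \<partial>M) \<le> k * a"
  by (rule Lp_le_expectation[OF Lp_le_scaleR_fun[OF assms]]) simp

lemma bounded_linear_borel_measurable:
  fixes L :: "'b::euclidean_space \<Rightarrow> 'c::euclidean_space"
  assumes "linear L" "f \<in> borel_measurable N"
  shows "(\<lambda>\<omega>. L (f \<omega>)) \<in> borel_measurable N"
  using borel_measurable_continuous_onI[OF linear_continuous_on[OF assms(1)[unfolded linear_conv_bounded_linear]]] assms(2)
  by (rule measurable_compose[rotated])

lemma integral_linear:
  fixes L :: "'b::euclidean_space \<Rightarrow> 'c::euclidean_space"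
  assumes "linear L" "integrable N f"
  shows "(\<integral>\<omega>. L (f \<omega>) \<partial>N) = L (\<integral>\<omega>. f \<omega> \<partial>N)"
  using integral_bounded_linear[OF assms(1)[unfolded linear_conv_bounded_linear] assms(2)] by simp

text \<open>The setting at one fixed \<epsilon>, stripped of the filtration: W enters through
  continuous paths from 0, through moments, means and covariances of its increments, and through its
  orthogonality to the initial velocity fluctuation. \<open>B\<close> bounds the coefficients,
  \<kappa> that fluctuation and \<open>c\<close> the noise; \<open>bt\<close> and \<open>b'\<close>
  are the time and space derivatives of \<open>b\<close>. The lower bounds 1 on \<open>T\<close>,
  \<open>B\<close>, \<kappa> and \<open>c\<close> are normalisations. Joint measurability is there
  for Fubini.\<close>

locale kinetic = prob_space M
  for M :: "'a measure" +
  fixes b G bt :: "real^'n \<Rightarrow> real \<Rightarrow> real^'n" and b' G' :: "real^'n \<Rightarrow> real \<Rightarrow> real^'n \<Rightarrow> real^'n"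
    and B T p \<kappa> c \<epsilon> :: real and x :: "real^'n" and X V Z W :: "real \<Rightarrow> 'a \<Rightarrow> real^'n"
  assumes b_C3: "C3_le T B b b'"
    and G_C2: "C2_le T B G G'" and G_continuous: "continuous_on UNIV (\<lambda>z. G (fst z) (snd z))"
    and b_lipschitz: "\<And>y y' t t'. t \<in> {0..T} \<Longrightarrow> t' \<in> {0..T} \<Longrightarrow> norm (b y t - b y' t') \<le> B * (norm (y - y') + \<bar>t - t'\<bar>)"
    and b_derivative: "\<And>y t. ((\<lambda>z. b (fst z) (snd z)) has_derivative (\<lambda>v. b' y t (fst v) + snd v *\<^sub>R bt y t)) (at (y, t))"
    and G_eq: "\<And>y t. G y t = bt y t + b' y t (b y t)"
    and T1: "1 \<le> T" and B1: "1 \<le> B" and kappa1: "1 \<le> \<kappa>" and c_ge1: "1 \<le> c" and p4: "4 \<le> p" and eps: "0 < \<epsilon>" "\<epsilon> < 1"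
    and X_jm: "case_prod X \<in> borel_measurable (borel \<Otimes>\<^sub>M M)"
    and V_jm: "case_prod V \<in> borel_measurable (borel \<Otimes>\<^sub>M M)"
    and Z_jm: "case_prod Z \<in> borel_measurable (borel \<Otimes>\<^sub>M M)"
    and W_jm: "case_prod W \<in> borel_measurable (borel \<Otimes>\<^sub>M M)"
    and paths: "AE \<omega> in M. continuous_on {0..} (\<lambda>t. X t \<omega>) \<and> continuous_on {0..} (\<lambda>t. V t \<omega>) \<and>
        continuous_on {0..} (\<lambda>t. Z t \<omega>) \<and> continuous_on {0..} (\<lambda>t. W t \<omega>) \<and> W 0 \<omega> = 0 \<and>
        (\<forall>t\<ge>0. X t \<omega> = x + integral {0..t} (\<lambda>s. V s \<omega>) \<and>
          V t \<omega> = V 0 \<omega> + integral {0..t} (\<lambda>s. (1 / \<epsilon>) *\<^sub>R (b (X s \<omega>) s - V s \<omega>)) + sqrt (2 / \<epsilon>) *\<^sub>R W t \<omega> \<and>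
          Z t \<omega> = x + integral {0..t} (\<lambda>s. b (Z s \<omega>) s - \<epsilon> *\<^sub>R G (Z s \<omega>) s) + sqrt (2 * \<epsilon>) *\<^sub>R W t \<omega>)"
    and V0_Lp: "Lp_le M p (\<lambda>\<omega>. V 0 \<omega> - b x 0) \<kappa>" and V0_mean: "(\<integral>\<omega>. V 0 \<omega> - b x 0 \<partial>M) = 0"
    and W_Lp: "\<And>s t a. 0 \<le> s \<Longrightarrow> s \<le> t \<Longrightarrow> c * sqrt (t - s) \<le> a \<Longrightarrow> 0 < a \<Longrightarrow> Lp_le M p (\<lambda>\<omega>. W t \<omega> - W s \<omega>) a"
    and W_mean: "\<And>s t. 0 \<le> s \<Longrightarrow> s \<le> t \<Longrightarrow> (\<integral>\<omega>. W t \<omega> - W s \<omega> \<partial>M) = 0"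
    and W_covariance: "\<And>r s t i. 0 \<le> r \<Longrightarrow> 0 \<le> s \<Longrightarrow> s \<le> t \<Longrightarrow> norm (\<integral>\<omega>. W r \<omega> $ i *\<^sub>R (W t \<omega> - W s \<omega>) \<partial>M) \<le> c * (t - s)"
    and W_V0: "\<And>r i. 0 \<le> r \<Longrightarrow> (\<integral>\<omega>. W r \<omega> $ i *\<^sub>R (V 0 \<omega> - b x 0) \<partial>M) = 0"
begin

section \<open>Pathwise equations with Lebesgue integrals\<close>

lemma b_C2: "C2_le T B b b'" and b_continuous: "continuous_on UNIV (\<lambda>z. b (fst z) (snd z))"
  using b_C3 by (auto simp: C3_le_def)

lemma p1: "1 \<le> p" and p0: "0 \<le> p" and B0: "0 \<le> B" and T0: "0 \<le> T" and c0: "0 \<le> c"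
  using p4 B1 T1 c_ge1 by auto

lemmas [measurable] = X_jm V_jm Z_jm W_jm

lemma X_measurable[measurable (raw)]: "g \<in> borel_measurable N \<Longrightarrow> h \<in> measurable N M \<Longrightarrow> (\<lambda>x. X (g x) (h x)) \<in> borel_measurable N"
  and V_measurable[measurable (raw)]: "g \<in> borel_measurable N \<Longrightarrow> h \<in> measurable N M \<Longrightarrow> (\<lambda>x. V (g x) (h x)) \<in> borel_measurable N"
  and Z_measurable[measurable (raw)]: "g \<in> borel_measurable N \<Longrightarrow> h \<in> measurable N M \<Longrightarrow> (\<lambda>x. Z (g x) (h x)) \<in> borel_measurable N"
  and W_measurable[measurable (raw)]: "g \<in> borel_measurable N \<Longrightarrow> h \<in> measurable N M \<Longrightarrow> (\<lambda>x. W (g x) (h x)) \<in> borel_measurable N"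
  by (rule measurable_Pair_compose_split[OF X_jm] measurable_Pair_compose_split[OF V_jm]
      measurable_Pair_compose_split[OF Z_jm] measurable_Pair_compose_split[OF W_jm]; assumption)+

lemmas b_measurable[measurable (raw)] = borel_measurable_curried[OF b_continuous]
  and G_measurable[measurable (raw)] = borel_measurable_curried[OF G_continuous]

lemma b_bound: "t \<in> {0..T} \<Longrightarrow> norm (b y t) \<le> B" and G_bound: "t \<in> {0..T} \<Longrightarrow> norm (G y t) \<le> B"
  using b_C2 G_C2 by (auto simp: C2_le_def)

lemma continuous_on_path:
  assumes "continuous_on UNIV (\<lambda>z. f (fst z) (snd z))" "continuous_on S y"
  shows "continuous_on S (\<lambda>s. f (y s) s)"
  using continuous_on_compose2[OF assms(1) continuous_on_Pair[OF assms(2) continuous_on_id]] by simp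

lemma X_increment: "AE \<omega> in M. \<forall>s\<ge>0. \<forall>t\<ge>s. X t \<omega> - X s \<omega> = (LBINT r:{s..t}. V r \<omega>)"
  using paths
proof eventually_elim
  case (elim \<omega>)
  show ?case
  proof (intro allI impI)
    fix s t :: real assume st: "0 \<le> s" "s \<le> t"
    have c: "continuous_on {a..t} (\<lambda>r. V r \<omega>)" if "0 \<le> a" for a
      using elim that by (intro continuous_on_Icc_of_nonneg) auto
    have "integral {0..s} (\<lambda>r. V r \<omega>) + integral {s..t} (\<lambda>r. V r \<omega>) = integral {0..t} (\<lambda>r. V r \<omega>)"
      by (rule Henstock_Kurzweil_Integration.integral_combine) (use st c[of 0] in \<open>auto intro: integrable_continuous_real\<close>)
    moreover have "X t \<omega> = x + integral {0..t} (\<lambda>r. V r \<omega>)" "X s \<omega> = x + integral {0..s} (\<lambda>r. V r \<omega>)"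
      using elim st by auto
    ultimately have "X t \<omega> - X s \<omega> = integral {s..t} (\<lambda>r. V r \<omega>)" by (simp add: algebra_simps)
    thus "X t \<omega> - X s \<omega> = (LBINT r:{s..t}. V r \<omega>)" using integral_eq_LBINT[OF c] st by simp
  qed
qed

lemma Z_equation: "AE \<omega> in M. \<forall>t\<ge>0. Z t \<omega> = x + (LBINT s:{0..t}. b (Z s \<omega>) s)
      - \<epsilon> *\<^sub>R (LBINT s:{0..t}. G (Z s \<omega>) s) + sqrt (2 * \<epsilon>) *\<^sub>R W t \<omega>"
  using paths
proof eventually_elim
  case (elim \<omega>)
  show ?case
  proof (intro allI impI)
    fix t :: real assume t: "0 \<le> t"
    have cZ: "continuous_on {0..t} (\<lambda>r. Z r \<omega>)"
      using elim by (intro continuous_on_Icc_of_nonneg) auto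
    note cb = continuous_on_path[OF b_continuous cZ] and cG = continuous_on_path[OF G_continuous cZ]
    have "Z t \<omega> = x + integral {0..t} (\<lambda>s. b (Z s \<omega>) s - \<epsilon> *\<^sub>R G (Z s \<omega>) s) + sqrt (2 * \<epsilon>) *\<^sub>R W t \<omega>"
      using elim t by blast
    also have "integral {0..t} (\<lambda>s. b (Z s \<omega>) s - \<epsilon> *\<^sub>R G (Z s \<omega>) s)
       = integral {0..t} (\<lambda>s. b (Z s \<omega>) s) - \<epsilon> *\<^sub>R integral {0..t} (\<lambda>s. G (Z s \<omega>) s)"
      by (subst Henstock_Kurzweil_Integration.integral_diff) (auto intro!: integrable_continuous_real continuous_intros cb cG)
    finally show "Z t \<omega> = x + (LBINT s:{0..t}. b (Z s \<omega>) s)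
      - \<epsilon> *\<^sub>R (LBINT s:{0..t}. G (Z s \<omega>) s) + sqrt (2 * \<epsilon>) *\<^sub>R W t \<omega>"
      by (simp add: integral_eq_LBINT[OF cb] integral_eq_LBINT[OF cG])
  qed
qed

definition D :: "real \<Rightarrow> 'a \<Rightarrow> real^'n" where "D t \<omega> = X t \<omega> - Z t \<omega>"

lemma D_measurable[measurable (raw)]: 
  assumes [measurable]: "g \<in> borel_measurable N" "h \<in> measurable N M"
  shows "(\<lambda>x. D (g x) (h x)) \<in> borel_measurable N"
  unfolding D_def by measurable

lemma D_equation: "AE \<omega> in M. \<forall>t\<ge>0. D t \<omega> = (LBINT s:{0..t}. b (X s \<omega>) s - b (Z s \<omega>) s)
      + (\<epsilon> *\<^sub>R (LBINT s:{0..t}. G (Z s \<omega>) s) - \<epsilon> *\<^sub>R (V t \<omega> - V 0 \<omega>))"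
  using paths Z_equation
proof eventually_elim
  case (elim \<omega>)
  show ?case
  proof (intro allI impI)
    fix t :: real assume t: "0 \<le> t"
    have cZ: "continuous_on {0..t} (\<lambda>r. Z r \<omega>)" and cX: "continuous_on {0..t} (\<lambda>r. X r \<omega>)" and cV: "continuous_on {0..t} (\<lambda>r. V r \<omega>)"
      using elim by (auto intro: continuous_on_Icc_of_nonneg)
    note cb = continuous_on_path[OF b_continuous cZ] and cbX = continuous_on_path[OF b_continuous cX]
    have "V t \<omega> = V 0 \<omega> + integral {0..t} (\<lambda>s. (1 / \<epsilon>) *\<^sub>R (b (X s \<omega>) s - V s \<omega>)) + sqrt (2 / \<epsilon>) *\<^sub>R W t \<omega>"
      using elim t by blast
    also have "integral {0..t} (\<lambda>s. (1 / \<epsilon>) *\<^sub>R (b (X s \<omega>) s - V s \<omega>))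
       = (1 / \<epsilon>) *\<^sub>R (integral {0..t} (\<lambda>s. b (X s \<omega>) s) - integral {0..t} (\<lambda>s. V s \<omega>))"
      by (subst Henstock_Kurzweil_Integration.integral_diff[symmetric]) (auto intro!: integrable_continuous_real cV cbX)
    also have "integral {0..t} (\<lambda>s. V s \<omega>) = X t \<omega> - x" using elim t by simp
    finally have "\<epsilon> *\<^sub>R V t \<omega> = \<epsilon> *\<^sub>R V 0 \<omega> + (\<epsilon> * (1 / \<epsilon>)) *\<^sub>R (integral {0..t} (\<lambda>s. b (X s \<omega>) s) - (X t \<omega> - x)) + (\<epsilon> * sqrt (2 / \<epsilon>)) *\<^sub>R W t \<omega>"
      by (simp add: scaleR_add_right)
    \<comment> \<open>The relaxation time \<epsilon> times the noise amplitude of the velocity is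
      exactly the noise amplitude in \<open>Z\<close>.\<close>
    moreover have "\<epsilon> * sqrt (2 / \<epsilon>) = sqrt (2 * \<epsilon>)" using eps
      by (simp add: real_sqrt_mult real_sqrt_divide field_simps) 
    ultimately have hX: "X t \<omega> = x + integral {0..t} (\<lambda>s. b (X s \<omega>) s) - \<epsilon> *\<^sub>R (V t \<omega> - V 0 \<omega>) + sqrt (2 * \<epsilon>) *\<^sub>R W t \<omega>"
      using eps by (simp add: algebra_simps)
    have hZ: "Z t \<omega> = x + (LBINT s:{0..t}. b (Z s \<omega>) s)
      - \<epsilon> *\<^sub>R (LBINT s:{0..t}. G (Z s \<omega>) s) + sqrt (2 * \<epsilon>) *\<^sub>R W t \<omega>"
      using elim t by blast
    have hI: "(LBINT s:{0..t}. b (X s \<omega>) s - b (Z s \<omega>) s) = (LBINT s:{0..t}. b (X s \<omega>) s) - (LBINT s:{0..t}. b (Z s \<omega>) s)"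
      by (rule set_integral_diff(2)) (auto intro!: borel_integrable_atLeastAtMost' cb cbX)
    show "D t \<omega> = (LBINT s:{0..t}. b (X s \<omega>) s - b (Z s \<omega>) s)
      + (\<epsilon> *\<^sub>R (LBINT s:{0..t}. G (Z s \<omega>) s) - \<epsilon> *\<^sub>R (V t \<omega> - V 0 \<omega>))"
    proof -
      have "(x + u - v + w) - (x + u' - v' + w) = (u - u') + (v' - v)" for u v w u' v' :: "real^'n" by simp
      from this[of "LBINT s:{0..t}. b (X s \<omega>) s" "\<epsilon> *\<^sub>R (V t \<omega> - V 0 \<omega>)" "sqrt (2 * \<epsilon>) *\<^sub>R W t \<omega>"
          "LBINT s:{0..t}. b (Z s \<omega>) s" "\<epsilon> *\<^sub>R (LBINT s:{0..t}. G (Z s \<omega>) s)"]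
      show ?thesis unfolding D_def hI hX[unfolded integral_eq_LBINT[OF cbX], symmetric] hZ[symmetric] .
    qed
  qed
qed

text \<open>The velocity relaxes to the drift through an average of the past increments \<open>lag s t\<close> against
  \<open>exp (- (t - s) / \<epsilon>) / \<epsilon>\<close>. This weight is split into the integrable \<open>kernel\<close> and a factor \<open>damp\<close>, both of half
  the rate, so that \<open>damp\<close> absorbs the growth of the increments in \<open>t - s\<close>.\<close>

definition vel :: "real \<Rightarrow> 'a \<Rightarrow> real^'n" where "vel t \<omega> = V t \<omega> - b (X t \<omega>) t"

definition lag :: "real \<Rightarrow> real \<Rightarrow> 'a \<Rightarrow> real^'n" where
  "lag s t \<omega> = b (X s \<omega>) s - b (X t \<omega>) t + sqrt (2 / \<epsilon>) *\<^sub>R (W t \<omega> - W s \<omega>)"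

definition damp :: "real \<Rightarrow> real \<Rightarrow> real" where "damp s t = exp (- (t - s) / (2 * \<epsilon>))"

definition kernel :: "real \<Rightarrow> real \<Rightarrow> real" where
  "kernel t s = indicator {0..t} s * (damp s t / \<epsilon>)"

lemma vel_measurable[measurable (raw)]: 
  assumes [measurable]: "g \<in> borel_measurable N" "h \<in> measurable N M"
  shows "(\<lambda>x. vel (g x) (h x)) \<in> borel_measurable N"
  unfolding vel_def by measurable

lemma damp_measurable[measurable (raw)]: 
  assumes [measurable]: "f \<in> borel_measurable N" "g \<in> borel_measurable N"
  shows "(\<lambda>x. damp (f x) (g x)) \<in> borel_measurable N"
  unfolding damp_def by measurable

lemma lag_measurable[measurable (raw)]: 
  assumes [measurable]: "f \<in> borel_measurable N" "g \<in> borel_measurable N" "h \<in> measurable N M"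
  shows "(\<lambda>x. lag (f x) (g x) (h x)) \<in> borel_measurable N"
  unfolding lag_def by measurable

lemma damp_bounds: "0 < damp s t" "s \<le> t \<Longrightarrow> damp s t \<le> 1"
  using eps by (auto simp: damp_def divide_nonpos_pos)

lemma kernel_nonneg: "0 \<le> kernel t s"
  and kernel_measurable[measurable]: "kernel t \<in> borel_measurable borel"
  and kernel_nz: "kernel t s \<noteq> 0 \<Longrightarrow> 0 \<le> s \<and> s \<le> t"
  and kernel_integral: "0 \<le> t \<Longrightarrow> (\<integral>\<^sup>+s. ennreal (kernel t s) \<partial>lborel) \<le> ennreal 2"
proof -
  show "0 \<le> kernel t s" using eps damp_bounds(1)[of s t] by (auto simp: kernel_def)
  show "kernel t \<in> borel_measurable borel" unfolding kernel_def by measurable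
  show "kernel t s \<noteq> 0 \<Longrightarrow> 0 \<le> s \<and> s \<le> t" by (auto simp: kernel_def indicator_def split: if_splits)
  show "0 \<le> t \<Longrightarrow> (\<integral>\<^sup>+s. ennreal (kernel t s) \<partial>lborel) \<le> ennreal 2"
    unfolding kernel_def damp_def by (rule nn_integral_kernel_le[OF eps(1)])
qed

text \<open>\<open>relaxation_formula\<close> with y = V and f the drift along X; each weight exp (-
  (t - s) / \<epsilon>) is written as two factors \<open>damp\<close>, one of which goes into
  \<open>kernel\<close>.\<close>

lemma vel_equation: "AE \<omega> in M. \<forall>t\<ge>0. vel t \<omega> = damp 0 t ^ 2 *\<^sub>R (V 0 \<omega> - b x 0)
     + damp 0 t *\<^sub>R (damp 0 t *\<^sub>R lag 0 t \<omega>) + (\<integral>s. kernel t s *\<^sub>R (damp s t *\<^sub>R lag s t \<omega>) \<partial>lborel)"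
  using paths
proof eventually_elim
  case (elim \<omega>)
  show ?case
  proof (intro allI impI)
    fix t :: real assume t: "0 \<le> t"
    have cX: "continuous_on {0..t} (\<lambda>r. X r \<omega>)" and cV: "continuous_on {0..t} (\<lambda>r. V r \<omega>)"
      and cW: "continuous_on {0..t} (\<lambda>r. W r \<omega>)" and W0: "W 0 \<omega> = 0" and X0: "X 0 \<omega> = x"
      using elim by (auto intro: continuous_on_Icc_of_nonneg)
    have sq: "exp (- (t - s) / \<epsilon>) = damp s t * damp s t" for s
      using eps by (simp add: damp_def exp_add[symmetric] field_simps)
    have yeq: "V s \<omega> = V 0 \<omega> + integral {0..s} (\<lambda>r. (1 / \<epsilon>) *\<^sub>R (b (X r \<omega>) r - V r \<omega>)) + sqrt (2 / \<epsilon>) *\<^sub>R W s \<omega>"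
      if "0 \<le> s" for s using elim that by blast
    have "vel t \<omega> = exp (- t / \<epsilon>) *\<^sub>R (V 0 \<omega> - b (X 0 \<omega>) 0)
       + exp (- t / \<epsilon>) *\<^sub>R (b (X 0 \<omega>) 0 - b (X t \<omega>) t + sqrt (2 / \<epsilon>) *\<^sub>R (W t \<omega> - W 0 \<omega>))
       + (LBINT s:{0..t}. (exp (- (t - s) / \<epsilon>) / \<epsilon>) *\<^sub>R (b (X s \<omega>) s - b (X t \<omega>) t + sqrt (2 / \<epsilon>) *\<^sub>R (W t \<omega> - W s \<omega>)))"
      unfolding vel_def
      by (rule relaxation_formula[OF continuous_on_path[OF b_continuous cX] cV cW eps(1) t W0 yeq])
    also have "exp (- t / \<epsilon>) = damp 0 t * damp 0 t" using sq[of 0] by simp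
    also have "(LBINT s:{0..t}. (exp (- (t - s) / \<epsilon>) / \<epsilon>) *\<^sub>R (b (X s \<omega>) s - b (X t \<omega>) t + sqrt (2 / \<epsilon>) *\<^sub>R (W t \<omega> - W s \<omega>)))
        = (\<integral>s. kernel t s *\<^sub>R (damp s t *\<^sub>R lag s t \<omega>) \<partial>lborel)"
      unfolding set_lebesgue_integral_def sq kernel_def lag_def by (intro Bochner_Integration.integral_cong) auto
    finally show "vel t \<omega> = damp 0 t ^ 2 *\<^sub>R (V 0 \<omega> - b x 0)
     + damp 0 t *\<^sub>R (damp 0 t *\<^sub>R lag 0 t \<omega>) + (\<integral>s. kernel t s *\<^sub>R (damp s t *\<^sub>R lag s t \<omega>) \<partial>lborel)"
      by (simp add: X0 lag_def power2_eq_square)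
  qed
qed

text \<open>Both follow from v \<le> exp v, with time measured in units of 2 \<epsilon>: after
  damping, a lag counts for at most 2 \<epsilon> and its square root for at most sqrt
  \<epsilon>.\<close>

lemma sqrt_le_damp: "s \<le> t \<Longrightarrow> sqrt (t - s) \<le> sqrt \<epsilon> / damp s t"
  and lin_le_damp: "s \<le> t \<Longrightarrow> t - s \<le> 2 * \<epsilon> / damp s t"
proof -
  assume st: "s \<le> t"
  define v where "v = (t - s) / (2 * \<epsilon>)"
  have v: "t - s = 2 * \<epsilon> * v" "0 \<le> v" using eps st by (auto simp: v_def)
  have "damp s t = exp (- v)" by (simp add: damp_def v_def minus_divide_left)
  hence d: "1 / damp s t = exp v" by (simp add: exp_minus divide_inverse)
  have "v \<le> exp v" using exp_ge_add_one_self[of v] by linarith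
  thus "t - s \<le> 2 * \<epsilon> / damp s t"
    using eps v d mult_left_mono[of v "exp v" "2 * \<epsilon>"] by (metis less_eq_real_def mult.right_neutral mult_pos_pos times_divide_eq_right zero_less_numeral)
  have "2 * v \<le> exp (2 * v)" using exp_ge_add_one_self[of "2 * v"] by linarith
  hence "sqrt (t - s) \<le> sqrt (\<epsilon> * exp (2 * v))" using eps v by (intro real_sqrt_le_mono) (simp add: mult.assoc[symmetric])
  also have "\<dots> = sqrt \<epsilon> * exp v" by (simp add: real_sqrt_mult exp_double)
  also have "\<dots> = sqrt \<epsilon> * (1 / damp s t)" by (simp only: d)
  finally show "sqrt (t - s) \<le> sqrt \<epsilon> / damp s t" by simp
qed

text \<open>The amplitude sqrt (2 / \<epsilon>) meets a damped Brownian increment of size sqrt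
  \<epsilon>, so the product is of order one. For the drift part boundedness suffices here.\<close>

lemma Lp_damp_lag:
  assumes "0 \<le> s" "s \<le> t" "t \<le> T"
  shows "Lp_le M p (\<lambda>\<omega>. damp s t *\<^sub>R lag s t \<omega>) (2 * B + 2 * c)"
proof -
  have "Lp_le M p (\<lambda>\<omega>. damp s t *\<^sub>R (b (X s \<omega>) s - b (X t \<omega>) t)) (2 * B)"
  proof (rule Lp_le_bounded)
    show "AE \<omega> in M. norm (damp s t *\<^sub>R (b (X s \<omega>) s - b (X t \<omega>) t)) \<le> 2 * B"
    proof (rule AE_I2)
      fix \<omega>
      have "norm (b (X s \<omega>) s - b (X t \<omega>) t) \<le> B + B"
        using assms by (intro norm_triangle_le_diff add_mono b_bound) auto
      hence "damp s t * norm (b (X s \<omega>) s - b (X t \<omega>) t) \<le> 1 * (2 * B)"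
        using damp_bounds assms by (intro mult_mono) (auto intro: less_imp_le)
      thus "norm (damp s t *\<^sub>R (b (X s \<omega>) s - b (X t \<omega>) t)) \<le> 2 * B" using damp_bounds(1)[of s t] by simp
    qed
  qed (use B1 p0 in auto)
  moreover have "Lp_le M p (\<lambda>\<omega>. (damp s t * sqrt (2 / \<epsilon>)) *\<^sub>R (W t \<omega> - W s \<omega>)) (2 * c)"
  proof (rule Lp_le_scaleR[OF W_Lp])
    show "c * sqrt (t - s) \<le> c * (sqrt \<epsilon> / damp s t)" using sqrt_le_damp[of s t] assms c0 by (intro mult_left_mono)
    have "\<bar>damp s t * sqrt (2 / \<epsilon>)\<bar> * (c * (sqrt \<epsilon> / damp s t)) = c * sqrt 2"
      using eps damp_bounds(1)[of s t] c0 by (simp add: abs_mult real_sqrt_divide)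
    also have "\<dots> \<le> c * 2" using c0 by (intro mult_left_mono) (auto simp: real_le_lsqrt)
    finally show "\<bar>damp s t * sqrt (2 / \<epsilon>)\<bar> * (c * (sqrt \<epsilon> / damp s t)) \<le> 2 * c" by simp
  qed (use assms c_ge1 eps damp_bounds(1) p0 in auto)
  ultimately have "Lp_le M p (\<lambda>\<omega>. damp s t *\<^sub>R (b (X s \<omega>) s - b (X t \<omega>) t) + (damp s t * sqrt (2 / \<epsilon>)) *\<^sub>R (W t \<omega> - W s \<omega>)) (2 * B + 2 * c)"
    by (rule Lp_le_add[OF _ _ p1])
  thus ?thesis by (simp add: lag_def scaleR_add_right)
qed

text \<open>\<kappa> accounts for the initial fluctuation; the boundary lag counts once and the
  kernel average, of mass 2, counts twice, which makes three times 2 B + 2 c.\<close>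

lemma Lp_vel:
  assumes "0 \<le> t" "t \<le> T"
  shows "Lp_le M p (vel t) (\<kappa> + 6 * B + 6 * c)"
proof -
  have h: "0 < 2 * B + 2 * c" using B1 c_ge1 by simp
  have 1: "Lp_le M p (\<lambda>\<omega>. damp 0 t ^ 2 *\<^sub>R (V 0 \<omega> - b x 0)) \<kappa>"
    using kappa1 p0 damp_bounds[of 0 t] assms
    by (intro Lp_le_scaleR[OF V0_Lp]) (auto simp: power_le_one mult_left_le_one_le)
  have 2: "Lp_le M p (\<lambda>\<omega>. damp 0 t *\<^sub>R (damp 0 t *\<^sub>R lag 0 t \<omega>)) (2 * B + 2 * c)"
    using damp_bounds[of 0 t] assms p0 h
    by (intro Lp_le_scaleR[OF Lp_damp_lag]) (auto simp: mult_left_le_one_le)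
  have 3: "Lp_le M p (\<lambda>\<omega>. \<integral>s. kernel t s *\<^sub>R (damp s t *\<^sub>R lag s t \<omega>) \<partial>lborel) (2 * (2 * B + 2 * c))"
  proof (rule Lp_le_weighted_integral[OF _ kernel_measurable kernel_nonneg kernel_integral _ h p1])
    fix s assume "kernel t s \<noteq> 0"
    hence "0 \<le> s" "s \<le> t" using kernel_nz by blast+
    thus "Lp_le M p (\<lambda>\<omega>. damp s t *\<^sub>R lag s t \<omega>) (2 * B + 2 * c)" using assms by (intro Lp_damp_lag)
  qed (use assms in \<open>auto, measurable\<close>)
  show ?thesis
  proof (rule Lp_le_cong_AE[OF Lp_le_mono[OF Lp_le_add[OF Lp_le_add[OF 1 2 p1] 3 p1]]])
    show "AE \<omega> in M. vel t \<omega> = damp 0 t ^ 2 *\<^sub>R (V 0 \<omega> - b x 0)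
     + damp 0 t *\<^sub>R (damp 0 t *\<^sub>R lag 0 t \<omega>) + (\<integral>s. kernel t s *\<^sub>R (damp s t *\<^sub>R lag s t \<omega>) \<partial>lborel)"
      using vel_equation by eventually_elim (use assms in auto)
  qed (use p0 in \<open>auto simp: algebra_simps\<close>)
qed

text \<open>The bound of \<open>vel\<close> enlarged by B, the size of the drift.\<close>

definition "cV = \<kappa> + 7 * B + 6 * c"

lemma cV_pos: "0 < cV" using kappa1 B1 c_ge1 by (simp add: cV_def)

lemma Lp_V:
  assumes "0 \<le> t" "t \<le> T"
  shows "Lp_le M p (V t) cV"
proof -
  have "Lp_le M p (\<lambda>\<omega>. b (X t \<omega>) t) B"
    using assms B1 p0 b_bound by (intro Lp_le_bounded) auto
  from Lp_le_add[OF Lp_vel[OF assms] this p1] show ?thesis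
    by (simp add: vel_def cV_def algebra_simps)
qed

text \<open>Gronwall's 4 r exp (2 L T) with L = 2 B and r = \<epsilon> (T B + 2 \<open>cV\<close>),
  divided by \<epsilon>.\<close>

definition "cD = 4 * (T * B + 2 * cV) * exp (4 * B * T)"

lemma cD_pos: "0 < cD" using cV_pos T1 B1 by (simp add: cD_def add_pos_pos)

text \<open>In \<open>D_equation\<close> everything but the drift difference is \<epsilon> times a
  quantity of order one in L^p. The a priori bound that Gronwall requires comes from boundedness of
  the drift.\<close>

lemma Lp_D:
  assumes "0 \<le> t" "t \<le> T"
  shows "Lp_le M p (D t) (cD * \<epsilon>)"
proof -
  define r where "r = \<epsilon> * (T * B + 2 * cV)"
  have r: "0 < r" using eps cV_pos T1 B1 by (simp add: r_def add_pos_pos)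
  have R: "Lp_le M p (\<lambda>\<omega>. \<epsilon> *\<^sub>R (LBINT s:{0..t}. G (Z s \<omega>) s) - \<epsilon> *\<^sub>R (V t \<omega> - V 0 \<omega>)) r"
    if t: "0 \<le> t" "t \<le> T" for t
  proof -
    have "Lp_le M p (\<lambda>\<omega>. LBINT s:{0..t}. G (Z s \<omega>) s) (T * B)"
      using t T1 B1 p1 p0 by (intro Lp_le_interval_integral Lp_le_bounded) (auto intro!: G_bound)
    hence 1: "Lp_le M p (\<lambda>\<omega>. \<epsilon> *\<^sub>R (LBINT s:{0..t}. G (Z s \<omega>) s)) (\<epsilon> * (T * B))"
      by (rule Lp_le_scaleR) (use eps T1 B1 p0 in auto)
    have 2: "Lp_le M p (\<lambda>\<omega>. \<epsilon> *\<^sub>R (V t \<omega> - V 0 \<omega>)) (\<epsilon> * (cV + cV))"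
      by (rule Lp_le_scaleR[OF Lp_le_diff[OF Lp_V Lp_V p1]]) (use t T0 eps cV_pos p0 in auto)
    show ?thesis by (rule Lp_le_mono[OF Lp_le_diff[OF 1 2 p1]]) (use p0 in \<open>auto simp: r_def algebra_simps\<close>)
  qed
  let ?A = "\<lambda>s \<omega>. b (X s \<omega>) s - b (Z s \<omega>) s"
  have "Lp_le M p (D t) (4 * r * exp (2 * (2 * B) * T))"
  proof (rule Lp_le_gronwall[where A = ?A])
    show "Lp_le M p (D t) (T * (2 * B) + r)" if t: "0 \<le> t" "t \<le> T" for t
    proof -
      have "norm (?A s \<omega>) \<le> 2 * B" if "0 \<le> s" "s \<le> T" for s \<omega>
        using norm_triangle_le_diff[of "b (X s \<omega>) s" "b (Z s \<omega>) s" "2 * B"] b_bound[of s "X s \<omega>"] b_bound[of s "Z s \<omega>"] that by auto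
      hence "Lp_le M p (\<lambda>\<omega>. LBINT s:{0..t}. ?A s \<omega>) (T * (2 * B))"
        using t T1 B1 p1 p0 by (intro Lp_le_interval_integral Lp_le_bounded) auto
      from Lp_le_add[OF this R[OF t] p1] show ?thesis
        by (rule Lp_le_cong_AE) (use D_equation p0 t in \<open>auto elim!: eventually_mono\<close>)
    qed
    show "Lp_le M p (?A s) (2 * B * a + r)" if s: "0 \<le> s" "s \<le> T" "Lp_le M p (D s) a" for s a
    proof -
      have "Lp_le M p (\<lambda>\<omega>. (2 * B) *\<^sub>R D s \<omega>) (2 * B * a)"
        using s B1 p0 Lp_le_pos[OF s(3)] by (intro Lp_le_scaleR[OF s(3)]) auto
      hence "Lp_le M p (?A s) (2 * B * a)"
        by (rule Lp_le_dominated) (use C2_le_lipschitz[OF b_C2] s B1 p0 in \<open>auto simp: D_def\<close>)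
      thus ?thesis by (rule Lp_le_mono) (use r p0 in auto)
    qed
    show "Lp_le M p (\<lambda>\<omega>. D t \<omega> - (LBINT s:{0..t}. ?A s \<omega>)) r" if t: "0 \<le> t" "t \<le> T" for t
      by (rule Lp_le_cong_AE[OF R[OF t]]) (use D_equation p0 t in \<open>auto elim!: eventually_mono intro!: borel_measurable_diff set_integral_borel_measurable\<close>)
  qed (use assms r p1 B1 T0 in auto)
  thus ?thesis by (rule Lp_le_mono) (use p0 in \<open>auto simp: cD_def r_def algebra_simps\<close>)
qed


section \<open>Fluctuations around the mean path\<close>

lemma Lp_down: "Lp_le M p f a \<Longrightarrow> 1 \<le> r \<Longrightarrow> r \<le> 4 \<Longrightarrow> Lp_le M r f a"
  by (rule Lp_le_exponent[where q = p]) (use p4 in auto)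

lemma sqrt_eps: "0 < sqrt \<epsilon>" "\<epsilon> \<le> sqrt \<epsilon>" "sqrt \<epsilon> * sqrt \<epsilon> = \<epsilon>" "sqrt (2 * \<epsilon>) \<le> 2 * sqrt \<epsilon>"
proof -
  show "0 < sqrt \<epsilon>" "sqrt \<epsilon> * sqrt \<epsilon> = \<epsilon>" using eps by auto
  have "\<epsilon> * \<epsilon> \<le> \<epsilon>" using eps by (simp add: mult_left_le)
  thus "\<epsilon> \<le> sqrt \<epsilon>" using eps by (intro real_le_rsqrt) (simp add: power2_eq_square)
  have "sqrt 2 \<le> 2" by (simp add: real_le_lsqrt)
  thus "sqrt (2 * \<epsilon>) \<le> 2 * sqrt \<epsilon>" using eps by (simp add: real_sqrt_mult mult_right_mono)
qed

lemma Lp_W: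
  assumes "0 \<le> t" "t \<le> T" "1 \<le> r" "r \<le> 4"
  shows "Lp_le M r (W t) (c * T)"
proof -
  have "sqrt t \<le> sqrt (T * T)" using assms T1 mult_mono[of 1 T t T] by (intro real_sqrt_le_mono) auto
  hence "c * sqrt t \<le> c * T" using T0 c0 by (intro mult_left_mono) auto
  hence "Lp_le M p (\<lambda>\<omega>. W t \<omega> - W 0 \<omega>) (c * T)" using assms c_ge1 T1 by (intro W_Lp) auto
  hence "Lp_le M p (W t) (c * T)"
  proof (rule Lp_le_cong_AE)
    show "AE \<omega> in M. W t \<omega> = W t \<omega> - W 0 \<omega>" using paths by eventually_elim simp
  qed (use p0 in auto)
  thus ?thesis using assms(3,4) by (rule Lp_down)
qed

lemma expectation_W: "0 \<le> t \<Longrightarrow> (\<integral>\<omega>. W t \<omega> \<partial>M) = 0"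
proof -
  assume t: "0 \<le> t"
  have "AE \<omega> in M. W 0 \<omega> = 0" using paths by eventually_elim simp
  hence "AE \<omega> in M. W t \<omega> = W t \<omega> - W 0 \<omega>" by eventually_elim simp
  hence "(\<integral>\<omega>. W t \<omega> \<partial>M) = (\<integral>\<omega>. W t \<omega> - W 0 \<omega> \<partial>M)" by (intro integral_cong_AE) auto
  thus ?thesis using W_mean[of 0 t] t by simp
qed

text \<open>Taking expectations in the equation of \<open>Z\<close> produces these means instead of
  values at z; keeping them makes the equations of \<open>z\<close> and \<open>zeta\<close>
  exact.\<close>

definition mean :: "(real^'n \<Rightarrow> real \<Rightarrow> 'c::euclidean_space) \<Rightarrow> real \<Rightarrow> 'c" where
  "mean f t = (\<integral>\<omega>. f (Z t \<omega>) t \<partial>M)"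

lemma mean_measurable:
  assumes "continuous_on UNIV (\<lambda>z. f (fst z) (snd z))"
  shows "mean f \<in> borel_measurable borel"
proof -
  note [measurable (raw)] = borel_measurable_curried[OF assms]
  show ?thesis unfolding mean_def by measurable
qed

lemma Lp_bounded_Z:
  assumes "continuous_on UNIV (\<lambda>z. f (fst z) (snd z))" "\<forall>y. norm (f y t) \<le> B" "0 \<le> r"
  shows "Lp_le M r (\<lambda>\<omega>. f (Z t \<omega>) t) B"
proof -
  note [measurable (raw)] = borel_measurable_curried[OF assms(1)]
  show ?thesis using assms(2,3) B1 by (intro Lp_le_bounded) auto
qed

lemma norm_mean_le:
  assumes "continuous_on UNIV (\<lambda>z. f (fst z) (snd z))" "\<forall>y. norm (f y t) \<le> B"
  shows "norm (mean f t) \<le> B"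
  unfolding mean_def by (rule Lp_le_expectation[OF Lp_bounded_Z[OF assms, of 1]]) auto

text \<open>The deterministic reference path is the mean of \<open>Z\<close> rather than the solution of the noiseless
  equation: no existence theorem is needed, and the fluctuation \<open>zeta\<close> is centered.\<close>

definition z :: "real \<Rightarrow> real^'n" where "z t = (\<integral>\<omega>. Z t \<omega> \<partial>M)"

definition zeta :: "real \<Rightarrow> 'a \<Rightarrow> real^'n" where "zeta t \<omega> = Z t \<omega> - z t"

lemma z_measurable[measurable]: "z \<in> borel_measurable borel"
  unfolding z_def by measurable

lemma zeta_measurable[measurable (raw)]:
  assumes [measurable]: "g \<in> borel_measurable N" "h \<in> measurable N M"
  shows "(\<lambda>x. zeta (g x) (h x)) \<in> borel_measurable N"
  unfolding zeta_def by measurable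

lemma Lp_drift_integral:
  assumes "continuous_on UNIV (\<lambda>z. f (fst z) (snd z))" "\<forall>t\<in>{0..T}. \<forall>y. norm (f y t) \<le> B"
    and t: "0 \<le> t" "t \<le> T" and r: "1 \<le> r"
  shows "Lp_le M r (\<lambda>\<omega>. LBINT s:{0..t}. f (Z s \<omega>) s) (T * B)"
proof -
  note [measurable (raw)] = borel_measurable_curried[OF assms(1)]
  show ?thesis using t T1 B1 r
    by (intro Lp_le_interval_integral Lp_bounded_Z assms(1)) (use assms(2) in auto)
qed

lemma expectation_drift_integral:
  assumes "continuous_on UNIV (\<lambda>z. f (fst z) (snd z))" "\<forall>t\<in>{0..T}. \<forall>y. norm (f y t) \<le> B"
    and t: "0 \<le> t" "t \<le> T"
  shows "(\<integral>\<omega>. (LBINT s:{0..t}. f (Z s \<omega>) s) \<partial>M) = (LBINT s:{0..t}. mean f s)"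
proof -
  note [measurable (raw)] = borel_measurable_curried[OF assms(1)]
  show ?thesis unfolding mean_def using t
    by (intro expectation_interval_integral[where q = 1 and a = B] Lp_bounded_Z assms(1)) (use assms(2) in auto)
qed

lemma drift_integral_diff_mean:
  assumes "continuous_on UNIV (\<lambda>z. f (fst z) (snd z))" "\<forall>t\<in>{0..T}. \<forall>y. norm (f y t) \<le> B"
    and t: "0 \<le> t" "t \<le> T" and om: "\<omega> \<in> space M"
  shows "(LBINT s:{0..t}. f (Z s \<omega>) s - mean f s) = (LBINT s:{0..t}. f (Z s \<omega>) s) - (LBINT s:{0..t}. mean f s)"
proof (rule set_integral_diff(2))
  note [measurable (raw)] = borel_measurable_curried[OF assms(1)]
  show "set_integrable lborel {0..t} (mean f)"
    using t by (intro set_integrable_bounded[where h = B] mean_measurable assms(1) norm_mean_le) (use assms(2) in auto)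
  have "(\<lambda>s. f (Z s \<omega>) s) \<in> borel_measurable borel" using om by measurable
  thus "set_integrable lborel {0..t} (\<lambda>s. f (Z s \<omega>) s)"
    using t by (intro set_integrable_bounded[where h = B]) (use assms(2) in auto)
qed

lemma b_Z: "continuous_on UNIV (\<lambda>z. b (fst z) (snd z))" "\<forall>t\<in>{0..T}. \<forall>y. norm (b y t) \<le> B"
  and G_Z: "continuous_on UNIV (\<lambda>z. G (fst z) (snd z))" "\<forall>t\<in>{0..T}. \<forall>y. norm (G y t) \<le> B"
  using b_continuous b_bound G_continuous G_bound by auto

lemma z_equation:
  assumes t: "0 \<le> t" "t \<le> T"
  shows "z t = x + (LBINT s:{0..t}. mean b s) - \<epsilon> *\<^sub>R (LBINT s:{0..t}. mean G s)"
proof -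
  note I = Lp_le_integrable[OF Lp_drift_integral[OF b_Z t, of 1]] Lp_le_integrable[OF Lp_drift_integral[OF G_Z t, of 1]]
    Lp_le_integrable[OF Lp_W[OF t, of 1]]
  have "z t = (\<integral>\<omega>. x + (LBINT s:{0..t}. b (Z s \<omega>) s)
      - \<epsilon> *\<^sub>R (LBINT s:{0..t}. G (Z s \<omega>) s) + sqrt (2 * \<epsilon>) *\<^sub>R W t \<omega> \<partial>M)"
    unfolding z_def
  proof (rule integral_cong_AE)
    show "AE \<omega> in M. Z t \<omega> = x + (LBINT s:{0..t}. b (Z s \<omega>) s)
      - \<epsilon> *\<^sub>R (LBINT s:{0..t}. G (Z s \<omega>) s) + sqrt (2 * \<epsilon>) *\<^sub>R W t \<omega>"
      using Z_equation by eventually_elim (use t in auto)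
  qed measurable
  also have "\<dots> = x + (\<integral>\<omega>. (LBINT s:{0..t}. b (Z s \<omega>) s) \<partial>M) - \<epsilon> *\<^sub>R (\<integral>\<omega>. (LBINT s:{0..t}. G (Z s \<omega>) s) \<partial>M)"
    using I t by (simp add: expectation_W prob_space)
  also have "\<dots> = x + (LBINT s:{0..t}. mean b s) - \<epsilon> *\<^sub>R (LBINT s:{0..t}. mean G s)"
    unfolding expectation_drift_integral[where f = b, OF b_Z t] expectation_drift_integral[where f = G, OF G_Z t] ..
  finally show ?thesis .
qed

lemma zeta_equation:
  assumes t: "0 \<le> t" "t \<le> T"
  shows "AE \<omega> in M. zeta t \<omega> = (LBINT s:{0..t}. b (Z s \<omega>) s - mean b s)
     + (sqrt (2 * \<epsilon>) *\<^sub>R W t \<omega> - \<epsilon> *\<^sub>R (LBINT s:{0..t}. G (Z s \<omega>) s - mean G s))"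
  using Z_equation AE_space
proof eventually_elim
  case (elim \<omega>)
  show ?case
    unfolding drift_integral_diff_mean[where f = b, OF b_Z t elim(2)] drift_integral_diff_mean[where f = G, OF G_Z t elim(2)]
      zeta_def z_equation[OF t] elim(1)[rule_format, OF t(1)]
    by (simp add: scaleR_diff_right)
qed

text \<open>Gronwall's constant for \<open>zeta\<close> in units of sqrt \<epsilon>. Here L = 4 B,
  the Lipschitz constant 2 B doubled by centering.\<close>

definition "cZ = 4 * (2 * B * T + 2 * c * T) * exp (8 * B * T)"

lemma cZ_pos: "0 < cZ" using T1 B1 c_ge1 by (simp add: cZ_def add_pos_pos)

lemma Lp_drift_centered:
  assumes "C2_le T B f f'" and f: "continuous_on UNIV (\<lambda>z. f (fst z) (snd z))" and t: "0 \<le> t" "t \<le> T" and q: "1 \<le> q"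
    and z: "Lp_le M q (zeta t) a"
  shows "Lp_le M q (\<lambda>\<omega>. f (Z t \<omega>) t - f (z t) t) (2 * B * a)"
    and "Lp_le M q (\<lambda>\<omega>. f (Z t \<omega>) t - mean f t) (4 * B * a)"
proof -
  note [measurable (raw)] = borel_measurable_curried[OF f]
  have "Lp_le M q (\<lambda>\<omega>. (2 * B) *\<^sub>R zeta t \<omega>) (2 * B * a)"
    using B1 q Lp_le_pos[OF z] by (intro Lp_le_scaleR[OF z]) auto
  thus *: "Lp_le M q (\<lambda>\<omega>. f (Z t \<omega>) t - f (z t) t) (2 * B * a)"
    by (rule Lp_le_dominated) (use C2_le_lipschitz[OF assms(1), of t] t B1 q in \<open>auto simp: zeta_def\<close>)
  show "Lp_le M q (\<lambda>\<omega>. f (Z t \<omega>) t - mean f t) (4 * B * a)"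
    using Lp_le_centered[OF * q] by (simp add: mean_def mult.assoc)
qed

text \<open>The source is the noise sqrt (2 \<epsilon>) W plus an O(\<epsilon>) term, which fixes
  the order sqrt \<epsilon>. The fourth moment is chosen so that quadratic expressions in
  \<open>zeta\<close> are controlled in L^2.\<close>

lemma Lp_zeta:
  assumes "0 \<le> t" "t \<le> T"
  shows "Lp_le M 4 (zeta t) (cZ * sqrt \<epsilon>)"
proof -
  define r where "r = sqrt \<epsilon> * (2 * B * T + 2 * c * T)"
  have r: "0 < r" using sqrt_eps T1 B1 c_ge1 by (simp add: r_def add_pos_pos)
  let ?A = "\<lambda>s \<omega>. b (Z s \<omega>) s - mean b s"
  note mm[measurable] = mean_measurable[OF b_continuous] mean_measurable[OF G_continuous]
  have bound: "Lp_le M 4 (\<lambda>\<omega>. LBINT s:{0..t}. f (Z s \<omega>) s - mean f s) (T * (2 * B))"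
    if f: "continuous_on UNIV (\<lambda>z. f (fst z) (snd z))" "\<forall>t\<in>{0..T}. \<forall>y. norm (f y t) \<le> B" and t: "0 \<le> t" "t \<le> T"
    for f :: "real^'n \<Rightarrow> real \<Rightarrow> real^'n" and t
  proof -
    note [measurable (raw)] = borel_measurable_curried[OF f(1)]
    note [measurable] = mean_measurable[OF f(1)]
    have "norm (f (Z s \<omega>) s - mean f s) \<le> 2 * B" if "0 \<le> s" "s \<le> t" for s \<omega>
    proof -
      have "\<forall>y. norm (f y s) \<le> B" using f(2) that t by auto
      thus ?thesis using norm_mean_le[OF f(1)] norm_triangle_ineq4[of "f (Z s \<omega>) s" "mean f s"]
        by (smt (verit))
    qed
    thus ?thesis using t T1 B1 by (intro Lp_le_interval_integral Lp_le_bounded) auto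
  qed
  have R: "Lp_le M 4 (\<lambda>\<omega>. sqrt (2 * \<epsilon>) *\<^sub>R W t \<omega> - \<epsilon> *\<^sub>R (LBINT s:{0..t}. G (Z s \<omega>) s - mean G s)) r"
    if t: "0 \<le> t" "t \<le> T" for t
  proof -
    have 1: "Lp_le M 4 (\<lambda>\<omega>. sqrt (2 * \<epsilon>) *\<^sub>R W t \<omega>) (2 * sqrt \<epsilon> * (c * T))"
      using sqrt_eps T1 c_ge1 eps by (intro Lp_le_scaleR[OF Lp_W[OF t]] mult_right_mono) auto
    have 2: "Lp_le M 4 (\<lambda>\<omega>. \<epsilon> *\<^sub>R (LBINT s:{0..t}. G (Z s \<omega>) s - mean G s)) (sqrt \<epsilon> * (T * (2 * B)))"
      using sqrt_eps T1 B1 eps by (intro Lp_le_scaleR[OF bound[of G t, OF G_Z t]] mult_right_mono) auto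
    show ?thesis by (rule Lp_le_mono[OF Lp_le_diff[OF 1 2]]) (auto simp: r_def algebra_simps)
  qed
  have "Lp_le M 4 (zeta t) (4 * r * exp (2 * (4 * B) * T))"
  proof (rule Lp_le_gronwall[where A = ?A])
    show "Lp_le M 4 (zeta t) (T * (2 * B) + r)" if t: "0 \<le> t" "t \<le> T" for t
      by (rule Lp_le_cong_AE[OF Lp_le_add[OF bound[of b t, OF b_Z t] R[OF t]] _ zeta_equation[OF t]]) auto
    show "Lp_le M 4 (?A s) (4 * B * a + r)" if s: "0 \<le> s" "s \<le> T" "Lp_le M 4 (zeta s) a" for s a
      by (rule Lp_le_mono[OF Lp_drift_centered(2)[OF b_C2 b_continuous s(1,2) _ s(3)]]) (use r in auto)
    show "Lp_le M 4 (\<lambda>\<omega>. zeta t \<omega> - (LBINT s:{0..t}. ?A s \<omega>)) r" if t: "0 \<le> t" "t \<le> T" for t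
    proof (rule Lp_le_cong_AE[OF R[OF t]])
      show "AE \<omega> in M. zeta t \<omega> - (LBINT s:{0..t}. ?A s \<omega>) = sqrt (2 * \<epsilon>) *\<^sub>R W t \<omega> - \<epsilon> *\<^sub>R (LBINT s:{0..t}. G (Z s \<omega>) s - mean G s)"
        using zeta_equation[OF t] by eventually_elim simp
    qed auto
  qed (use assms r B1 T0 in auto)
  thus ?thesis by (rule Lp_le_mono) (auto simp: cZ_def r_def algebra_simps)
qed

lemma integrable_Z: "0 \<le> t \<Longrightarrow> t \<le> T \<Longrightarrow> integrable M (Z t)"
  using Bochner_Integration.integrable_add[OF Lp_le_integrable[OF Lp_zeta[of t]] integrable_const[of "z t"]]
  by (simp add: zeta_def)

lemma expectation_zeta: "0 \<le> t \<Longrightarrow> t \<le> T \<Longrightarrow> (\<integral>\<omega>. zeta t \<omega> \<partial>M) = 0"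
  unfolding zeta_def by (simp add: integrable_Z z_def prob_space)

text \<open>The remainder is at most B times the square of norm \<open>zeta\<close>, and two L^4
  factors of size sqrt \<epsilon> make \<epsilon> in L^2.\<close>

lemma Lp_taylor_Z:
  assumes C: "C2_le T B f f'" and f: "continuous_on UNIV (\<lambda>z. f (fst z) (snd z))" and t: "0 \<le> t" "t \<le> T"
  shows "Lp_le M 2 (\<lambda>\<omega>. f (Z t \<omega>) t - f (z t) t - f' (z t) t (zeta t \<omega>)) (B * cZ\<^sup>2 * \<epsilon>)"
proof -
  note [measurable (raw)] = borel_measurable_curried[OF f]
  have lin: "linear (f' (z t) t)" using C t by (simp add: C2_le_def)
  have [measurable]: "(\<lambda>\<omega>. f' (z t) t (zeta t \<omega>)) \<in> borel_measurable M"
    by (rule bounded_linear_borel_measurable[OF lin]) measurable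
  have 1: "Lp_le M (2 * 2) (\<lambda>\<omega>. B *\<^sub>R zeta t \<omega>) (B * (cZ * sqrt \<epsilon>))"
    using Lp_zeta[OF t] B1 cZ_pos sqrt_eps by (auto intro!: Lp_le_scaleR)
  have 2: "Lp_le M (2 * 2) (zeta t) (cZ * sqrt \<epsilon>)" using Lp_zeta[OF t] by simp
  have "Lp_le M 2 (\<lambda>\<omega>. f (Z t \<omega>) t - f (z t) t - f' (z t) t (zeta t \<omega>)) (B * (cZ * sqrt \<epsilon>) * (cZ * sqrt \<epsilon>))"
  proof (rule Lp_le_product[OF 1 2])
    show "AE \<omega> in M. norm (f (Z t \<omega>) t - f (z t) t - f' (z t) t (zeta t \<omega>)) \<le> norm (B *\<^sub>R zeta t \<omega>) * norm (zeta t \<omega>)"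
    proof (rule AE_I2)
      fix \<omega>
      have "norm (f (z t + zeta t \<omega>) t - f (z t) t - f' (z t) t (zeta t \<omega>)) \<le> B * (norm (zeta t \<omega>))\<^sup>2"
        using C t unfolding C2_le_def by auto
      thus "norm (f (Z t \<omega>) t - f (z t) t - f' (z t) t (zeta t \<omega>)) \<le> norm (B *\<^sub>R zeta t \<omega>) * norm (zeta t \<omega>)"
        using B1 by (simp add: zeta_def power2_eq_square)
    qed
  qed auto
  also have "B * (cZ * sqrt \<epsilon>) * (cZ * sqrt \<epsilon>) = B * cZ\<^sup>2 * (sqrt \<epsilon> * sqrt \<epsilon>)" by (simp add: power2_eq_square)
  finally show ?thesis by (simp only: sqrt_eps)
qed

text \<open>The linear Taylor term has mean zero because \<open>zeta\<close> is centered; this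
  improves the order from sqrt \<epsilon> to \<epsilon>.\<close>

lemma norm_mean_diff_le:
  assumes C: "C2_le T B f f'" and f: "continuous_on UNIV (\<lambda>z. f (fst z) (snd z))" and t: "0 \<le> t" "t \<le> T"
  shows "norm (mean f t - f (z t) t) \<le> B * cZ\<^sup>2 * \<epsilon>"
proof -
  have lin: "linear (f' (z t) t)" using C t by (simp add: C2_le_def)
  have bd: "\<forall>y. norm (f y t) \<le> B" using C t by (simp add: C2_le_def)
  have iz: "integrable M (zeta t)" by (rule Lp_le_integrable[OF Lp_zeta[OF t]]) simp
  have i: "integrable M (\<lambda>\<omega>. f (Z t \<omega>) t)" by (rule Lp_le_integrable[OF Lp_bounded_Z[OF f bd, of 1]]) auto
  have "(\<integral>\<omega>. f (Z t \<omega>) t - f (z t) t - f' (z t) t (zeta t \<omega>) \<partial>M)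
     = mean f t - f (z t) t - f' (z t) t (\<integral>\<omega>. zeta t \<omega> \<partial>M)"
    using i iz integrable_bounded_linear[OF lin[unfolded linear_conv_bounded_linear] iz]
    by (simp add: integral_linear[OF lin iz] mean_def prob_space)
  also have "\<dots> = mean f t - f (z t) t" by (simp add: expectation_zeta[OF t] linear_0[OF lin])
  finally show ?thesis using Lp_le_expectation[OF Lp_taylor_Z[OF C f t]] by simp
qed

text \<open>Dominated convergence along the continuous paths of \<open>Z\<close>. Continuity of the
  means is what makes \<open>z\<close> differentiable.\<close>

lemma continuous_on_mean:
  assumes f: "continuous_on UNIV (\<lambda>z. f (fst z) (snd z))" "\<forall>t\<in>{0..T}. \<forall>y. norm (f y t) \<le> B"
  shows "continuous_on {0..T} (mean f)"
proof (rule continuous_on_sequentiallyI)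
  note [measurable (raw)] = borel_measurable_curried[OF f(1)]
  fix u a assume u: "\<forall>n. u n \<in> {0..T}" "a \<in> {0..T}" "u \<longlonglongrightarrow> a"
  show "(\<lambda>n. mean f (u n)) \<longlonglongrightarrow> mean f a"
    unfolding mean_def
  proof (rule integral_dominated_convergence[where w = "\<lambda>_. B"])
    show "AE \<omega> in M. (\<lambda>n. f (Z (u n) \<omega>) (u n)) \<longlonglongrightarrow> f (Z a \<omega>) a"
      using paths
    proof eventually_elim
      case (elim \<omega>)
      hence "continuous_on {0..} (\<lambda>t. Z t \<omega>)" by blast
      from continuous_on_path[OF f(1) this] show ?case
        using u by (auto simp: continuous_on_sequentially o_def)
    qed
    show "AE \<omega> in M. norm (f (Z (u n) \<omega>) (u n)) \<le> B" for n
      using f(2) u(1) by auto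
  qed auto
qed

lemma mean_path_equation:
  assumes t: "t \<in> {0..T}"
  shows "z t = x + integral {0..t} (\<lambda>s. mean b s - \<epsilon> *\<^sub>R mean G s)"
proof -
  have c: "continuous_on {0..t} (mean b)" "continuous_on {0..t} (mean G)"
    using t by (auto intro: continuous_on_subset[OF continuous_on_mean[OF b_Z]] continuous_on_subset[OF continuous_on_mean[OF G_Z]])
  have "integral {0..t} (\<lambda>s. mean b s - \<epsilon> *\<^sub>R mean G s) = integral {0..t} (mean b) - \<epsilon> *\<^sub>R integral {0..t} (mean G)"
    by (subst Henstock_Kurzweil_Integration.integral_diff) (auto intro!: integrable_continuous_real continuous_intros c)
  thus ?thesis using z_equation[of t] t integral_eq_LBINT[OF c(1)] integral_eq_LBINT[OF c(2)] by simp
qed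

lemma z_0: "z 0 = x"
  using mean_path_equation[of 0] T0 by simp

lemma z_derivative:
  assumes s: "s \<in> {0..T}"
  shows "(z has_vector_derivative (mean b s - \<epsilon> *\<^sub>R mean G s)) (at s within {0..T})"
proof -
  have "((\<lambda>t. integral {0..t} (\<lambda>s. mean b s - \<epsilon> *\<^sub>R mean G s)) has_vector_derivative (mean b s - \<epsilon> *\<^sub>R mean G s)) (at s within {0..T})"
    by (rule integral_has_vector_derivative[OF _ s]) (intro continuous_intros continuous_on_mean b_Z G_Z)
  hence "((\<lambda>t. x + integral {0..t} (\<lambda>s. mean b s - \<epsilon> *\<^sub>R mean G s)) has_vector_derivative (mean b s - \<epsilon> *\<^sub>R mean G s)) (at s within {0..T})"
    by (simp only: has_vector_derivative_add_const add.commute[of x])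
  thus ?thesis
    by (rule has_vector_derivative_transform[OF s, rotated]) (simp add: mean_path_equation)
qed

lemma continuous_on_z: "continuous_on {0..T} z"
  using z_derivative by (meson continuous_on_eq_continuous_within has_vector_derivative_continuous)

lemma b'_linear: "t \<in> {0..T} \<Longrightarrow> linear (b' y t)" and b'_bound: "t \<in> {0..T} \<Longrightarrow> norm (b' y t h) \<le> B * norm h"
  using b_C2 by (auto simp: C2_le_def)

definition "cg = T * (B * (B * cZ\<^sup>2 + B))"

lemma cg_pos: "0 < cg"
  using T1 B1 by (simp add: cg_def add_nonneg_pos)

text \<open>Along the mean path, \<open>G\<close> is up to order \<open>\<epsilon>\<close> the total time derivative of the drift; this is
  why the correction term in the effective drift has this form.\<close>

lemma drift_along_mean_path:
  assumes t: "0 \<le> t" "t \<le> T"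
  shows "norm (b (z t) t - b x 0 - (LBINT s:{0..t}. G (z s) s)) \<le> cg * \<epsilon>"
proof -
  define v where "v s = mean b s - \<epsilon> *\<^sub>R mean G s" for s
  have cz: "continuous_on {0..t} z" using continuous_on_z by (rule continuous_on_subset) (use t in auto)
  have 1: "((\<lambda>s. b' (z s) s (v s) + bt (z s) s) has_integral (b (z t) t - b (z 0) 0)) {0..t}"
  proof (rule fundamental_theorem_of_calculus[OF t(1)])
    fix s assume s: "s \<in> {0..t}"
    hence sT: "s \<in> {0..T}" using t by auto
    have "(z has_vector_derivative v s) (at s within {0..t})"
      unfolding v_def by (rule has_vector_derivative_within_subset[OF z_derivative[OF sT]]) (use t in auto)
    hence "((\<lambda>s. (z s, s)) has_derivative (\<lambda>h. (h *\<^sub>R v s, h))) (at s within {0..t})"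
      unfolding has_vector_derivative_def by (intro has_derivative_Pair) auto
    from has_derivative_compose[OF this b_derivative[of "z s" s]]
    have "((\<lambda>s. b (z s) s) has_derivative (\<lambda>h. b' (z s) s (h *\<^sub>R v s) + h *\<^sub>R bt (z s) s)) (at s within {0..t})"
      by simp
    thus "((\<lambda>s. b (z s) s) has_vector_derivative b' (z s) s (v s) + bt (z s) s) (at s within {0..t})"
      unfolding has_vector_derivative_def by (simp add: linear_cmul[OF b'_linear[OF sT]] scaleR_add_right)
  qed
  have cG: "continuous_on {0..t} (\<lambda>s. G (z s) s)" by (rule continuous_on_path[OF G_continuous cz])
  have 2: "((\<lambda>s. G (z s) s) has_integral (LBINT s:{0..t}. G (z s) s)) {0..t}"
    using integrable_integral[OF integrable_continuous_real[OF cG]] integral_eq_LBINT[OF cG] by simp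
  have "norm ((b (z t) t - b (z 0) 0) - (LBINT s:{0..t}. G (z s) s)) \<le> (B * (B * cZ\<^sup>2 + B) * \<epsilon>) * measure lborel {0..t}"
  proof (rule has_integral_bound_real[OF _ finite.emptyI has_integral_diff[OF 1 2]])
    fix s assume "s \<in> {0..t} - {}"
    hence sT: "s \<in> {0..T}" using t by auto
    \<comment> \<open>The chain rule derivative differs from \<open>G\<close> only because the
      velocity v of the mean path is not exactly the drift at \<open>z\<close>.\<close>
    have "b' (z s) s (v s) + bt (z s) s - G (z s) s = b' (z s) s (v s - b (z s) s)"
      by (simp add: G_eq linear_diff[OF b'_linear[OF sT]])
    also have "norm \<dots> \<le> B * norm (v s - b (z s) s)" by (rule b'_bound[OF sT])
    also have "\<dots> \<le> B * (B * cZ\<^sup>2 * \<epsilon> + \<epsilon> * B)"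
    proof (rule mult_left_mono[OF _ B0])
      have "norm ((mean b s - b (z s) s) - \<epsilon> *\<^sub>R mean G s) \<le> B * cZ\<^sup>2 * \<epsilon> + \<epsilon> * B"
      proof (rule norm_triangle_le_diff[OF add_mono])
        show "norm (mean b s - b (z s) s) \<le> B * cZ\<^sup>2 * \<epsilon>"
          using norm_mean_diff_le[OF b_C2 b_continuous] sT by auto
        have "norm (mean G s) \<le> B" using norm_mean_le[OF G_continuous] G_bound[OF sT] by blast
        thus "norm (\<epsilon> *\<^sub>R mean G s) \<le> \<epsilon> * B" using eps by (simp add: mult_left_mono)
      qed
      thus "norm (v s - b (z s) s) \<le> B * cZ\<^sup>2 * \<epsilon> + \<epsilon> * B" by (simp add: v_def algebra_simps)
    qed
    finally show "norm (b' (z s) s (v s) + bt (z s) s - G (z s) s) \<le> B * (B * cZ\<^sup>2 + B) * \<epsilon>"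
      by (simp add: algebra_simps)
  qed (use B1 eps in auto)
  also have "\<dots> \<le> (B * (B * cZ\<^sup>2 + B) * \<epsilon>) * T" using t B1 eps by (intro mult_left_mono) auto
  finally show ?thesis by (simp add: z_0 cg_def mult_ac)
qed

lemma Lp_X_increment:
  assumes "0 \<le> s" "s \<le> t" "t \<le> T" "cV * (t - s) \<le> a" "0 < a"
  shows "Lp_le M p (\<lambda>\<omega>. X t \<omega> - X s \<omega>) a"
proof (rule Lp_le_cong_AE)
  have "Lp_le M p (\<lambda>\<omega>. LBINT r:{s..t}. V r \<omega>) (a / cV * cV)"
  proof (rule Lp_le_interval_integral)
    show "t - s \<le> a / cV" using assms cV_pos by (simp add: pos_le_divide_eq mult.commute)
    show "Lp_le M p (V r) cV" if "s \<le> r" "r \<le> t" for r using that assms by (intro Lp_V) auto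
  qed (use assms cV_pos p1 in auto)
  thus "Lp_le M p (\<lambda>\<omega>. LBINT r:{s..t}. V r \<omega>) a" using cV_pos by simp
  show "AE \<omega> in M. X t \<omega> - X s \<omega> = (LBINT r:{s..t}. V r \<omega>)"
    using X_increment by eventually_elim (use assms in blast)
qed (use p0 in auto)

text \<open>The drift is Lipschitz with constant B in the displacement of X, which is at most
  \<open>cV\<close> per unit time in L^p, plus the elapsed time itself; a damped lag counts as 2
  \<epsilon>.\<close>

definition "crho = 2 * B * (cV + 1)"

lemma crho_pos: "0 < crho" using B1 cV_pos by (simp add: crho_def)

text \<open>X moves with a velocity bounded in L^p, so the drift along it changes by O(t - s), and
  damping turns this into O(\<epsilon>). Only the noise part of \<open>lag\<close> is left without a
  small L^p bound.\<close>

lemma Lp_damp_drift_increment: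
  assumes st: "0 \<le> s" "s \<le> t" "t \<le> T"
  shows "Lp_le M p (\<lambda>\<omega>. damp s t *\<^sub>R (b (X s \<omega>) s - b (X t \<omega>) t)) (crho * \<epsilon>)"
proof -
  let ?e = "2 * \<epsilon> / damp s t"
  have e: "0 < ?e" "t - s \<le> ?e" using eps damp_bounds(1)[of s t] lin_le_damp[OF st(2)] by auto
  have "Lp_le M p (\<lambda>\<omega>. X t \<omega> - X s \<omega>) (cV * ?e)"
    using st e cV_pos by (intro Lp_X_increment mult_left_mono mult_pos_pos) auto
  hence 1: "Lp_le M p (\<lambda>\<omega>. norm (X t \<omega> - X s \<omega>)) (cV * ?e)"
    by (rule Lp_le_dominated) (use p0 in auto)
  have 2: "Lp_le M p (\<lambda>_. t - s) ?e" using e st p0 by (intro Lp_le_const) auto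
  have 3: "Lp_le M p (\<lambda>\<omega>. (damp s t * B) *\<^sub>R (norm (X t \<omega> - X s \<omega>) + (t - s))) (crho * \<epsilon>)"
  proof (rule Lp_le_scaleR[OF Lp_le_add[OF 1 2 p1]])
    show "\<bar>damp s t * B\<bar> * (cV * ?e + ?e) \<le> crho * \<epsilon>"
      using damp_bounds(1)[of s t] B1 by (simp add: crho_def abs_mult field_simps)
  qed (use crho_pos eps p0 in auto)
  show ?thesis
  proof (rule Lp_le_dominated[OF 3])
    show "AE \<omega> in M. norm (damp s t *\<^sub>R (b (X s \<omega>) s - b (X t \<omega>) t)) \<le> norm ((damp s t * B) *\<^sub>R (norm (X t \<omega> - X s \<omega>) + (t - s)))"
    proof (rule AE_I2)
      fix \<omega>
      have "norm (b (X s \<omega>) s - b (X t \<omega>) t) \<le> B * (norm (X s \<omega> - X t \<omega>) + \<bar>s - t\<bar>)"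
        using st by (intro b_lipschitz) auto
      also have "\<dots> = B * (norm (X t \<omega> - X s \<omega>) + (t - s))" using st by (simp add: norm_minus_commute)
      finally have "damp s t * norm (b (X s \<omega>) s - b (X t \<omega>) t) \<le> damp s t * (B * (norm (X t \<omega> - X s \<omega>) + (t - s)))"
        using damp_bounds(1)[of s t] by (intro mult_left_mono) auto
      thus "norm (damp s t *\<^sub>R (b (X s \<omega>) s - b (X t \<omega>) t)) \<le> norm ((damp s t * B) *\<^sub>R (norm (X t \<omega> - X s \<omega>) + (t - s)))"
        using damp_bounds(1)[of s t] B1 st by (simp add: abs_mult)
    qed
  qed (use p0 in auto)
qed

text \<open>The velocity fluctuation \<open>vel\<close> is of order one in \<open>L\<^sup>q\<close>; it contributes little to the weak error only
  because it decorrelates within time \<open>\<epsilon>\<close>.\<close>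

lemma norm_expectation_vel_le:
  assumes xi: "Lp_le M 2 \<xi> k" and m: "0 \<le> m"
    and W: "\<And>s t. 0 \<le> s \<Longrightarrow> s \<le> t \<Longrightarrow> norm (\<integral>\<omega>. \<xi> \<omega> *\<^sub>R (W t \<omega> - W s \<omega>) \<partial>M) \<le> m * (t - s)"
    and V0: "(\<integral>\<omega>. \<xi> \<omega> *\<^sub>R (V 0 \<omega> - b x 0) \<partial>M) = 0"
    and t: "0 \<le> t" "t \<le> T"
  shows "norm (\<integral>\<omega>. \<xi> \<omega> *\<^sub>R vel t \<omega> \<partial>M) \<le> 3 * (k * crho * \<epsilon> + 4 * m * sqrt \<epsilon>)"
proof -
  have [measurable]: "\<xi> \<in> borel_measurable M" and k: "0 < k" using xi by (auto simp: Lp_le_def)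
  define h where "h = k * crho * \<epsilon> + 4 * m * sqrt \<epsilon>"
  have h0: "0 \<le> h" using k crho_pos eps m by (simp add: h_def)
  define l where "l s \<omega> = damp s t *\<^sub>R lag s t \<omega>" for s \<omega>
  have [measurable (raw)]: "(\<lambda>x. l (f x) (g x)) \<in> borel_measurable N" if [measurable]: "f \<in> borel_measurable N" "g \<in> measurable N M" for f g N
    unfolding l_def by measurable
  have lL: "Lp_le M 2 (l s) (2 * B + 2 * c)" if "0 \<le> s" "s \<le> t" for s
    unfolding l_def using that t by (intro Lp_down[OF Lp_damp_lag]) auto
  \<comment> \<open>The drift part of the lag is of order \<epsilon> in L^2 and is paired by
    Cauchy-Schwarz. For the noise part the correlation m (t - s) is linear in the lag: damped it is
    2 m \<epsilon>, and the amplitude sqrt (2 / \<epsilon>) leaves the order m sqrt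
    \<epsilon>.\<close>
  have lE: "norm (\<integral>\<omega>. \<xi> \<omega> *\<^sub>R l s \<omega> \<partial>M) \<le> h" if s: "0 \<le> s" "s \<le> t" for s
  proof -
    have 1: "Lp_le M 2 (\<lambda>\<omega>. damp s t *\<^sub>R (b (X s \<omega>) s - b (X t \<omega>) t)) (crho * \<epsilon>)"
      using s t by (intro Lp_down[OF Lp_damp_drift_increment]) auto
    have "Lp_le M 2 (\<lambda>\<omega>. W t \<omega> - W s \<omega>) (1 + c * sqrt (t - s))"
      by (rule Lp_down[OF W_Lp]) (use s c_ge1 in \<open>auto intro!: add_pos_nonneg\<close>)
    hence 2: "Lp_le M 2 (\<lambda>\<omega>. (damp s t * sqrt (2 / \<epsilon>)) *\<^sub>R (W t \<omega> - W s \<omega>)) (damp s t * sqrt (2 / \<epsilon>) * (1 + c * sqrt (t - s)))"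
      by (rule Lp_le_scaleR) (use s c_ge1 eps damp_bounds(1)[of s t] in \<open>auto intro!: mult_pos_pos add_pos_nonneg simp: abs_mult\<close>)
    have "l s = (\<lambda>\<omega>. damp s t *\<^sub>R (b (X s \<omega>) s - b (X t \<omega>) t) + (damp s t * sqrt (2 / \<epsilon>)) *\<^sub>R (W t \<omega> - W s \<omega>))"
      by (simp add: l_def lag_def scaleR_add_right fun_eq_iff)
    hence "(\<integral>\<omega>. \<xi> \<omega> *\<^sub>R l s \<omega> \<partial>M) = (\<integral>\<omega>. \<xi> \<omega> *\<^sub>R (damp s t *\<^sub>R (b (X s \<omega>) s - b (X t \<omega>) t)) \<partial>M)
        + (\<integral>\<omega>. \<xi> \<omega> *\<^sub>R ((damp s t * sqrt (2 / \<epsilon>)) *\<^sub>R (W t \<omega> - W s \<omega>)) \<partial>M)"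
      by (simp only: expectation_scaleR_add[OF xi 1 2])
    also have "(\<integral>\<omega>. \<xi> \<omega> *\<^sub>R ((damp s t * sqrt (2 / \<epsilon>)) *\<^sub>R (W t \<omega> - W s \<omega>)) \<partial>M)
       = (damp s t * sqrt (2 / \<epsilon>)) *\<^sub>R (\<integral>\<omega>. \<xi> \<omega> *\<^sub>R (W t \<omega> - W s \<omega>) \<partial>M)"
      by (subst integral_scaleR_right[symmetric]) (simp only: scaleR_left_commute)
    also have "norm ((\<integral>\<omega>. \<xi> \<omega> *\<^sub>R (damp s t *\<^sub>R (b (X s \<omega>) s - b (X t \<omega>) t)) \<partial>M)
        + (damp s t * sqrt (2 / \<epsilon>)) *\<^sub>R (\<integral>\<omega>. \<xi> \<omega> *\<^sub>R (W t \<omega> - W s \<omega>) \<partial>M)) \<le> k * (crho * \<epsilon>) + 4 * m * sqrt \<epsilon>"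
    proof (rule norm_triangle_mono)
      show "norm (\<integral>\<omega>. \<xi> \<omega> *\<^sub>R (damp s t *\<^sub>R (b (X s \<omega>) s - b (X t \<omega>) t)) \<partial>M) \<le> k * (crho * \<epsilon>)"
        by (rule norm_expectation_scaleR_le[OF xi 1])
      have "norm ((damp s t * sqrt (2 / \<epsilon>)) *\<^sub>R (\<integral>\<omega>. \<xi> \<omega> *\<^sub>R (W t \<omega> - W s \<omega>) \<partial>M))
          \<le> (damp s t * sqrt (2 / \<epsilon>)) * (m * (t - s))"
        using W[OF s] damp_bounds(1)[of s t] eps by (simp add: abs_mult mult_left_mono)
      also have "\<dots> \<le> (damp s t * sqrt (2 / \<epsilon>)) * (m * (2 * \<epsilon> / damp s t))"
        using lin_le_damp[OF s(2)] damp_bounds(1)[of s t] eps m by (intro mult_left_mono) auto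
      also have "\<dots> = 2 * m * sqrt 2 * ((sqrt \<epsilon> * sqrt \<epsilon>) / sqrt \<epsilon>)"
        unfolding sqrt_eps(3) using damp_bounds(1)[of s t] by (simp add: real_sqrt_divide)
      also have "\<dots> = 2 * m * sqrt \<epsilon> * sqrt 2"
        by (subst nonzero_mult_div_cancel_right) (use eps in auto)
      also have "\<dots> \<le> 2 * m * sqrt \<epsilon> * 2" using m eps by (intro mult_left_mono) (auto simp: real_le_lsqrt)
      finally show "norm ((damp s t * sqrt (2 / \<epsilon>)) *\<^sub>R (\<integral>\<omega>. \<xi> \<omega> *\<^sub>R (W t \<omega> - W s \<omega>) \<partial>M)) \<le> 4 * m * sqrt \<epsilon>" by simp
    qed
    finally show ?thesis by (simp add: h_def mult.assoc)
  qed
  have V0L: "Lp_le M 2 (\<lambda>\<omega>. V 0 \<omega> - b x 0) \<kappa>" by (rule Lp_down[OF V0_Lp]) auto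
  have i1: "integrable M (\<lambda>\<omega>. \<xi> \<omega> *\<^sub>R (V 0 \<omega> - b x 0))"
    by (rule Lp_le_integrable[OF Lp_le_scaleR_fun[OF xi V0L]]) simp
  have i2: "integrable M (\<lambda>\<omega>. \<xi> \<omega> *\<^sub>R l 0 \<omega>)"
    by (rule Lp_le_integrable[OF Lp_le_scaleR_fun[OF xi lL]]) (use t in auto)
  have "Lp_le M 2 (\<lambda>\<omega>. \<integral>s. kernel t s *\<^sub>R l s \<omega> \<partial>lborel) (2 * (2 * B + 2 * c))"
    using t B1 c_ge1 by (intro Lp_le_weighted_integral kernel_measurable kernel_nonneg kernel_integral lL) (auto dest: kernel_nz)
  hence i3: "integrable M (\<lambda>\<omega>. \<xi> \<omega> *\<^sub>R (\<integral>s. kernel t s *\<^sub>R l s \<omega> \<partial>lborel))"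
    by (rule Lp_le_integrable[OF Lp_le_scaleR_fun[OF xi]]) simp
  have "(\<integral>\<omega>. \<xi> \<omega> *\<^sub>R (\<integral>s. kernel t s *\<^sub>R l s \<omega> \<partial>lborel) \<partial>M) = (\<integral>\<omega>. (\<integral>s. kernel t s *\<^sub>R (\<xi> \<omega> *\<^sub>R l s \<omega>) \<partial>lborel) \<partial>M)"
    by (simp only: integral_scaleR_right[symmetric] scaleR_left_commute[of "\<xi> _"])
  also have "\<dots> = (\<integral>s. kernel t s *\<^sub>R (\<integral>\<omega>. \<xi> \<omega> *\<^sub>R l s \<omega> \<partial>M) \<partial>lborel)"
  proof (rule expectation_weighted_integral[where a = "k * (2 * B + 2 * c)"])
    show "(\<integral>\<^sup>+ s. ennreal (kernel t s) \<partial>lborel) < \<infinity>"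
      using kernel_integral[OF t(1)] by (auto intro: le_less_trans)
    show "Lp_le M 1 (\<lambda>\<omega>. \<xi> \<omega> *\<^sub>R l s \<omega>) (k * (2 * B + 2 * c))" if "kernel t s \<noteq> 0" for s
      using kernel_nz[OF that] by (intro Lp_le_scaleR_fun[OF xi lL]) auto
  qed (auto intro: kernel_nonneg)
  finally have E3: "(\<integral>\<omega>. \<xi> \<omega> *\<^sub>R (\<integral>s. kernel t s *\<^sub>R l s \<omega> \<partial>lborel) \<partial>M) = (\<integral>s. kernel t s *\<^sub>R (\<integral>\<omega>. \<xi> \<omega> *\<^sub>R l s \<omega> \<partial>M) \<partial>lborel)" .
  have N3: "norm (\<integral>\<omega>. \<xi> \<omega> *\<^sub>R (\<integral>s. kernel t s *\<^sub>R l s \<omega> \<partial>lborel) \<partial>M) \<le> 2 * h"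
    unfolding E3
  proof (rule norm_weighted_integral_le[OF kernel_measurable kernel_nonneg kernel_integral[OF t(1)] h0])
    show "norm (\<integral>\<omega>. \<xi> \<omega> *\<^sub>R l s \<omega> \<partial>M) \<le> h" if "kernel t s \<noteq> 0" for s
      using kernel_nz[OF that] by (intro lE) auto
  qed simp
  have "(\<integral>\<omega>. \<xi> \<omega> *\<^sub>R vel t \<omega> \<partial>M) = (\<integral>\<omega>. damp 0 t ^ 2 *\<^sub>R (\<xi> \<omega> *\<^sub>R (V 0 \<omega> - b x 0))
     + damp 0 t *\<^sub>R (\<xi> \<omega> *\<^sub>R l 0 \<omega>) + \<xi> \<omega> *\<^sub>R (\<integral>s. kernel t s *\<^sub>R l s \<omega> \<partial>lborel) \<partial>M)"
  proof (rule integral_cong_AE)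
    show "AE \<omega> in M. \<xi> \<omega> *\<^sub>R vel t \<omega> = damp 0 t ^ 2 *\<^sub>R (\<xi> \<omega> *\<^sub>R (V 0 \<omega> - b x 0))
     + damp 0 t *\<^sub>R (\<xi> \<omega> *\<^sub>R l 0 \<omega>) + \<xi> \<omega> *\<^sub>R (\<integral>s. kernel t s *\<^sub>R l s \<omega> \<partial>lborel)"
      using vel_equation
    proof eventually_elim
      case (elim \<omega>)
      show ?case
        unfolding l_def elim[rule_format, OF t(1)] scaleR_add_right
        by (simp only: scaleR_left_commute[of "\<xi> \<omega>"])
    qed
  qed measurable
  also have "\<dots> = damp 0 t *\<^sub>R (\<integral>\<omega>. \<xi> \<omega> *\<^sub>R l 0 \<omega> \<partial>M) + (\<integral>\<omega>. \<xi> \<omega> *\<^sub>R (\<integral>s. kernel t s *\<^sub>R l s \<omega> \<partial>lborel) \<partial>M)"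
    using i1 i2 i3 V0 by (simp del: scaleR_scaleR)
  \<comment> \<open>Weight at most 1 for the boundary lag and mass at most 2 for the kernel.\<close>
  also have "norm \<dots> \<le> 1 * h + 2 * h"
  proof (rule norm_triangle_mono[OF _ N3])
    have "damp 0 t * norm (\<integral>\<omega>. \<xi> \<omega> *\<^sub>R l 0 \<omega> \<partial>M) \<le> 1 * h"
      using damp_bounds[of 0 t] t lE[of 0] by (intro mult_mono) auto
    thus "norm (damp 0 t *\<^sub>R (\<integral>\<omega>. \<xi> \<omega> *\<^sub>R l 0 \<omega> \<partial>M)) \<le> 1 * h" using damp_bounds(1)[of 0 t] by simp
  qed
  finally have "norm (\<integral>\<omega>. \<xi> \<omega> *\<^sub>R vel t \<omega> \<partial>M) \<le> 3 * h" by simp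
  thus ?thesis unfolding h_def .
qed

section \<open>Weak error\<close>

text \<open>With \<open>gap\<close> the equation for \<open>D\<close> isolates the fluctuating velocity; the remainder \<open>gap\<close> is small
  because the drift correction compensates the time derivative of the drift.\<close>

definition gap :: "real \<Rightarrow> 'a \<Rightarrow> real^'n" where
  "gap t \<omega> = (LBINT s:{0..t}. G (Z s \<omega>) s) - (b (X t \<omega>) t - b x 0)"

definition drift_diff :: "(real^'n \<Rightarrow> real \<Rightarrow> 'c::euclidean_space) \<Rightarrow> real \<Rightarrow> 'a \<Rightarrow> 'c" where
  "drift_diff f t \<omega> = f (X t \<omega>) t - f (Z t \<omega>) t"

lemma gap_measurable[measurable]: "gap t \<in> borel_measurable M"
  unfolding gap_def by measurable

lemma drift_diff_b_measurable[measurable (raw)]: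
  assumes [measurable]: "g \<in> borel_measurable N" "h \<in> measurable N M"
  shows "(\<lambda>x. drift_diff b (g x) (h x)) \<in> borel_measurable N"
  unfolding drift_diff_def by measurable

text \<open>V t - V 0 is rewritten as \<open>vel t\<close> plus the increment of the drift along X
  minus the initial fluctuation; the drift increment joins the integral of \<open>G\<close> in
  \<open>gap\<close>.\<close>

lemma D_gap_equation:
  assumes "0 \<le> t"
  shows "AE \<omega> in M. D t \<omega> = (LBINT s:{0..t}. drift_diff b s \<omega>) + (\<epsilon> *\<^sub>R gap t \<omega> + (\<epsilon> *\<^sub>R (V 0 \<omega> - b x 0) - \<epsilon> *\<^sub>R vel t \<omega>))"
  using D_equation
proof eventually_elim
  case (elim \<omega>)
  show ?case unfolding drift_diff_def elim[rule_format, OF assms] gap_def vel_def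
    by (simp add: algebra_simps)
qed

lemma Lp4_D: "0 \<le> t \<Longrightarrow> t \<le> T \<Longrightarrow> Lp_le M 4 (D t) (cD * \<epsilon>)"
  by (rule Lp_down[OF Lp_D]) auto

lemma cZ_eps_pos: "0 < cZ * sqrt \<epsilon>" "0 < cD * \<epsilon>" "0 < cg * \<epsilon>"
  using cZ_pos cD_pos cg_pos eps by auto

text \<open>\<open>cG\<close> measures the L^4 norm of \<open>gap\<close> in units of sqrt
  \<epsilon>, \<open>cE\<close> its mean in units of \<epsilon>.\<close>

definition "cG = T * (2 * B * cZ) + cg + 2 * B * (cD + cZ)"
definition "cE = T * (B * cZ\<^sup>2) + cg + B * cZ\<^sup>2 + 2 * B * cD"

lemma cG_pos: "0 < cG" and cE_pos: "0 < cE"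
  using T1 B1 cZ_pos cg_pos cD_pos by (auto simp: cG_def cE_def intro!: add_pos_pos)

lemma Lp_drift_diff:
  assumes C: "C2_le T B f f'" and f: "continuous_on UNIV (\<lambda>z. f (fst z) (snd z))" and t: "0 \<le> t" "t \<le> T"
  shows "Lp_le M 4 (drift_diff f t) (2 * B * (cD * \<epsilon>))"
proof -
  note [measurable (raw)] = borel_measurable_curried[OF f]
  have "Lp_le M 4 (\<lambda>\<omega>. (2 * B) *\<^sub>R D t \<omega>) (2 * B * (cD * \<epsilon>))"
    using B1 cZ_eps_pos by (intro Lp_le_scaleR[OF Lp4_D[OF t]]) auto
  thus ?thesis unfolding drift_diff_def
    by (rule Lp_le_dominated) (use C2_le_lipschitz[OF C, of t] t B1 in \<open>auto simp: D_def\<close>)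
qed

text \<open>The integrand and the endpoint term are compared with their values on the mean path,
  where \<open>gap\<close> reduces to O(\<epsilon>). The comparison costs one factor
  \<open>zeta\<close> or \<open>D\<close>, hence sqrt \<epsilon>.\<close>

lemma Lp_gap:
  assumes t: "0 \<le> t" "t \<le> T"
  shows "Lp_le M 4 (gap t) (cG * sqrt \<epsilon>)"
proof -
  let ?\<gamma> = "b (z t) t - b x 0 - (LBINT s:{0..t}. G (z s) s)"
  have 1: "Lp_le M 4 (\<lambda>\<omega>. LBINT s:{0..t}. G (Z s \<omega>) s - G (z s) s) (T * (2 * B * (cZ * sqrt \<epsilon>)))"
  proof (rule Lp_le_interval_integral)
    show "Lp_le M 4 (\<lambda>\<omega>. G (Z s \<omega>) s - G (z s) s) (2 * B * (cZ * sqrt \<epsilon>))" if "0 \<le> s" "s \<le> t" for s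
      using that t by (intro Lp_drift_centered(1)[OF G_C2 G_continuous] Lp_zeta) auto
  qed (use t T1 B1 cZ_eps_pos in auto)
  have 2: "Lp_le M 4 (\<lambda>_. - ?\<gamma>) (cg * sqrt \<epsilon>)"
  proof (rule Lp_le_const)
    have "cg * \<epsilon> \<le> cg * sqrt \<epsilon>" using cg_pos sqrt_eps by (intro mult_left_mono) auto
    thus "norm (- ?\<gamma>) \<le> cg * sqrt \<epsilon>" using drift_along_mean_path[OF t] unfolding norm_minus_cancel by linarith
  qed (use cg_pos eps in auto)
  have "Lp_le M 4 (\<lambda>\<omega>. D t \<omega> + zeta t \<omega>) (cD * \<epsilon> + cZ * sqrt \<epsilon>)"
    by (rule Lp_le_add[OF Lp4_D[OF t] Lp_zeta[OF t]]) simp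
  hence "Lp_le M 4 (\<lambda>\<omega>. (2 * B) *\<^sub>R (D t \<omega> + zeta t \<omega>)) (2 * B * (cD * \<epsilon> + cZ * sqrt \<epsilon>))"
    using B1 cZ_eps_pos by (rule_tac Lp_le_scaleR) (auto intro!: mult_pos_pos add_pos_pos)
  hence 3: "Lp_le M 4 (\<lambda>\<omega>. b (z t) t - b (X t \<omega>) t) (2 * B * (cD * \<epsilon> + cZ * sqrt \<epsilon>))"
  proof (rule Lp_le_dominated)
    show "AE \<omega> in M. norm (b (z t) t - b (X t \<omega>) t) \<le> norm ((2 * B) *\<^sub>R (D t \<omega> + zeta t \<omega>))"
    proof (rule AE_I2)
      fix \<omega>
      have "norm (b (z t) t - b (X t \<omega>) t) \<le> 2 * B * norm (z t - X t \<omega>)"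
        by (rule C2_le_lipschitz[OF b_C2]) (use t in auto)
      thus "norm (b (z t) t - b (X t \<omega>) t) \<le> norm ((2 * B) *\<^sub>R (D t \<omega> + zeta t \<omega>))"
        using B1 by (simp add: D_def zeta_def norm_minus_commute)
    qed
  qed auto
  have "Lp_le M 4 (\<lambda>\<omega>. (LBINT s:{0..t}. G (Z s \<omega>) s - G (z s) s) + (- ?\<gamma> + (b (z t) t - b (X t \<omega>) t)))
     (T * (2 * B * (cZ * sqrt \<epsilon>)) + (cg * sqrt \<epsilon> + 2 * B * (cD * \<epsilon> + cZ * sqrt \<epsilon>)))"
    by (intro Lp_le_add 1 2 3) auto
  hence "Lp_le M 4 (gap t) (T * (2 * B * (cZ * sqrt \<epsilon>)) + (cg * sqrt \<epsilon> + 2 * B * (cD * \<epsilon> + cZ * sqrt \<epsilon>)))"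
  proof (rule Lp_le_cong_AE)
    show "AE \<omega> in M. gap t \<omega> = (LBINT s:{0..t}. G (Z s \<omega>) s - G (z s) s) + (- ?\<gamma> + (b (z t) t - b (X t \<omega>) t))"
    proof (rule AE_I2)
      fix \<omega> assume om: "\<omega> \<in> space M"
      have "(\<lambda>s. G (Z s \<omega>) s) \<in> borel_measurable borel" using om by measurable
      hence "(LBINT s:{0..t}. G (Z s \<omega>) s - G (z s) s) = (LBINT s:{0..t}. G (Z s \<omega>) s) - (LBINT s:{0..t}. G (z s) s)"
        using t by (intro set_integral_diff(2) set_integrable_bounded[where h = B]) (auto intro!: G_bound)
      thus "gap t \<omega> = (LBINT s:{0..t}. G (Z s \<omega>) s - G (z s) s) + (- ?\<gamma> + (b (z t) t - b (X t \<omega>) t))"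
        by (simp add: gap_def)
    qed
  qed auto
  thus ?thesis
  proof (rule Lp_le_mono)
    have "2 * B * (cD * \<epsilon>) \<le> 2 * B * (cD * sqrt \<epsilon>)" using B1 cD_pos sqrt_eps by (intro mult_left_mono) auto
    thus "T * (2 * B * (cZ * sqrt \<epsilon>)) + (cg * sqrt \<epsilon> + 2 * B * (cD * \<epsilon> + cZ * sqrt \<epsilon>)) \<le> cG * sqrt \<epsilon>"
      by (simp add: cG_def algebra_simps)
  qed simp
qed

text \<open>Under the expectation the comparison with the mean path costs only \<epsilon>: means of
  functions of \<open>Z\<close> differ from the values at \<open>z\<close> to second order in
  \<open>zeta\<close>, and replacing X by \<open>Z\<close> costs \<open>D\<close>.\<close>

lemma norm_expectation_gap_le:
  assumes t: "0 \<le> t" "t \<le> T"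
  shows "norm (\<integral>\<omega>. gap t \<omega> \<partial>M) \<le> cE * \<epsilon>"
proof -
  let ?\<gamma> = "b (z t) t - b x 0 - (LBINT s:{0..t}. G (z s) s)"
  let ?d = "\<integral>\<omega>. drift_diff b t \<omega> \<partial>M"
  have dL: "Lp_le M 4 (drift_diff b t) (2 * B * (cD * \<epsilon>))"
    by (rule Lp_drift_diff[OF b_C2 b_continuous t])
  have bd: "\<forall>y. norm (b y t) \<le> B" using b_bound t by auto
  have i: "integrable M (drift_diff b t)" "integrable M (\<lambda>\<omega>. b (Z t \<omega>) t)" "integrable M (\<lambda>\<omega>. LBINT s:{0..t}. G (Z s \<omega>) s)"
    using Lp_le_integrable[OF dL] Lp_le_integrable[OF Lp_bounded_Z[OF b_continuous bd, of 1]]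
      Lp_le_integrable[OF Lp_drift_integral[OF G_Z t, of 1]] by auto
  have GG: "(LBINT s:{0..t}. mean G s - G (z s) s) = (LBINT s:{0..t}. mean G s) - (LBINT s:{0..t}. G (z s) s)"
    using t by (intro set_integral_diff(2) set_integrable_bounded[where h = B] mean_measurable[OF G_continuous] norm_mean_le[OF G_continuous])
      (auto intro!: G_bound)
  have "gap t = (\<lambda>\<omega>. (LBINT s:{0..t}. G (Z s \<omega>) s) - drift_diff b t \<omega> - b (Z t \<omega>) t + b x 0)"
    by (simp add: gap_def drift_diff_def fun_eq_iff)
  hence "(\<integral>\<omega>. gap t \<omega> \<partial>M) = (\<integral>\<omega>. (LBINT s:{0..t}. G (Z s \<omega>) s) \<partial>M) - ?d - mean b t + b x 0"
    using i by (simp add: mean_def prob_space)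
  also have "\<dots> = (LBINT s:{0..t}. mean G s) - ?d - mean b t + b x 0"
    by (simp only: expectation_drift_integral[OF G_Z t])
  also have "\<dots> = (LBINT s:{0..t}. mean G s - G (z s) s) - ?\<gamma> - (mean b t - b (z t) t) - ?d"
    unfolding GG by simp
  also have "norm \<dots> \<le> T * (B * cZ\<^sup>2 * \<epsilon>) + cg * \<epsilon> + B * cZ\<^sup>2 * \<epsilon> + 2 * B * (cD * \<epsilon>)"
  proof (rule norm_triangle_le_diff[OF add_mono[OF norm_triangle_le_diff[OF add_mono[OF norm_triangle_le_diff[OF add_mono]]]]])
    show "norm (LBINT s:{0..t}. mean G s - G (z s) s) \<le> T * (B * cZ\<^sup>2 * \<epsilon>)"
      using t T0 B1 eps by (intro norm_interval_integral_le norm_mean_diff_le[OF G_C2 G_continuous]) auto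
    show "norm ?\<gamma> \<le> cg * \<epsilon>" by (rule drift_along_mean_path[OF t])
    show "norm (mean b t - b (z t) t) \<le> B * cZ\<^sup>2 * \<epsilon>" by (rule norm_mean_diff_le[OF b_C2 b_continuous t])
    show "norm ?d \<le> 2 * B * (cD * \<epsilon>)" by (rule Lp_le_expectation[OF dL]) simp
  qed
  finally show ?thesis by (simp add: cE_def algebra_simps)
qed

text \<open>The deterministic Gronwall lemma as the case of constant random variables, for which an
  L^1 bound is a bound on the norm.\<close>

lemma norm_gronwall:
  fixes K A :: "real \<Rightarrow> 'b::euclidean_space"
  assumes [measurable]: "A \<in> borel_measurable borel" and L: "1 \<le> L" and r: "0 < r"
    and apriori: "\<And>t. 0 \<le> t \<Longrightarrow> t \<le> T \<Longrightarrow> norm (K t) \<le> a0"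
    and A: "\<And>s. 0 \<le> s \<Longrightarrow> s \<le> T \<Longrightarrow> norm (A s) \<le> L * norm (K s) + r"
    and R: "\<And>t. 0 \<le> t \<Longrightarrow> t \<le> T \<Longrightarrow> norm (K t - (LBINT s:{0..t}. A s)) \<le> r"
    and t: "0 \<le> t" "t \<le> T"
  shows "norm (K t) \<le> 4 * r * exp (2 * L * T)"
proof -
  have "Lp_le M 1 (\<lambda>_. K t) (4 * r * exp (2 * L * T))"
  proof (rule Lp_le_gronwall[where D = "\<lambda>t _. K t" and A = "\<lambda>s _. A s"])
    show "Lp_le M 1 (\<lambda>_. K t) (\<bar>a0\<bar> + 1)" if "0 \<le> t" "t \<le> T" for t
      using apriori[OF that] by (intro Lp_le_const) auto
    show "Lp_le M 1 (\<lambda>_. A s) (L * a + r)" if s: "0 \<le> s" "s \<le> T" "Lp_le M 1 (\<lambda>_. K s) a" for s a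
    proof (rule Lp_le_const)
      have "norm (K s) \<le> a" using Lp_le_expectation[OF s(3)] by (simp add: prob_space)
      hence "L * norm (K s) \<le> L * a" using L by (intro mult_left_mono) auto
      thus "norm (A s) \<le> L * a + r" using A[OF s(1,2)] by simp
      show "0 < L * a + r" using Lp_le_pos[OF s(3)] L r by (intro add_pos_pos) auto
    qed simp
    show "Lp_le M 1 (\<lambda>\<omega>. K t - (LBINT s:{0..t}. A s)) r" if "0 \<le> t" "t \<le> T" for t
      using R[OF that] r by (intro Lp_le_const) auto
  qed (use L T0 r t in auto)
  from Lp_le_expectation[OF this] show ?thesis by (simp add: prob_space)
qed

section \<open>Linearisation of the drift difference\<close>

lemma expectation_scaleR_linear:
  fixes L :: "'b::euclidean_space \<Rightarrow> 'c::euclidean_space"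
  assumes L: "linear L" and xi: "Lp_le M 2 \<xi> k" and f: "Lp_le M 2 f a"
  shows "(\<integral>\<omega>. \<xi> \<omega> *\<^sub>R L (f \<omega>) \<partial>M) = L (\<integral>\<omega>. \<xi> \<omega> *\<^sub>R f \<omega> \<partial>M)"
  using integral_linear[OF L Lp_le_integrable[OF Lp_le_scaleR_fun[OF xi f]]] by (simp add: linear_cmul[OF L])

lemma Lp_le_linear:
  fixes L :: "'b::euclidean_space \<Rightarrow> 'c::euclidean_space"
  assumes L: "linear L" "\<And>h. norm (L h) \<le> B * norm h" and f: "Lp_le M q f a" and q: "0 \<le> q"
  shows "Lp_le M q (\<lambda>\<omega>. L (f \<omega>)) (B * a)"
proof -
  have [measurable]: "f \<in> borel_measurable M" using f by (simp add: Lp_le_def)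
  have "Lp_le M q (\<lambda>\<omega>. B *\<^sub>R f \<omega>) (B * a)" using B1 q Lp_le_pos[OF f] by (intro Lp_le_scaleR[OF f]) auto
  thus ?thesis
    by (rule Lp_le_dominated) (use L B1 q in \<open>auto intro!: bounded_linear_borel_measurable[OF L(1)]\<close>)
qed

text \<open>The derivative is taken at the deterministic point \<open>z\<close> and not at
  \<open>Z\<close>, so that it commutes with the expectation; the price is an extra term in which
  \<open>D\<close> multiplies the fluctuation of the derivative.\<close>

definition remD :: "(real^'n \<Rightarrow> real \<Rightarrow> 'c::euclidean_space) \<Rightarrow> (real^'n \<Rightarrow> real \<Rightarrow> real^'n \<Rightarrow> 'c) \<Rightarrow> real \<Rightarrow> 'a \<Rightarrow> 'c" where
  "remD f f' t \<omega> = drift_diff f t \<omega> - f' (z t) t (D t \<omega>)"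

definition remZ :: "(real^'n \<Rightarrow> real \<Rightarrow> 'c::euclidean_space) \<Rightarrow> real \<Rightarrow> 'a \<Rightarrow> 'c" where
  "remZ g t \<omega> = g (Z t \<omega>) t - g (z t) t"

text \<open>Expanding at \<open>Z\<close> leaves a remainder quadratic in \<open>D\<close>. Moving
  the derivative from \<open>Z\<close> to \<open>z\<close> produces Q, which is linear in
  \<open>D\<close> and in the fluctuations of the partial derivatives.\<close>

lemma remD_decomposition:
  fixes f :: "real^'n \<Rightarrow> real \<Rightarrow> 'c::euclidean_space"
  assumes f: "C3_le T B f f'" and t: "0 \<le> t" "t \<le> T"
  defines "Q \<equiv> \<lambda>\<omega>. \<Sum>i\<in>UNIV. D t \<omega> $ i *\<^sub>R remZ (\<lambda>y t. f' y t (axis i 1)) t \<omega>"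
  shows "Lp_le M 2 (\<lambda>\<omega>. remD f f' t \<omega> - Q \<omega>) (B * (cD * \<epsilon>) * (cD * \<epsilon>))"
    and "\<And>i. Lp_le M 4 (remZ (\<lambda>y t. f' y t (axis i 1)) t) (2 * B * (cZ * sqrt \<epsilon>))"
proof -
  have C: "C2_le T B f f'" and fc: "continuous_on UNIV (\<lambda>z. f (fst z) (snd z))"
    and gc: "\<And>i. continuous_on UNIV (\<lambda>z. f' (fst z) (snd z) (axis i 1))"
    and gC: "\<And>i. \<exists>f''. C2_le T B (\<lambda>y t. f' y t (axis i 1)) f''"
    using f by (auto simp: C3_le_def)
  have lin: "linear (f' y t)" for y using C t by (simp add: C2_le_def)
  show R: "Lp_le M 4 (remZ (\<lambda>y t. f' y t (axis i 1)) t) (2 * B * (cZ * sqrt \<epsilon>))" for i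
  proof -
    obtain f'' where "C2_le T B (\<lambda>y t. f' y t (axis i 1)) f''" using gC by blast
    from Lp_drift_centered(1)[OF this gc t _ Lp_zeta[OF t]] show ?thesis unfolding remZ_def[abs_def] by simp
  qed
  note [measurable (raw)] = borel_measurable_curried[OF fc]
  have [measurable]: "(\<lambda>\<omega>. f' (z t) t (D t \<omega>)) \<in> borel_measurable M"
    by (rule bounded_linear_borel_measurable[OF lin]) measurable
  have [measurable]: "drift_diff f t \<in> borel_measurable M" unfolding drift_diff_def by measurable
  have m1: "remD f f' t \<in> borel_measurable M" unfolding remD_def by measurable
  have m2: "Q \<in> borel_measurable M"
    unfolding Q_def
  proof (intro borel_measurable_sum borel_measurable_scaleR)
    show "(\<lambda>\<omega>. D t \<omega> $ i) \<in> borel_measurable M" for i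
      using Lp_le_component[OF Lp4_D[OF t]] by (simp add: Lp_le_def)
    show "remZ (\<lambda>y t. f' y t (axis i 1)) t \<in> borel_measurable M" for i using R by (simp add: Lp_le_def)
  qed
  have 1: "Lp_le M (2 * 2) (\<lambda>\<omega>. B *\<^sub>R D t \<omega>) (B * (cD * \<epsilon>))"
    using Lp4_D[OF t] B1 cZ_eps_pos by (auto intro!: Lp_le_scaleR)
  have 2: "Lp_le M (2 * 2) (D t) (cD * \<epsilon>)" using Lp4_D[OF t] by simp
  show "Lp_le M 2 (\<lambda>\<omega>. remD f f' t \<omega> - Q \<omega>) (B * (cD * \<epsilon>) * (cD * \<epsilon>))"
  proof (rule Lp_le_product[OF 1 2])
    show "AE \<omega> in M. norm (remD f f' t \<omega> - Q \<omega>) \<le> norm (B *\<^sub>R D t \<omega>) * norm (D t \<omega>)"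
    proof (rule AE_I2)
      fix \<omega>
      have "Q \<omega> = f' (Z t \<omega>) t (D t \<omega>) - f' (z t) t (D t \<omega>)"
        by (subst (1 2) linear_axis_expansion[OF lin]) (simp add: Q_def remZ_def scaleR_diff_right sum_subtractf)
      hence "remD f f' t \<omega> - Q \<omega> = f (Z t \<omega> + D t \<omega>) t - f (Z t \<omega>) t - f' (Z t \<omega>) t (D t \<omega>)"
        by (simp add: remD_def drift_diff_def D_def)
      also have "norm \<dots> \<le> B * (norm (D t \<omega>))\<^sup>2" using C t by (simp add: C2_le_def)
      finally show "norm (remD f f' t \<omega> - Q \<omega>) \<le> norm (B *\<^sub>R D t \<omega>) * norm (D t \<omega>)"
        using B1 by (simp add: power2_eq_square)
    qed
  qed (use m1 m2 in auto)
qed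

definition "cR = B * cD\<^sup>2 + real CARD('n) * (cD * (2 * B * cZ))"

lemma cR_pos: "0 < cR"
  using B1 cD_pos cZ_pos by (auto simp: cR_def intro!: add_pos_pos)

text \<open>In L^4, \<open>D\<close> has size \<epsilon> and each fluctuation \<open>remZ\<close>
  size sqrt \<epsilon>; their product dominates the part quadratic in \<open>D\<close>.\<close>

lemma Lp_remD:
  fixes f :: "real^'n \<Rightarrow> real \<Rightarrow> 'c::euclidean_space"
  assumes f: "C3_le T B f f'" and t: "0 \<le> t" "t \<le> T"
  shows "Lp_le M 2 (remD f f' t) (cR * (\<epsilon> * sqrt \<epsilon>))"
proof -
  let ?R = "\<lambda>i. remZ (\<lambda>y t. f' y t (axis i 1)) t"
  have "Lp_le M 2 (\<lambda>\<omega>. D t \<omega> $ i *\<^sub>R ?R i \<omega>) (cD * \<epsilon> * (2 * B * (cZ * sqrt \<epsilon>)))" for i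
  proof (rule Lp_le_product)
    show D: "Lp_le M (2 * 2) (\<lambda>\<omega>. D t \<omega> $ i) (cD * \<epsilon>)" using Lp_le_component[OF Lp4_D[OF t]] by simp
    show R: "Lp_le M (2 * 2) (?R i) (2 * B * (cZ * sqrt \<epsilon>))" using remD_decomposition(2)[OF f t] by simp
    show "(\<lambda>\<omega>. D t \<omega> $ i *\<^sub>R ?R i \<omega>) \<in> borel_measurable M" using D R by (auto simp: Lp_le_def)
  qed auto
  hence "Lp_le M 2 (\<lambda>\<omega>. \<Sum>i\<in>UNIV. D t \<omega> $ i *\<^sub>R ?R i \<omega>) (\<Sum>i\<in>(UNIV::'n set). cD * \<epsilon> * (2 * B * (cZ * sqrt \<epsilon>)))"
    by (intro Lp_le_sum) auto
  from Lp_le_add[OF remD_decomposition(1)[OF f t] this]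
  have "Lp_le M 2 (remD f f' t) (B * (cD * \<epsilon>) * (cD * \<epsilon>) + real CARD('n) * (cD * \<epsilon> * (2 * B * (cZ * sqrt \<epsilon>))))"
    by simp
  thus ?thesis
  proof (rule Lp_le_mono)
    have "(B * cD\<^sup>2) * (\<epsilon> * \<epsilon>) \<le> (B * cD\<^sup>2) * (\<epsilon> * sqrt \<epsilon>)"
      using B1 eps sqrt_eps(2) by (intro mult_left_mono) auto
    thus "B * (cD * \<epsilon>) * (cD * \<epsilon>) + real CARD('n) * (cD * \<epsilon> * (2 * B * (cZ * sqrt \<epsilon>))) \<le> cR * (\<epsilon> * sqrt \<epsilon>)"
      by (simp add: cR_def power2_eq_square algebra_simps)
  qed simp
qed

text \<open>\<open>D_gap_equation\<close> is multiplied by \<xi> and averaged. By orthogonality to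
  \<xi> the initial fluctuation disappears, so the velocity enters only through its correlation with
  \<xi>.\<close>

lemma expectation_test_equation:
  assumes xi: "Lp_le M 2 \<xi> k" and t: "0 \<le> t" "t \<le> T"
    and V0: "(\<integral>\<omega>. \<xi> \<omega> *\<^sub>R (V 0 \<omega> - b x 0) \<partial>M) = 0"
  shows "(\<integral>\<omega>. \<xi> \<omega> *\<^sub>R D t \<omega> \<partial>M) - (LBINT s:{0..t}. (\<integral>\<omega>. \<xi> \<omega> *\<^sub>R drift_diff b s \<omega> \<partial>M))
     = \<epsilon> *\<^sub>R (\<integral>\<omega>. \<xi> \<omega> *\<^sub>R gap t \<omega> \<partial>M) - \<epsilon> *\<^sub>R (\<integral>\<omega>. \<xi> \<omega> *\<^sub>R vel t \<omega> \<partial>M)"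
proof -
  have [measurable]: "\<xi> \<in> borel_measurable M" using xi by (simp add: Lp_le_def)
  have dL: "Lp_le M 2 (drift_diff b s) (2 * B * (cD * \<epsilon>))" if "0 \<le> s" "s \<le> t" for s
    by (rule Lp_le_exponent[OF Lp_drift_diff[OF b_C2 b_continuous]]) (use that t in auto)
  have "Lp_le M 2 (\<lambda>\<omega>. LBINT s:{0..t}. drift_diff b s \<omega>) (T * (2 * B * (cD * \<epsilon>)))"
    using t T1 B1 cZ_eps_pos by (intro Lp_le_interval_integral dL) auto
  note i0 = Lp_le_integrable[OF Lp_le_scaleR_fun[OF xi this] order_refl]
  note i1 = Lp_le_integrable[OF Lp_le_scaleR_fun[OF xi Lp_le_exponent[OF Lp_gap[OF t]]] order_refl]
  note i2 = Lp_le_integrable[OF Lp_le_scaleR_fun[OF xi Lp_down[OF V0_Lp]] order_refl]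
  note i3 = Lp_le_integrable[OF Lp_le_scaleR_fun[OF xi Lp_down[OF Lp_vel[OF t]]] order_refl]
  have "(\<integral>\<omega>. \<xi> \<omega> *\<^sub>R D t \<omega> \<partial>M) = (\<integral>\<omega>. \<xi> \<omega> *\<^sub>R (LBINT s:{0..t}. drift_diff b s \<omega>) + (\<epsilon> *\<^sub>R (\<xi> \<omega> *\<^sub>R gap t \<omega>)
      + (\<epsilon> *\<^sub>R (\<xi> \<omega> *\<^sub>R (V 0 \<omega> - b x 0)) - \<epsilon> *\<^sub>R (\<xi> \<omega> *\<^sub>R vel t \<omega>))) \<partial>M)"
  proof (rule integral_cong_AE)
    show "AE \<omega> in M. \<xi> \<omega> *\<^sub>R D t \<omega> = \<xi> \<omega> *\<^sub>R (LBINT s:{0..t}. drift_diff b s \<omega>) + (\<epsilon> *\<^sub>R (\<xi> \<omega> *\<^sub>R gap t \<omega>)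
      + (\<epsilon> *\<^sub>R (\<xi> \<omega> *\<^sub>R (V 0 \<omega> - b x 0)) - \<epsilon> *\<^sub>R (\<xi> \<omega> *\<^sub>R vel t \<omega>)))"
      using D_gap_equation[OF t(1)]
    proof eventually_elim
      case (elim \<omega>)
      show ?case unfolding elim scaleR_add_right scaleR_diff_right[of "\<xi> \<omega>" "\<epsilon> *\<^sub>R (V 0 \<omega> - b x 0)"]
        by (simp only: scaleR_left_commute[of "\<xi> \<omega>"])
    qed
  qed measurable
  also have "\<dots> = (\<integral>\<omega>. \<xi> \<omega> *\<^sub>R (LBINT s:{0..t}. drift_diff b s \<omega>) \<partial>M) + (\<epsilon> *\<^sub>R (\<integral>\<omega>. \<xi> \<omega> *\<^sub>R gap t \<omega> \<partial>M)
      + (\<epsilon> *\<^sub>R 0 - \<epsilon> *\<^sub>R (\<integral>\<omega>. \<xi> \<omega> *\<^sub>R vel t \<omega> \<partial>M)))"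
    using i0 i1 i2 i3 V0 by (simp del: scaleR_scaleR)
  also have "(\<integral>\<omega>. \<xi> \<omega> *\<^sub>R (LBINT s:{0..t}. drift_diff b s \<omega>) \<partial>M) = (LBINT s:{0..t}. (\<integral>\<omega>. \<xi> \<omega> *\<^sub>R drift_diff b s \<omega> \<partial>M))"
    by (rule expectation_scaleR_interval_integral[OF _ xi dL]) measurable
  finally show ?thesis by simp
qed

text \<open>The linear part acts on the deterministic vector E[\<xi> D], which closes the Gronwall
  inequality; only \<open>remD\<close> is left as a source.\<close>

lemma norm_expectation_drift_diff_le:
  fixes f :: "real^'n \<Rightarrow> real \<Rightarrow> 'c::euclidean_space"
  assumes f: "C3_le T B f f'" and t: "0 \<le> t" "t \<le> T" and xi: "Lp_le M 2 \<xi> k"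
  shows "norm (\<integral>\<omega>. \<xi> \<omega> *\<^sub>R drift_diff f t \<omega> \<partial>M) \<le> B * norm (\<integral>\<omega>. \<xi> \<omega> *\<^sub>R D t \<omega> \<partial>M) + norm (\<integral>\<omega>. \<xi> \<omega> *\<^sub>R remD f f' t \<omega> \<partial>M)"
proof -
  have lin: "linear (f' (z t) t)" and bd: "norm (f' (z t) t h) \<le> B * norm h" for h
    using f t by (auto simp: C3_le_def C2_le_def)
  have D: "Lp_le M 2 (D t) (cD * \<epsilon>)" by (rule Lp_le_exponent[OF Lp4_D[OF t]]) auto
  have "drift_diff f t = (\<lambda>\<omega>. f' (z t) t (D t \<omega>) + remD f f' t \<omega>)" by (simp add: remD_def fun_eq_iff)
  hence "(\<integral>\<omega>. \<xi> \<omega> *\<^sub>R drift_diff f t \<omega> \<partial>M) = (\<integral>\<omega>. \<xi> \<omega> *\<^sub>R f' (z t) t (D t \<omega>) \<partial>M) + (\<integral>\<omega>. \<xi> \<omega> *\<^sub>R remD f f' t \<omega> \<partial>M)"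
    by (simp only: expectation_scaleR_add[OF xi Lp_le_linear[OF lin bd D] Lp_remD[OF f t]])
  also have "(\<integral>\<omega>. \<xi> \<omega> *\<^sub>R f' (z t) t (D t \<omega>) \<partial>M) = f' (z t) t (\<integral>\<omega>. \<xi> \<omega> *\<^sub>R D t \<omega> \<partial>M)"
    by (rule expectation_scaleR_linear[OF lin xi D])
  finally show ?thesis using norm_triangle_mono[OF bd order_refl] by metis
qed

lemma expectation_drift_diff_b_measurable[measurable]:
  assumes "\<xi> \<in> borel_measurable M"
  shows "(\<lambda>s. \<integral>\<omega>. \<xi> \<omega> *\<^sub>R drift_diff b s \<omega> \<partial>M) \<in> borel_measurable borel"
proof -
  note [measurable] = assms
  show ?thesis by measurable
qed

text \<open>Gronwall for E[\<xi> D] with three sources of order \<epsilon>^(3/2):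
  \<open>remD\<close>, \<epsilon> times \<open>gap\<close>, and \<epsilon> times the correlation of
  \<xi> with \<open>vel\<close>. Cauchy-Schwarz and the strong bound would give only
  \<epsilon>.\<close>

lemma norm_expectation_test_D_le:
  assumes xi: "Lp_le M 2 \<xi> k" and m: "0 \<le> m"
    and W: "\<And>s t. 0 \<le> s \<Longrightarrow> s \<le> t \<Longrightarrow> norm (\<integral>\<omega>. \<xi> \<omega> *\<^sub>R (W t \<omega> - W s \<omega>) \<partial>M) \<le> m * (t - s)"
    and V0: "(\<integral>\<omega>. \<xi> \<omega> *\<^sub>R (V 0 \<omega> - b x 0) \<partial>M) = 0"
    and t: "0 \<le> t" "t \<le> T"
  shows "norm (\<integral>\<omega>. \<xi> \<omega> *\<^sub>R D t \<omega> \<partial>M) \<le> 4 * ((k * (cR + cG + 3 * crho) + 12 * m) * (\<epsilon> * sqrt \<epsilon>)) * exp (2 * B * T)"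
proof (rule norm_gronwall)
  have k: "0 < k" using xi by (rule Lp_le_pos)
  have [measurable]: "\<xi> \<in> borel_measurable M" using xi by (simp add: Lp_le_def)
  let ?r = "(k * (cR + cG + 3 * crho) + 12 * m) * (\<epsilon> * sqrt \<epsilon>)"
  have ee: "0 < \<epsilon> * sqrt \<epsilon>" using eps by simp
  have pos: "0 < k * cR" "0 < k * cG" "0 < k * crho" using k cR_pos cG_pos crho_pos by auto
  show "0 < ?r" 
    by (rule mult_pos_pos[OF _ ee]) (use pos m in \<open>auto simp: algebra_simps intro!: add_pos_nonneg\<close>)
  show "norm (\<integral>\<omega>. \<xi> \<omega> *\<^sub>R D t \<omega> \<partial>M) \<le> k * (cD * \<epsilon>)" if "0 \<le> t" "t \<le> T" for t
    by (rule norm_expectation_scaleR_le[OF xi Lp_le_exponent[OF Lp4_D]]) (use that in auto)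
  show "norm (\<integral>\<omega>. \<xi> \<omega> *\<^sub>R drift_diff b s \<omega> \<partial>M) \<le> B * norm (\<integral>\<omega>. \<xi> \<omega> *\<^sub>R D s \<omega> \<partial>M) + ?r" if s: "0 \<le> s" "s \<le> T" for s
  proof -
    have "norm (\<integral>\<omega>. \<xi> \<omega> *\<^sub>R remD b b' s \<omega> \<partial>M) \<le> k * (cR * (\<epsilon> * sqrt \<epsilon>))"
      by (rule norm_expectation_scaleR_le[OF xi Lp_remD[OF b_C3 s]])
    also have "\<dots> = (k * cR) * (\<epsilon> * sqrt \<epsilon>)" by simp
    also have "\<dots> \<le> ?r" using pos m ee by (intro mult_right_mono) (auto simp: algebra_simps)
    finally show ?thesis using norm_expectation_drift_diff_le[OF b_C3 s xi] by simp
  qed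
  show "norm ((\<integral>\<omega>. \<xi> \<omega> *\<^sub>R D t \<omega> \<partial>M) - (LBINT s:{0..t}. (\<integral>\<omega>. \<xi> \<omega> *\<^sub>R drift_diff b s \<omega> \<partial>M))) \<le> ?r" if t: "0 \<le> t" "t \<le> T" for t
    unfolding expectation_test_equation[OF xi t V0]
  proof (rule order_trans[OF norm_triangle_le_diff[OF add_mono]])
    have "norm (\<integral>\<omega>. \<xi> \<omega> *\<^sub>R gap t \<omega> \<partial>M) \<le> k * (cG * sqrt \<epsilon>)"
      by (rule norm_expectation_scaleR_le[OF xi Lp_le_exponent[OF Lp_gap[OF t]]]) auto
    thus "norm (\<epsilon> *\<^sub>R (\<integral>\<omega>. \<xi> \<omega> *\<^sub>R gap t \<omega> \<partial>M)) \<le> \<epsilon> * (k * (cG * sqrt \<epsilon>))"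
      using eps by (simp add: mult_left_mono)
    have "norm (\<integral>\<omega>. \<xi> \<omega> *\<^sub>R vel t \<omega> \<partial>M) \<le> 3 * (k * crho * \<epsilon> + 4 * m * sqrt \<epsilon>)"
      by (rule norm_expectation_vel_le[OF xi m W V0 t])
    also have "\<dots> \<le> 3 * (k * crho * sqrt \<epsilon> + 4 * m * sqrt \<epsilon>)"
      using pos sqrt_eps by (intro mult_left_mono add_right_mono mult_left_mono[of \<epsilon>]) auto
    finally show "norm (\<epsilon> *\<^sub>R (\<integral>\<omega>. \<xi> \<omega> *\<^sub>R vel t \<omega> \<partial>M)) \<le> \<epsilon> * (3 * (k * crho * sqrt \<epsilon> + 4 * m * sqrt \<epsilon>))"
      using eps by (simp add: mult_left_mono)
    have "\<epsilon> * (k * (cG * sqrt \<epsilon>)) + \<epsilon> * (3 * (k * crho * sqrt \<epsilon> + 4 * m * sqrt \<epsilon>)) = (k * (cG + 3 * crho) + 12 * m) * (\<epsilon> * sqrt \<epsilon>)"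
      by (simp add: algebra_simps)
    also have "\<dots> \<le> ?r" using pos ee by (intro mult_right_mono) (auto simp: algebra_simps)
    finally show "\<epsilon> * (k * (cG * sqrt \<epsilon>)) + \<epsilon> * (3 * (k * crho * sqrt \<epsilon> + 4 * m * sqrt \<epsilon>)) \<le> ?r" .
  qed
  show "(\<lambda>s. \<integral>\<omega>. \<xi> \<omega> *\<^sub>R drift_diff b s \<omega> \<partial>M) \<in> borel_measurable borel" by measurable
qed (use B1 t in auto)

text \<open>The preceding constant for \<xi> a coordinate of \<open>W r\<close>, with L^2 bound k =
  c T and covariance bound m = c.\<close>

definition "cK = 4 * (c * T * (cR + cG + 3 * crho) + 12 * c) * exp (2 * B * T)"

lemma cK_pos: "0 < cK"
  using c_ge1 T1 cR_pos cG_pos crho_pos kinetic_axioms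
  by (auto simp: cK_def kinetic_def intro!: mult_pos_pos add_pos_pos)

lemma norm_expectation_W_D_le:
  assumes r: "0 \<le> r" "r \<le> T" and t: "0 \<le> t" "t \<le> T"
  shows "norm (\<integral>\<omega>. W r \<omega> $ i *\<^sub>R D t \<omega> \<partial>M) \<le> cK * (\<epsilon> * sqrt \<epsilon>)"
proof -
  have "norm (\<integral>\<omega>. W r \<omega> $ i *\<^sub>R D t \<omega> \<partial>M) \<le> 4 * ((c * T * (cR + cG + 3 * crho) + 12 * c) * (\<epsilon> * sqrt \<epsilon>)) * exp (2 * B * T)"
    by (rule norm_expectation_test_D_le[OF Lp_le_component[OF Lp_W[OF r]] c0 W_covariance[OF r(1)] W_V0[OF r(1)] t]) auto
  thus ?thesis unfolding cK_def by (simp only: mult_ac)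
qed

definition "cC = 4 * (2 * B * cD * cZ\<^sup>2 + 2 * real CARD('n) * cK + 4 * B * T * cD * cZ) * exp (2 * B * T)"

lemma cC_pos: "0 < cC"
  using B1 T1 cD_pos cZ_pos cK_pos by (auto simp: cC_def intro!: mult_pos_pos add_pos_pos)

text \<open>Transposes the matrix of correlations of W and \<open>D\<close>: the scalar now comes
  from \<open>D\<close>, as is required for testing the equation of \<open>zeta\<close> with it.
  Passing from entries to the norm costs the dimension.\<close>

lemma norm_expectation_D_W_le:
  assumes r: "0 \<le> r" "r \<le> T" and t: "0 \<le> t" "t \<le> T"
  shows "norm (\<integral>\<omega>. D t \<omega> $ j *\<^sub>R W r \<omega> \<partial>M) \<le> real CARD('n) * (cK * (\<epsilon> * sqrt \<epsilon>))"
proof -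
  have D2: "Lp_le M 2 (D t) (cD * \<epsilon>)" by (rule Lp_le_exponent[OF Lp4_D[OF t]]) auto
  have W2: "Lp_le M 2 (W r) (c * T)" by (rule Lp_W[OF r]) auto
  have i1: "integrable M (\<lambda>\<omega>. D t \<omega> $ j *\<^sub>R W r \<omega>)"
    by (rule Lp_le_integrable[OF Lp_le_scaleR_fun[OF Lp_le_component[OF D2] W2]]) auto
  have "\<bar>(\<integral>\<omega>. D t \<omega> $ j *\<^sub>R W r \<omega> \<partial>M) $ i\<bar> \<le> cK * (\<epsilon> * sqrt \<epsilon>)" for i
  proof -
    have i2: "integrable M (\<lambda>\<omega>. W r \<omega> $ i *\<^sub>R D t \<omega>)"
      by (rule Lp_le_integrable[OF Lp_le_scaleR_fun[OF Lp_le_component[OF W2] D2]]) auto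
    have "(\<integral>\<omega>. D t \<omega> $ j *\<^sub>R W r \<omega> \<partial>M) $ i = (\<integral>\<omega>. W r \<omega> $ i *\<^sub>R D t \<omega> \<partial>M) $ j"
      using integral_bounded_linear[OF bounded_linear_vec_nth[of i] i1] integral_bounded_linear[OF bounded_linear_vec_nth[of j] i2]
      by (simp add: mult.commute)
    thus ?thesis using component_le_norm_cart[of "\<integral>\<omega>. W r \<omega> $ i *\<^sub>R D t \<omega> \<partial>M" j] norm_expectation_W_D_le[OF r t, of i] by simp
  qed
  hence "(\<Sum>i\<in>UNIV. \<bar>(\<integral>\<omega>. D t \<omega> $ j *\<^sub>R W r \<omega> \<partial>M) $ i\<bar>) \<le> (\<Sum>i\<in>(UNIV :: 'n set). cK * (\<epsilon> * sqrt \<epsilon>))"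
    by (intro sum_mono)
  thus ?thesis using norm_le_l1_cart[of "\<integral>\<omega>. D t \<omega> $ j *\<^sub>R W r \<omega> \<partial>M"] by simp
qed

text \<open>Gronwall in the time of \<open>zeta\<close>, with a coordinate of \<open>D t\<close>
  frozen as test variable of size \<epsilon>. The noise source is sqrt (2 \<epsilon>) times the
  correlation of \<open>D\<close> with W, which is of order \<epsilon>^(3/2). The nonlinear part of
  the drift and the \<open>G\<close> term reach \<epsilon>^2 by Cauchy-Schwarz.\<close>

lemma norm_expectation_D_zeta_le:
  assumes t: "0 \<le> t" "t \<le> T" and r: "0 \<le> r" "r \<le> T"
  shows "norm (\<integral>\<omega>. D t \<omega> $ j *\<^sub>R zeta r \<omega> \<partial>M) \<le> cC * \<epsilon>\<^sup>2"
proof -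
  let ?r = "(2 * B * cD * cZ\<^sup>2 + 2 * real CARD('n) * cK + 4 * B * T * cD * cZ) * \<epsilon>\<^sup>2"
  let ?\<eta> = "\<lambda>\<omega>. D t \<omega> $ j"
  have eta: "Lp_le M 2 ?\<eta> (cD * \<epsilon>)"
    by (rule Lp_le_component[OF Lp_le_exponent[OF Lp4_D[OF t]]]) auto
  have [measurable]: "?\<eta> \<in> borel_measurable M" using eta by (simp add: Lp_le_def)
  note [measurable] = mean_measurable[OF b_continuous] mean_measurable[OF G_continuous]
  have pos: "0 < 2 * B * cD * cZ\<^sup>2" "0 < 2 * real CARD('n) * cK" "0 < 4 * B * T * cD * cZ"
    using B1 T1 cD_pos cZ_pos cK_pos by auto
  have Z2: "Lp_le M 2 (zeta s) (cZ * sqrt \<epsilon>)" if "0 \<le> s" "s \<le> T" for s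
    by (rule Lp_le_exponent[OF Lp_zeta[OF that]]) auto
  have G2: "Lp_le M 2 (\<lambda>\<omega>. LBINT s:{0..r}. G (Z s \<omega>) s - mean G s) (T * (4 * B * (cZ * sqrt \<epsilon>)))" if r: "0 \<le> r" "r \<le> T" for r
  proof (rule Lp_le_interval_integral)
    show "Lp_le M 2 (\<lambda>\<omega>. G (Z s \<omega>) s - mean G s) (4 * B * (cZ * sqrt \<epsilon>))" if "0 \<le> s" "s \<le> r" for s
      using that r by (intro Lp_drift_centered(2)[OF G_C2 G_continuous] Z2) auto
  qed (use r T1 B1 cZ_eps_pos in auto)
  have b2: "Lp_le M 2 (\<lambda>\<omega>. b (Z s \<omega>) s - mean b s) (4 * B * (cZ * sqrt \<epsilon>))" if "0 \<le> s" "s \<le> T" for s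
    using that by (intro Lp_drift_centered(2)[OF b_C2 b_continuous] Z2) auto
  have "norm (\<integral>\<omega>. ?\<eta> \<omega> *\<^sub>R zeta r \<omega> \<partial>M) \<le> 4 * ?r * exp (2 * B * T)"
  proof (rule norm_gronwall[where A = "\<lambda>s. \<integral>\<omega>. ?\<eta> \<omega> *\<^sub>R (b (Z s \<omega>) s - mean b s) \<partial>M"])
    show "(\<lambda>s. \<integral>\<omega>. ?\<eta> \<omega> *\<^sub>R (b (Z s \<omega>) s - mean b s) \<partial>M) \<in> borel_measurable borel" by measurable
    have "0 < 2 * B * cD * cZ\<^sup>2 + 2 * real CARD('n) * cK + 4 * B * T * cD * cZ" using pos by linarith
    thus "0 < ?r" using eps by (rule_tac mult_pos_pos) auto
    show "norm (\<integral>\<omega>. ?\<eta> \<omega> *\<^sub>R zeta r \<omega> \<partial>M) \<le> cD * \<epsilon> * (cZ * sqrt \<epsilon>)" if "0 \<le> r" "r \<le> T" for r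
      by (rule norm_expectation_scaleR_le[OF eta Z2[OF that]])
    show "norm (\<integral>\<omega>. ?\<eta> \<omega> *\<^sub>R (b (Z s \<omega>) s - mean b s) \<partial>M) \<le> B * norm (\<integral>\<omega>. ?\<eta> \<omega> *\<^sub>R zeta s \<omega> \<partial>M) + ?r" if s: "0 \<le> s" "s \<le> T" for s
    proof -
      \<comment> \<open>What the centered drift contains beyond its linear part: the Taylor
        remainder and the offset between \<open>mean b\<close> and the drift at \<open>z\<close>,
        both of order \<epsilon> in L^2.\<close>
      let ?q = "\<lambda>\<omega>. (b (Z s \<omega>) s - b (z s) s - b' (z s) s (zeta s \<omega>)) - (mean b s - b (z s) s)"
      have sT: "s \<in> {0..T}" using s by simp
      have q: "Lp_le M 2 ?q (B * cZ\<^sup>2 * \<epsilon> + B * cZ\<^sup>2 * \<epsilon>)"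
        using B1 cZ_pos eps by (intro Lp_le_diff Lp_taylor_Z[OF b_C2 b_continuous s] Lp_le_const norm_mean_diff_le[OF b_C2 b_continuous s]) auto
      have "b (Z s \<omega>) s - mean b s = b' (z s) s (zeta s \<omega>) + ?q \<omega>" for \<omega> by simp
      hence "(\<integral>\<omega>. ?\<eta> \<omega> *\<^sub>R (b (Z s \<omega>) s - mean b s) \<partial>M) = (\<integral>\<omega>. ?\<eta> \<omega> *\<^sub>R (b' (z s) s (zeta s \<omega>) + ?q \<omega>) \<partial>M)"
        by (intro Bochner_Integration.integral_cong refl arg_cong[where f = "(*\<^sub>R) _"])
      also have "\<dots> = (\<integral>\<omega>. ?\<eta> \<omega> *\<^sub>R b' (z s) s (zeta s \<omega>) \<partial>M) + (\<integral>\<omega>. ?\<eta> \<omega> *\<^sub>R ?q \<omega> \<partial>M)"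
        by (rule expectation_scaleR_add[OF eta Lp_le_linear[OF b'_linear[OF sT] b'_bound[OF sT] Z2[OF s]] q]) simp
      finally have E1: "(\<integral>\<omega>. ?\<eta> \<omega> *\<^sub>R (b (Z s \<omega>) s - mean b s) \<partial>M) = (\<integral>\<omega>. ?\<eta> \<omega> *\<^sub>R b' (z s) s (zeta s \<omega>) \<partial>M) + (\<integral>\<omega>. ?\<eta> \<omega> *\<^sub>R ?q \<omega> \<partial>M)" .
      have E2: "(\<integral>\<omega>. ?\<eta> \<omega> *\<^sub>R b' (z s) s (zeta s \<omega>) \<partial>M) = b' (z s) s (\<integral>\<omega>. ?\<eta> \<omega> *\<^sub>R zeta s \<omega> \<partial>M)"
        by (rule expectation_scaleR_linear[OF b'_linear[OF sT] eta Z2[OF s]])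
      have E3: "norm (\<integral>\<omega>. ?\<eta> \<omega> *\<^sub>R ?q \<omega> \<partial>M) \<le> cD * \<epsilon> * (B * cZ\<^sup>2 * \<epsilon> + B * cZ\<^sup>2 * \<epsilon>)"
        by (rule norm_expectation_scaleR_le[OF eta q])
      have N: "norm (\<integral>\<omega>. ?\<eta> \<omega> *\<^sub>R (b (Z s \<omega>) s - mean b s) \<partial>M)
         \<le> B * norm (\<integral>\<omega>. ?\<eta> \<omega> *\<^sub>R zeta s \<omega> \<partial>M) + cD * \<epsilon> * (B * cZ\<^sup>2 * \<epsilon> + B * cZ\<^sup>2 * \<epsilon>)"
        unfolding E1 E2 by (rule norm_triangle_mono[OF b'_bound[OF sT] E3])
      have "cD * \<epsilon> * (B * cZ\<^sup>2 * \<epsilon> + B * cZ\<^sup>2 * \<epsilon>) = (2 * B * cD * cZ\<^sup>2) * \<epsilon>\<^sup>2"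
        unfolding power2_eq_square by algebra
      moreover have "\<dots> \<le> ?r" by (rule mult_right_mono) (use pos in linarith, simp)
      ultimately show ?thesis using N by linarith
    qed
    show "norm ((\<integral>\<omega>. ?\<eta> \<omega> *\<^sub>R zeta r \<omega> \<partial>M) - (LBINT s:{0..r}. (\<integral>\<omega>. ?\<eta> \<omega> *\<^sub>R (b (Z s \<omega>) s - mean b s) \<partial>M))) \<le> ?r"
      if r: "0 \<le> r" "r \<le> T" for r
    proof -
      have "Lp_le M 2 (\<lambda>\<omega>. LBINT s:{0..r}. b (Z s \<omega>) s - mean b s) (T * (4 * B * (cZ * sqrt \<epsilon>)))"
        using r T1 B1 cZ_eps_pos by (intro Lp_le_interval_integral b2) auto
      note i0 = Lp_le_integrable[OF Lp_le_scaleR_fun[OF eta this] order_refl]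
      note i1 = Lp_le_integrable[OF Lp_le_scaleR_fun[OF eta Lp_W[OF r]] order_refl]
      note i2 = Lp_le_integrable[OF Lp_le_scaleR_fun[OF eta G2[OF r]] order_refl]
      have "(\<integral>\<omega>. ?\<eta> \<omega> *\<^sub>R zeta r \<omega> \<partial>M) = (\<integral>\<omega>. ?\<eta> \<omega> *\<^sub>R (LBINT s:{0..r}. b (Z s \<omega>) s - mean b s) +
         (sqrt (2 * \<epsilon>) *\<^sub>R (?\<eta> \<omega> *\<^sub>R W r \<omega>) - \<epsilon> *\<^sub>R (?\<eta> \<omega> *\<^sub>R (LBINT s:{0..r}. G (Z s \<omega>) s - mean G s))) \<partial>M)"
      proof (rule integral_cong_AE)
        show "AE \<omega> in M. ?\<eta> \<omega> *\<^sub>R zeta r \<omega> = ?\<eta> \<omega> *\<^sub>R (LBINT s:{0..r}. b (Z s \<omega>) s - mean b s) +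
         (sqrt (2 * \<epsilon>) *\<^sub>R (?\<eta> \<omega> *\<^sub>R W r \<omega>) - \<epsilon> *\<^sub>R (?\<eta> \<omega> *\<^sub>R (LBINT s:{0..r}. G (Z s \<omega>) s - mean G s)))"
          using zeta_equation[OF r]
        proof eventually_elim
          case (elim \<omega>)
          show ?case unfolding elim scaleR_add_right scaleR_diff_right[of "?\<eta> \<omega>" "sqrt (2 * \<epsilon>) *\<^sub>R W r \<omega>"]
            by (simp only: scaleR_left_commute[of "?\<eta> \<omega>"])
        qed
      qed measurable
      also have "\<dots> = (\<integral>\<omega>. ?\<eta> \<omega> *\<^sub>R (LBINT s:{0..r}. b (Z s \<omega>) s - mean b s) \<partial>M) +
         (sqrt (2 * \<epsilon>) *\<^sub>R (\<integral>\<omega>. ?\<eta> \<omega> *\<^sub>R W r \<omega> \<partial>M) - \<epsilon> *\<^sub>R (\<integral>\<omega>. ?\<eta> \<omega> *\<^sub>R (LBINT s:{0..r}. G (Z s \<omega>) s - mean G s) \<partial>M))"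
        using i0 i1 i2 by (simp del: scaleR_scaleR real_scaleR_def)
      also have "(\<integral>\<omega>. ?\<eta> \<omega> *\<^sub>R (LBINT s:{0..r}. b (Z s \<omega>) s - mean b s) \<partial>M) = (LBINT s:{0..r}. (\<integral>\<omega>. ?\<eta> \<omega> *\<^sub>R (b (Z s \<omega>) s - mean b s) \<partial>M))"
        by (rule expectation_scaleR_interval_integral[OF _ eta b2]) (use r in \<open>measurable, auto\<close>)
      finally have "(\<integral>\<omega>. ?\<eta> \<omega> *\<^sub>R zeta r \<omega> \<partial>M) - (LBINT s:{0..r}. (\<integral>\<omega>. ?\<eta> \<omega> *\<^sub>R (b (Z s \<omega>) s - mean b s) \<partial>M))
         = sqrt (2 * \<epsilon>) *\<^sub>R (\<integral>\<omega>. ?\<eta> \<omega> *\<^sub>R W r \<omega> \<partial>M) - \<epsilon> *\<^sub>R (\<integral>\<omega>. ?\<eta> \<omega> *\<^sub>R (LBINT s:{0..r}. G (Z s \<omega>) s - mean G s) \<partial>M)"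
        by simp
      also have "norm \<dots> \<le> (2 * sqrt \<epsilon>) * (real CARD('n) * (cK * (\<epsilon> * sqrt \<epsilon>))) + \<epsilon> * (cD * \<epsilon> * (T * (4 * B * (cZ * 1))))"
      proof (rule norm_triangle_le_diff[OF add_mono])
        have "sqrt (2 * \<epsilon>) * norm (\<integral>\<omega>. ?\<eta> \<omega> *\<^sub>R W r \<omega> \<partial>M) \<le> (2 * sqrt \<epsilon>) * (real CARD('n) * (cK * (\<epsilon> * sqrt \<epsilon>)))"
          using sqrt_eps by (intro mult_mono norm_expectation_D_W_le r t) auto
        thus "norm (sqrt (2 * \<epsilon>) *\<^sub>R (\<integral>\<omega>. ?\<eta> \<omega> *\<^sub>R W r \<omega> \<partial>M)) \<le> (2 * sqrt \<epsilon>) * (real CARD('n) * (cK * (\<epsilon> * sqrt \<epsilon>)))"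
          using eps by simp
        have "norm (\<integral>\<omega>. ?\<eta> \<omega> *\<^sub>R (LBINT s:{0..r}. G (Z s \<omega>) s - mean G s) \<partial>M) \<le> cD * \<epsilon> * (T * (4 * B * (cZ * sqrt \<epsilon>)))"
          by (rule norm_expectation_scaleR_le[OF eta G2[OF r]])
        \<comment> \<open>The surplus factor sqrt \<epsilon> \<le> 1 is given away, since
          \<epsilon>^2 is all that is wanted.\<close>
        also have "\<dots> \<le> cD * \<epsilon> * (T * (4 * B * (cZ * 1)))"
          using eps T1 B1 cZ_pos cD_pos by (intro mult_left_mono) auto
        finally show "norm (\<epsilon> *\<^sub>R (\<integral>\<omega>. ?\<eta> \<omega> *\<^sub>R (LBINT s:{0..r}. G (Z s \<omega>) s - mean G s) \<partial>M)) \<le> \<epsilon> * (cD * \<epsilon> * (T * (4 * B * (cZ * 1))))"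
          using eps by (simp add: mult_left_mono)
      qed
      also have "(2 * sqrt \<epsilon>) * (real CARD('n) * (cK * (\<epsilon> * sqrt \<epsilon>))) = 2 * real CARD('n) * cK * (\<epsilon> * (sqrt \<epsilon> * sqrt \<epsilon>))" by simp
      also have "\<dots> = (2 * real CARD('n) * cK) * \<epsilon>\<^sup>2" unfolding sqrt_eps(3) by (simp add: power2_eq_square)
      also have "\<epsilon> * (cD * \<epsilon> * (T * (4 * B * (cZ * 1)))) = (4 * B * T * cD * cZ) * \<epsilon>\<^sup>2" by (simp add: power2_eq_square)
      finally have "norm ((\<integral>\<omega>. ?\<eta> \<omega> *\<^sub>R zeta r \<omega> \<partial>M) - (LBINT s:{0..r}. (\<integral>\<omega>. ?\<eta> \<omega> *\<^sub>R (b (Z s \<omega>) s - mean b s) \<partial>M)))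
         \<le> (2 * real CARD('n) * cK + 4 * B * T * cD * cZ) * \<epsilon>\<^sup>2" by (simp only: distrib_right)
      also have "\<dots> \<le> ?r" using pos by (intro mult_right_mono) auto
      finally show ?thesis .
    qed
  qed (use B1 r in auto)
  thus ?thesis unfolding cC_def by (simp only: mult_ac)
qed

definition "cF = B * cD\<^sup>2 + real CARD('n) * (B * cC + cD * (B * cZ\<^sup>2))"

lemma cF_pos: "0 < cF"
  using B1 cD_pos cZ_pos cC_pos by (auto simp: cF_def intro!: add_pos_pos mult_pos_pos)

text \<open>The expectation gains half a power over the L^2 bound of \<open>remD\<close>. The
  fluctuation of each partial derivative is linearised in \<open>zeta\<close>, whose correlation
  with \<open>D\<close> is O(\<epsilon>^2); the Taylor remainder, of order \<epsilon>, is paired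
  with \<open>D\<close>, of size \<epsilon>.\<close>

lemma norm_expectation_remD_le:
  fixes f :: "real^'n \<Rightarrow> real \<Rightarrow> 'c::euclidean_space"
  assumes f: "C3_le T B f f'" and t: "0 \<le> t" "t \<le> T"
  shows "norm (\<integral>\<omega>. remD f f' t \<omega> \<partial>M) \<le> cF * \<epsilon>\<^sup>2"
proof -
  let ?g = "\<lambda>i y t. f' y t (axis i 1)"
  let ?P = "\<lambda>i \<omega>. D t \<omega> $ i *\<^sub>R remZ (?g i) t \<omega>"
  have eta: "Lp_le M 2 (\<lambda>\<omega>. D t \<omega> $ i) (cD * \<epsilon>)" for i
    by (rule Lp_le_component[OF Lp_le_exponent[OF Lp4_D[OF t]]]) auto
  have Z2: "Lp_le M 2 (zeta t) (cZ * sqrt \<epsilon>)" by (rule Lp_le_exponent[OF Lp_zeta[OF t]]) auto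
  have R2: "Lp_le M 2 (remZ (?g i) t) (2 * B * (cZ * sqrt \<epsilon>))" for i
    by (rule Lp_le_exponent[OF remD_decomposition(2)[OF f t]]) auto
  have iP: "integrable M (?P i)" for i
    by (rule Lp_le_integrable[OF Lp_le_scaleR_fun[OF eta R2] order_refl])
  note i1 = Lp_le_integrable[OF remD_decomposition(1)[OF f t]]
  have P: "norm (\<integral>\<omega>. ?P i \<omega> \<partial>M) \<le> B * (cC * \<epsilon>\<^sup>2) + cD * \<epsilon> * (B * cZ\<^sup>2 * \<epsilon>)" for i
  proof -
    obtain f'' where C: "C2_le T B (?g i) f''" and gc: "continuous_on UNIV (\<lambda>z. ?g i (fst z) (snd z))"
      using f unfolding C3_le_def by blast
    have lin: "linear (f'' (z t) t)" and bd: "norm (f'' (z t) t h) \<le> B * norm h" for h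
      using C t by (auto simp: C2_le_def)
    note L = Lp_taylor_Z[OF C gc t]
    have "?P i = (\<lambda>\<omega>. D t \<omega> $ i *\<^sub>R (f'' (z t) t (zeta t \<omega>) + (?g i (Z t \<omega>) t - ?g i (z t) t - f'' (z t) t (zeta t \<omega>))))"
      by (simp add: remZ_def fun_eq_iff)
    hence "(\<integral>\<omega>. ?P i \<omega> \<partial>M) = (\<integral>\<omega>. D t \<omega> $ i *\<^sub>R f'' (z t) t (zeta t \<omega>) \<partial>M)
        + (\<integral>\<omega>. D t \<omega> $ i *\<^sub>R (?g i (Z t \<omega>) t - ?g i (z t) t - f'' (z t) t (zeta t \<omega>)) \<partial>M)"
      by (simp only: expectation_scaleR_add[OF eta Lp_le_linear[OF lin bd Z2] L])
    also have "(\<integral>\<omega>. D t \<omega> $ i *\<^sub>R f'' (z t) t (zeta t \<omega>) \<partial>M) = f'' (z t) t (\<integral>\<omega>. D t \<omega> $ i *\<^sub>R zeta t \<omega> \<partial>M)"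
      by (rule expectation_scaleR_linear[OF lin eta Z2])
    also have "norm (f'' (z t) t (\<integral>\<omega>. D t \<omega> $ i *\<^sub>R zeta t \<omega> \<partial>M)
        + (\<integral>\<omega>. D t \<omega> $ i *\<^sub>R (?g i (Z t \<omega>) t - ?g i (z t) t - f'' (z t) t (zeta t \<omega>)) \<partial>M))
      \<le> B * (cC * \<epsilon>\<^sup>2) + cD * \<epsilon> * (B * cZ\<^sup>2 * \<epsilon>)"
    proof (rule norm_triangle_mono[OF _ norm_expectation_scaleR_le[OF eta L]])
      have "B * norm (\<integral>\<omega>. D t \<omega> $ i *\<^sub>R zeta t \<omega> \<partial>M) \<le> B * (cC * \<epsilon>\<^sup>2)"
        using B0 by (intro mult_left_mono norm_expectation_D_zeta_le t)
      thus "norm (f'' (z t) t (\<integral>\<omega>. D t \<omega> $ i *\<^sub>R zeta t \<omega> \<partial>M)) \<le> B * (cC * \<epsilon>\<^sup>2)"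
        using bd order_trans by blast
    qed
    finally show ?thesis .
  qed
  have E: "(\<integral>\<omega>. remD f f' t \<omega> \<partial>M) = (\<integral>\<omega>. remD f f' t \<omega> - (\<Sum>i\<in>UNIV. ?P i \<omega>) \<partial>M) + (\<Sum>i\<in>UNIV. (\<integral>\<omega>. ?P i \<omega> \<partial>M))"
  proof -
    have "(\<Sum>i\<in>UNIV. (\<integral>\<omega>. ?P i \<omega> \<partial>M)) = (\<integral>\<omega>. (\<Sum>i\<in>UNIV. ?P i \<omega>) \<partial>M)"
      by (rule Bochner_Integration.integral_sum[symmetric, OF iP])
    moreover have "integrable M (\<lambda>\<omega>. \<Sum>i\<in>UNIV. ?P i \<omega>)"
      by (rule Bochner_Integration.integrable_sum[OF iP])
    from Bochner_Integration.integral_add[OF i1 this]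
    have "(\<integral>\<omega>. remD f f' t \<omega> - (\<Sum>i\<in>UNIV. ?P i \<omega>) \<partial>M) + (\<integral>\<omega>. (\<Sum>i\<in>UNIV. ?P i \<omega>) \<partial>M) = (\<integral>\<omega>. remD f f' t \<omega> \<partial>M)"
      by simp
    ultimately show ?thesis by (simp only:)
  qed
  have N: "norm (\<integral>\<omega>. remD f f' t \<omega> - (\<Sum>i\<in>UNIV. ?P i \<omega>) \<partial>M) \<le> B * (cD * \<epsilon>) * (cD * \<epsilon>)"
    by (rule Lp_le_expectation[OF remD_decomposition(1)[OF f t]]) simp
  have "norm (\<integral>\<omega>. remD f f' t \<omega> \<partial>M) \<le> B * (cD * \<epsilon>) * (cD * \<epsilon>) + (\<Sum>i\<in>(UNIV :: 'n set). B * (cC * \<epsilon>\<^sup>2) + cD * \<epsilon> * (B * cZ\<^sup>2 * \<epsilon>))"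
    unfolding E by (rule norm_triangle_mono[OF N sum_norm_le[OF P]])
  moreover have "B * (cD * \<epsilon>) * (cD * \<epsilon>) + (\<Sum>i\<in>(UNIV :: 'n set). B * (cC * \<epsilon>\<^sup>2) + cD * \<epsilon> * (B * cZ\<^sup>2 * \<epsilon>)) = cF * \<epsilon>\<^sup>2"
    by (simp add: cF_def power2_eq_square algebra_simps)
  ultimately show ?thesis by simp
qed

lemma Lp_one: "Lp_le M 2 (\<lambda>_. 1 :: real) 1"
  by (rule Lp_le_const) auto

definition "cM = 4 * (cF + cE + 3 * crho) * exp (2 * B * T)"

text \<open>The test variable is 1. Brownian increments have mean zero, so m = 0 and the mean of
  \<open>vel\<close> is O(\<epsilon>), whereas its correlation with W is bounded only by O(sqrt
  \<epsilon>).\<close>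

lemma norm_expectation_D_le:
  assumes t: "0 \<le> t" "t \<le> T"
  shows "norm (\<integral>\<omega>. D t \<omega> \<partial>M) \<le> cM * \<epsilon>\<^sup>2"
proof -
  let ?r = "(cF + cE + 3 * crho) * \<epsilon>\<^sup>2"
  have V0: "(\<integral>\<omega>. (1::real) *\<^sub>R (V 0 \<omega> - b x 0) \<partial>M) = 0" using V0_mean by simp
  have "norm (\<integral>\<omega>. D t \<omega> \<partial>M) \<le> 4 * ?r * exp (2 * B * T)"
  proof (rule norm_gronwall[where A = "\<lambda>s. \<integral>\<omega>. drift_diff b s \<omega> \<partial>M"])
    show "0 < ?r" using cF_pos cE_pos crho_pos eps by (intro mult_pos_pos add_pos_pos) auto
    show "norm (\<integral>\<omega>. D t \<omega> \<partial>M) \<le> cD * \<epsilon>" if "0 \<le> t" "t \<le> T" for t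
      by (rule Lp_le_expectation[OF Lp4_D[OF that]]) simp
    show "norm (\<integral>\<omega>. drift_diff b s \<omega> \<partial>M) \<le> B * norm (\<integral>\<omega>. D s \<omega> \<partial>M) + ?r" if s: "0 \<le> s" "s \<le> T" for s
    proof -
      have "norm (\<integral>\<omega>. remD b b' s \<omega> \<partial>M) \<le> cF * \<epsilon>\<^sup>2" by (rule norm_expectation_remD_le[OF b_C3 s])
      also have "\<dots> \<le> ?r" using cE_pos crho_pos by (intro mult_right_mono) auto
      finally show ?thesis using norm_expectation_drift_diff_le[OF b_C3 s Lp_one] by simp
    qed
    show "norm ((\<integral>\<omega>. D t \<omega> \<partial>M) - (LBINT s:{0..t}. (\<integral>\<omega>. drift_diff b s \<omega> \<partial>M))) \<le> ?r" if t: "0 \<le> t" "t \<le> T" for t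
    proof -
      have v: "norm (\<integral>\<omega>. (1::real) *\<^sub>R vel t \<omega> \<partial>M) \<le> 3 * (1 * crho * \<epsilon> + 4 * 0 * sqrt \<epsilon>)"
        by (rule norm_expectation_vel_le[OF Lp_one _ _ V0 t]) (auto simp: W_mean)
      have "norm ((\<integral>\<omega>. D t \<omega> \<partial>M) - (LBINT s:{0..t}. (\<integral>\<omega>. drift_diff b s \<omega> \<partial>M)))
         = norm (\<epsilon> *\<^sub>R (\<integral>\<omega>. gap t \<omega> \<partial>M) - \<epsilon> *\<^sub>R (\<integral>\<omega>. vel t \<omega> \<partial>M))"
        using expectation_test_equation[OF Lp_one t V0] by simp
      also have "\<dots> \<le> \<epsilon> * (cE * \<epsilon>) + \<epsilon> * (3 * crho * \<epsilon>)"
        using norm_expectation_gap_le[OF t] v eps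
        by (intro norm_triangle_le_diff add_mono) (auto intro!: mult_left_mono)
      also have "\<dots> = (cE + 3 * crho) * \<epsilon>\<^sup>2" by (simp add: power2_eq_square algebra_simps)
      also have "\<dots> \<le> ?r" using cF_pos by (intro mult_right_mono) auto
      finally show ?thesis .
    qed
    show "(\<lambda>s. \<integral>\<omega>. drift_diff b s \<omega> \<partial>M) \<in> borel_measurable borel"
      using expectation_drift_diff_b_measurable[of "\<lambda>_. 1"] by simp
  qed (use B1 t in auto)
  thus ?thesis unfolding cM_def by (simp only: mult_ac)
qed

text \<open>The derivative of f at \<open>z\<close> applied to E D, plus the mean of
  \<open>remD\<close>, both O(\<epsilon>^2). Here f ranges over the regularity class of the drift; a
  test function is the time-independent case.\<close>

lemma weak_error:
  fixes f :: "real^'n \<Rightarrow> real \<Rightarrow> 'c::euclidean_space"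
  assumes f: "C3_le T B f f'" and t: "0 \<le> t" "t \<le> T"
  shows "norm ((\<integral>\<omega>. f (X t \<omega>) t \<partial>M) - (\<integral>\<omega>. f (Z t \<omega>) t \<partial>M)) \<le> (B * cM + cF) * \<epsilon>\<^sup>2"
proof -
  have fc: "continuous_on UNIV (\<lambda>z. f (fst z) (snd z))" and bd: "norm (f y t) \<le> B" for y
    using f t by (auto simp: C3_le_def C2_le_def)
  note [measurable (raw)] = borel_measurable_curried[OF fc]
  have iX: "integrable M (\<lambda>\<omega>. f (X t \<omega>) t)"
    by (rule Lp_le_integrable[OF Lp_le_bounded[where a = B and q = 1]]) (use bd B1 in auto)
  have iZ: "integrable M (\<lambda>\<omega>. f (Z t \<omega>) t)"
    by (rule Lp_le_integrable[OF Lp_le_bounded[where a = B and q = 1]]) (use bd B1 in auto)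
  have "(\<integral>\<omega>. f (X t \<omega>) t \<partial>M) - (\<integral>\<omega>. f (Z t \<omega>) t \<partial>M) = (\<integral>\<omega>. (1::real) *\<^sub>R drift_diff f t \<omega> \<partial>M)"
    using iX iZ by (simp add: drift_diff_def)
  also have "norm \<dots> \<le> B * norm (\<integral>\<omega>. D t \<omega> \<partial>M) + norm (\<integral>\<omega>. remD f f' t \<omega> \<partial>M)"
    using norm_expectation_drift_diff_le[OF f t Lp_one] by simp
  also have "\<dots> \<le> B * (cM * \<epsilon>\<^sup>2) + cF * \<epsilon>\<^sup>2"
    by (intro add_mono mult_left_mono norm_expectation_D_le norm_expectation_remD_le f t B0)
  finally show ?thesis by (simp add: algebra_simps)
qed

end

section \<open>Transfer to the coupled processes\<close>

text \<open>Time is rounded down to multiples of 1 / (n + 1). The rounded process depends on time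
  through a countable index, hence is jointly measurable, and it converges by continuity of the
  paths.\<close>

lemma jointly_measurable_of_continuous_paths:
  fixes f :: "real \<Rightarrow> 'a \<Rightarrow> 'b::euclidean_space"
  assumes m: "\<And>t. f t \<in> borel_measurable M" and c: "\<And>\<omega>. \<omega> \<in> space M \<Longrightarrow> continuous_on UNIV (\<lambda>t. f t \<omega>)"
  shows "case_prod f \<in> borel_measurable (borel \<Otimes>\<^sub>M M)"
proof (rule borel_measurable_LIMSEQ_metric)
  let ?a = "\<lambda>n t. real_of_int \<lfloor>real (Suc n) * t\<rfloor> / real (Suc n)"
  show "(\<lambda>p. f (?a n (fst p)) (snd p)) \<in> borel_measurable (borel \<Otimes>\<^sub>M M)" for n
  proof (rule measurable_compose_countable[where f = "\<lambda>i p. f (real_of_int i / real (Suc n)) (snd p)"])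
    show "(\<lambda>p. f (real_of_int i / real (Suc n)) (snd p)) \<in> borel_measurable (borel \<Otimes>\<^sub>M M)" for i
      using m by measurable
    show "(\<lambda>p. \<lfloor>real (Suc n) * fst p\<rfloor>) \<in> measurable (borel \<Otimes>\<^sub>M M) (count_space UNIV)" by measurable
  qed
  fix p :: "real \<times> 'a" assume "p \<in> space (borel \<Otimes>\<^sub>M M)"
  then obtain t :: real and \<omega> where p: "p = (t, \<omega>)" "\<omega> \<in> space M" by (auto simp: space_pair_measure)
  have "(\<lambda>n. ?a n t) \<longlonglongrightarrow> t"
  proof (rule LIM_zero_cancel, rule Lim_null_comparison)
    show "\<forall>\<^sub>F n in sequentially. norm (?a n t - t) \<le> 1 / real (Suc n)"
    proof (intro always_eventually allI)
      fix n
      have "\<bar>real_of_int \<lfloor>real (Suc n) * t\<rfloor> - real (Suc n) * t\<bar> \<le> 1" by linarith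
      hence "\<bar>real_of_int \<lfloor>real (Suc n) * t\<rfloor> - real (Suc n) * t\<bar> / real (Suc n) \<le> 1 / real (Suc n)"
        by (intro divide_right_mono) auto
      moreover have "?a n t - t = (real_of_int \<lfloor>real (Suc n) * t\<rfloor> - real (Suc n) * t) / real (Suc n)"
        by (simp add: diff_divide_distrib)
      ultimately show "norm (?a n t - t) \<le> 1 / real (Suc n)" by (simp only: real_norm_def abs_divide abs_of_nat)
    qed
    show "(\<lambda>n. 1 / real (Suc n)) \<longlonglongrightarrow> 0" using LIMSEQ_inverse_real_of_nat by (simp add: inverse_eq_divide)
  qed
  hence "(\<lambda>n. f (?a n t) \<omega>) \<longlonglongrightarrow> f t \<omega>"
    using c[OF p(2)] by (intro isCont_tendsto_compose[where g = "\<lambda>t. f t \<omega>"]) (simp add: continuous_on_eq_continuous_at)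
  thus "(\<lambda>n. f (?a n (fst p)) (snd p)) \<longlonglongrightarrow> case_prod f p" by (simp add: p)
qed

text \<open>The maximum with 1 makes the bound positive for every real K, and at least 1 as the
  locale demands of \<kappa>.\<close>

lemma Lp_le_of_moment:
  fixes Y :: "'a \<Rightarrow> 'b::euclidean_space"
  assumes "Y \<in> borel_measurable M" "(\<integral>\<^sup>+\<omega>. ennreal (norm (Y \<omega>) powr p) \<partial>M) \<le> ennreal K" "1 \<le> p"
  shows "Lp_le M p Y (max K 1 powr (1 / p))"
proof -
  have "ennreal K \<le> ennreal (max K 1)" by (intro ennreal_leI) simp
  also have "max K 1 = (max K 1 powr (1 / p)) powr p" using assms(3) by (simp add: powr_powr)
  finally have "(\<integral>\<^sup>+\<omega>. ennreal (norm (Y \<omega>) powr p) \<partial>M) \<le> ennreal ((max K 1 powr (1 / p)) powr p)"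
    by (rule order_trans[OF assms(2)])
  thus ?thesis using assms(1) by (simp add: Lp_le_def)
qed

text \<open>The coupled processes agree, outside a null set and for nonnegative times, with jointly
  measurable ones, to which the estimates of the locale \<open>kinetic\<close> apply.\<close>

lemma langevin_coupling_kinetic:
  fixes b :: "real^'n \<Rightarrow> real \<Rightarrow> real^'n" and M :: "'a measure"
  assumes b: "smooth (unc b)" "zperiodic_t b"
    and T: "1 \<le> T" and B: "1 \<le> B" and p: "4 \<le> p" and eps: "0 < eps" "eps < 1"
    and C3: "C3_le T B b (space_deriv b)" and C2: "C2_le T B (drift_correction b) G'"
    and lip: "\<And>y y' t t'. t \<in> {0..T} \<Longrightarrow> t' \<in> {0..T} \<Longrightarrow> norm (b y t - b y' t') \<le> B * (norm (y - y') + \<bar>t - t'\<bar>)"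
    and coup: "langevin_coupling eps b x M F W X V Z"
    and mean: "integral\<^sup>L M (\<lambda>\<omega>. V 0 \<omega> - b x 0) = 0"
    and moment: "(\<integral>\<^sup>+\<omega>. ennreal (norm (V 0 \<omega> - b x 0) powr p) \<partial>M) \<le> ennreal K"
  obtains X' V' Z' W' where
    "kinetic M b (drift_correction b) (time_deriv b) (space_deriv b) G' B T p (max K 1 powr (1 / p))
       (max 1 (max (gauss_const CARD('n) p) ((gauss_const CARD('n) 2)\<^sup>2))) eps x X' V' Z' W'"
    "\<And>t. 0 \<le> t \<Longrightarrow> AE \<omega> in M. X' t \<omega> = X t \<omega>" "\<And>t. 0 \<le> t \<Longrightarrow> AE \<omega> in M. Z' t \<omega> = Z t \<omega>"
proof -
  let ?g = "gauss_const CARD('n)"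
  let ?c = "max 1 (max (?g p) ((?g 2)\<^sup>2))"
  have bm: "brownian_motion M F W" and V0F: "meas_wrt M (F 0) (V 0)"
    and meas: "\<And>t. 0 \<le> t \<Longrightarrow> X t \<in> borel_measurable M \<and> V t \<in> borel_measurable M \<and> Z t \<in> borel_measurable M"
    and AE: "AE \<omega> in M.
        continuous_on {0..} (\<lambda>t. X t \<omega>) \<and> continuous_on {0..} (\<lambda>t. V t \<omega>) \<and>
        continuous_on {0..} (\<lambda>t. Z t \<omega>) \<and>
        (\<forall>t\<ge>0.
          X t \<omega> = x + integral {0..t} (\<lambda>s. V s \<omega>) \<and>
          V t \<omega> = V 0 \<omega> + integral {0..t} (\<lambda>s. (1 / eps) *\<^sub>R (b (X s \<omega>) s - V s \<omega>))
                   + sqrt (2 / eps) *\<^sub>R W t \<omega> \<and>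
          Z t \<omega> = x + integral {0..t} (\<lambda>s. eff_drift b eps (Z s \<omega>) s)
                   + sqrt (2 * eps) *\<^sub>R W t \<omega>)"
    using coup unfolding langevin_coupling_def by blast+
  interpret brownian M F W by (rule brownian.intro[OF bm])
  have W_cont: "\<And>\<omega>. \<omega> \<in> space M \<Longrightarrow> continuous_on {0..} (\<lambda>t. W t \<omega>)"
    using bm unfolding brownian_motion_def by blast
  from AE obtain N where N: "N \<in> sets M" "emeasure M N = 0" and good: "\<And>\<omega>. \<omega> \<in> space M - N \<Longrightarrow>
        continuous_on {0..} (\<lambda>t. X t \<omega>) \<and> continuous_on {0..} (\<lambda>t. V t \<omega>) \<and>
        continuous_on {0..} (\<lambda>t. Z t \<omega>) \<and>
        (\<forall>t\<ge>0.
          X t \<omega> = x + integral {0..t} (\<lambda>s. V s \<omega>) \<and>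
          V t \<omega> = V 0 \<omega> + integral {0..t} (\<lambda>s. (1 / eps) *\<^sub>R (b (X s \<omega>) s - V s \<omega>))
                   + sqrt (2 / eps) *\<^sub>R W t \<omega> \<and>
          Z t \<omega> = x + integral {0..t} (\<lambda>s. eff_drift b eps (Z s \<omega>) s)
                   + sqrt (2 * eps) *\<^sub>R W t \<omega>)"
    by (rule AE_E) blast
  have AE_N: "AE \<omega> in M. \<omega> \<in> space M - N"
    using AE_not_in[of N M] N by (auto intro!: AE_I[of _ _ N])
  \<comment> \<open>Time is clamped at 0 and the null set N is sent to the zero path, so that all
    paths are continuous on the whole real line, as the joint measurability lemma requires.\<close>
  define m :: "(real \<Rightarrow> 'a \<Rightarrow> real^'n) \<Rightarrow> real \<Rightarrow> 'a \<Rightarrow> real^'n"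
    where "m Y t \<omega> = (if \<omega> \<in> N then 0 else Y (max 0 t) \<omega>)" for Y t \<omega>
  have m_eq: "m Y t \<omega> = Y t \<omega>" if "\<omega> \<in> space M - N" "0 \<le> t" for Y t \<omega>
    using that by (simp add: m_def)
  have m_AE: "AE \<omega> in M. m Y t \<omega> = Y t \<omega>" if "0 \<le> t" for Y t
    using AE_N by eventually_elim (use that m_eq in blast)
  have cont_max: "continuous_on UNIV (\<lambda>t. y (max 0 t))" if "continuous_on {0..} y" for y :: "real \<Rightarrow> real^'n"
    by (rule continuous_on_compose2[OF that]) (auto intro!: continuous_intros)
  have m_jm: "case_prod (m Y) \<in> borel_measurable (borel \<Otimes>\<^sub>M M)"
    if "\<And>t. 0 \<le> t \<Longrightarrow> Y t \<in> borel_measurable M" "\<And>\<omega>. \<omega> \<in> space M - N \<Longrightarrow> continuous_on {0..} (\<lambda>t. Y t \<omega>)" for Y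
  proof (rule jointly_measurable_of_continuous_paths)
    show "m Y t \<in> borel_measurable M" for t
      unfolding m_def[abs_def] using that(1)[of "max 0 t"] by (intro measurable_If_set) (auto simp: N(1))
    show "continuous_on UNIV (\<lambda>t. m Y t \<omega>)" if "\<omega> \<in> space M" for \<omega>
      using cont_max[of "\<lambda>t. Y t \<omega>"] \<open>\<And>\<omega>. \<omega> \<in> space M - N \<Longrightarrow> continuous_on {0..} (\<lambda>t. Y t \<omega>)\<close>[of \<omega>] that
      by (cases "\<omega> \<in> N") (auto simp: m_def)
  qed
  have m_cont: "continuous_on {0..} (\<lambda>t. m Y t \<omega>)" if "\<omega> \<in> space M - N" "continuous_on {0..} (\<lambda>t. Y t \<omega>)" for Y \<omega>
    using that(2) by (rule continuous_on_eq) (use m_eq that(1) in auto)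
  have V0_meas: "V 0 \<in> borel_measurable M" using meas by simp
  have V0_Lp: "Lp_le M p (\<lambda>\<omega>. V 0 \<omega> - b x 0) (max K 1 powr (1 / p))"
    by (rule Lp_le_of_moment) (use moment p V0_meas in auto)
  have int_cong: "integral {0..t} (\<lambda>s. f (m Y s \<omega>) (m Y' s \<omega>) s) = integral {0..t} (\<lambda>s. f (Y s \<omega>) (Y' s \<omega>) s)"
    if "\<omega> \<in> space M - N" for f :: "real^'n \<Rightarrow> real^'n \<Rightarrow> real \<Rightarrow> real^'n" and Y Y' t \<omega>
    by (rule Henstock_Kurzweil_Integration.integral_cong) (use m_eq that in auto)
  \<comment> \<open>Expectations involving W at up to three nonnegative times are unchanged by the
    modification.\<close>
  have W_m: "(\<integral>\<omega>. f (m W r \<omega>) (m W t \<omega>) (m W s \<omega>) \<omega> \<partial>M) = (\<integral>\<omega>. f (W r \<omega>) (W t \<omega>) (W s \<omega>) \<omega> \<partial>M)"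
    if "0 \<le> r" "0 \<le> t" "0 \<le> s" and f: "(\<lambda>\<omega>. f (m W r \<omega>) (m W t \<omega>) (m W s \<omega>) \<omega>) \<in> borel_measurable M"
       "(\<lambda>\<omega>. f (W r \<omega>) (W t \<omega>) (W s \<omega>) \<omega>) \<in> borel_measurable M"
    for f :: "real^'n \<Rightarrow> real^'n \<Rightarrow> real^'n \<Rightarrow> 'a \<Rightarrow> real^'n" and r s t
    using f
  proof (rule integral_cong_AE)
    show "AE \<omega> in M. f (m W r \<omega>) (m W t \<omega>) (m W s \<omega>) \<omega> = f (W r \<omega>) (W t \<omega>) (W s \<omega>) \<omega>"
      using AE_N by eventually_elim (use that m_eq in auto)
  qed
  have mW[measurable]: "m W t \<in> borel_measurable M" for t
    unfolding m_def[abs_def] using W_borel[of "max 0 t"] by (intro measurable_If_set) (auto simp: N(1))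
  have mV[measurable]: "m V 0 \<in> borel_measurable M"
    unfolding m_def[abs_def] using V0_meas by (intro measurable_If_set) (auto simp: N(1))
  note [measurable] = V0_meas
  have [measurable]: "(\<lambda>v::real^'n. v $ j) \<in> borel_measurable borel" for j
    by (intro borel_measurable_continuous_onI continuous_intros)
  show ?thesis
  proof (rule that[of "m X" "m V" "m Z" "m W"])
    show "AE \<omega> in M. m X t \<omega> = X t \<omega>" "AE \<omega> in M. m Z t \<omega> = Z t \<omega>" if "0 \<le> t" for t
      by (rule m_AE[OF that])+
    show "kinetic M b (drift_correction b) (time_deriv b) (space_deriv b) G' B T p (max K 1 powr (1 / p)) ?c eps x (m X) (m V) (m Z) (m W)"
    proof (intro kinetic.intro kinetic_axioms.intro)
      show "prob_space M" by (rule prob_space_axioms)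
      show "continuous_on UNIV (\<lambda>z. drift_correction b (fst z) (snd z))" by (rule drift_correction_regular(2)[OF b])
      show "((\<lambda>z. b (fst z) (snd z)) has_derivative (\<lambda>v. space_deriv b y t (fst v) + snd v *\<^sub>R time_deriv b y t)) (at (y, t))" for y t
        by (rule unc_has_derivative[OF b(1)])
      show "case_prod (m X) \<in> borel_measurable (borel \<Otimes>\<^sub>M M)" "case_prod (m V) \<in> borel_measurable (borel \<Otimes>\<^sub>M M)"
        "case_prod (m Z) \<in> borel_measurable (borel \<Otimes>\<^sub>M M)" "case_prod (m W) \<in> borel_measurable (borel \<Otimes>\<^sub>M M)"
        using meas good W_borel W_cont by (intro m_jm; blast)+
      show "1 \<le> max K 1 powr (1 / p)" using p by (intro ge_one_powr_ge_zero) auto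
      show "AE \<omega> in M. continuous_on {0..} (\<lambda>t. m X t \<omega>) \<and> continuous_on {0..} (\<lambda>t. m V t \<omega>) \<and>
        continuous_on {0..} (\<lambda>t. m Z t \<omega>) \<and> continuous_on {0..} (\<lambda>t. m W t \<omega>) \<and> m W 0 \<omega> = 0 \<and>
        (\<forall>t\<ge>0. m X t \<omega> = x + integral {0..t} (\<lambda>s. m V s \<omega>) \<and>
          m V t \<omega> = m V 0 \<omega> + integral {0..t} (\<lambda>s. (1 / eps) *\<^sub>R (b (m X s \<omega>) s - m V s \<omega>)) + sqrt (2 / eps) *\<^sub>R m W t \<omega> \<and>
          m Z t \<omega> = x + integral {0..t} (\<lambda>s. b (m Z s \<omega>) s - eps *\<^sub>R drift_correction b (m Z s \<omega>) s) + sqrt (2 * eps) *\<^sub>R m W t \<omega>)"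
        using AE_N
      proof eventually_elim
        case (elim \<omega>)
        note g = good[OF elim]
        have i: "integral {0..t} (\<lambda>s. m V s \<omega>) = integral {0..t} (\<lambda>s. V s \<omega>)"
          "integral {0..t} (\<lambda>s. (1 / eps) *\<^sub>R (b (m X s \<omega>) s - m V s \<omega>)) = integral {0..t} (\<lambda>s. (1 / eps) *\<^sub>R (b (X s \<omega>) s - V s \<omega>))"
          "integral {0..t} (\<lambda>s. b (m Z s \<omega>) s - eps *\<^sub>R drift_correction b (m Z s \<omega>) s) = integral {0..t} (\<lambda>s. b (Z s \<omega>) s - eps *\<^sub>R drift_correction b (Z s \<omega>) s)"
          for t
          using int_cong[OF elim, of t "\<lambda>y v s. v" X V] int_cong[OF elim, of t "\<lambda>y v s. (1 / eps) *\<^sub>R (b y s - v)" X V]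
            int_cong[OF elim, of t "\<lambda>y v s. b y s - eps *\<^sub>R drift_correction b y s" Z V] by blast+
        have "m W 0 \<omega> = 0" using m_eq[OF elim, of 0 W] W_0 elim by simp
        moreover have "continuous_on {0..} (\<lambda>t. m W t \<omega>)" using m_cont[OF elim, of W] W_cont elim by blast
        moreover have "continuous_on {0..} (\<lambda>t. m X t \<omega>)" "continuous_on {0..} (\<lambda>t. m V t \<omega>)" "continuous_on {0..} (\<lambda>t. m Z t \<omega>)"
          using g m_cont[OF elim] by blast+
        moreover have "m X t \<omega> = x + integral {0..t} (\<lambda>s. m V s \<omega>) \<and>
          m V t \<omega> = m V 0 \<omega> + integral {0..t} (\<lambda>s. (1 / eps) *\<^sub>R (b (m X s \<omega>) s - m V s \<omega>)) + sqrt (2 / eps) *\<^sub>R m W t \<omega> \<and>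
          m Z t \<omega> = x + integral {0..t} (\<lambda>s. b (m Z s \<omega>) s - eps *\<^sub>R drift_correction b (m Z s \<omega>) s) + sqrt (2 * eps) *\<^sub>R m W t \<omega>"
          if "0 \<le> t" for t
          unfolding i m_eq[OF elim that] m_eq[OF elim order_refl]
          by (rule g[THEN conjunct2, THEN conjunct2, THEN conjunct2, rule_format, OF that, unfolded eff_drift_eq])
        ultimately show ?case by blast
      qed
      show "Lp_le M p (\<lambda>\<omega>. m V 0 \<omega> - b x 0) (max K 1 powr (1 / p))"
      proof (rule Lp_le_cong_AE[OF V0_Lp])
        show "AE \<omega> in M. m V 0 \<omega> - b x 0 = V 0 \<omega> - b x 0" using m_AE[OF order_refl, of V] by eventually_elim simp
      qed (use p in auto)
      have "(\<integral>\<omega>. m V 0 \<omega> - b x 0 \<partial>M) = (\<integral>\<omega>. V 0 \<omega> - b x 0 \<partial>M)"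
      proof (rule integral_cong_AE)
        show "AE \<omega> in M. m V 0 \<omega> - b x 0 = V 0 \<omega> - b x 0" using m_AE[OF order_refl, of V] by eventually_elim simp
      qed measurable
      thus "(\<integral>\<omega>. m V 0 \<omega> - b x 0 \<partial>M) = 0" using mean by simp
      show "Lp_le M p (\<lambda>\<omega>. m W t \<omega> - m W s \<omega>) a" if "0 \<le> s" "s \<le> t" "?c * sqrt (t - s) \<le> a" "0 < a" for s t a
      proof (rule Lp_le_cong_AE)
        have "?g p * sqrt (t - s) \<le> ?c * sqrt (t - s)" using that by (intro mult_right_mono) auto
        thus "Lp_le M p (\<lambda>\<omega>. W t \<omega> - W s \<omega>) a" using that p by (intro Lp_le_increment) auto
        show "AE \<omega> in M. m W t \<omega> - m W s \<omega> = W t \<omega> - W s \<omega>"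
          using AE_N by eventually_elim (use that m_eq in auto)
      qed (use p in auto)
      show "(\<integral>\<omega>. m W t \<omega> - m W s \<omega> \<partial>M) = 0" if "0 \<le> s" "s \<le> t" for s t
        using W_m[of 0 t s "\<lambda>_ u v _. u - v"] expectation_increment[OF that] that by simp
      show "norm (\<integral>\<omega>. m W r \<omega> $ i *\<^sub>R (m W t \<omega> - m W s \<omega>) \<partial>M) \<le> ?c * (t - s)" if "0 \<le> r" "0 \<le> s" "s \<le> t" for r s t i
      proof -
        have "(\<integral>\<omega>. m W r \<omega> $ i *\<^sub>R (m W t \<omega> - m W s \<omega>) \<partial>M) = (\<integral>\<omega>. W r \<omega> $ i *\<^sub>R (W t \<omega> - W s \<omega>) \<partial>M)"
          using that by (intro W_m[of r t s "\<lambda>w u v _. w $ i *\<^sub>R (u - v)"]) auto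
        also have "norm \<dots> \<le> (?g 2)\<^sup>2 * (t - s)" by (rule norm_expectation_W_increment[OF that(2,3,1)])
        also have "\<dots> \<le> ?c * (t - s)" using that by (intro mult_right_mono) auto
        finally show ?thesis .
      qed
      show "(\<integral>\<omega>. m W r \<omega> $ i *\<^sub>R (m V 0 \<omega> - b x 0) \<partial>M) = 0" if r: "0 \<le> r" for r i
      proof -
        \<comment> \<open>The initial fluctuation belongs to F 0 and is therefore orthogonal to the
          increment of W from time 0, which is \<open>W r\<close> itself because W starts at
          0.\<close>
        have "meas_wrt M (F 0) (\<lambda>\<omega>. V 0 \<omega> - b x 0)"
          using V0F unfolding meas_wrt_iff[OF F_sigma_algebra[OF order_refl]] by (intro borel_measurable_diff) auto
        hence "(\<integral>\<omega>. (W r \<omega> - W 0 \<omega>) $ i *\<^sub>R (V 0 \<omega> - b x 0) \<partial>M) = 0"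
          using r p by (intro expectation_increment_scaleR_past[OF order_refl r _ Lp_le_exponent[OF V0_Lp]]) auto
        also have "(\<integral>\<omega>. (W r \<omega> - W 0 \<omega>) $ i *\<^sub>R (V 0 \<omega> - b x 0) \<partial>M) = (\<integral>\<omega>. m W r \<omega> $ i *\<^sub>R (m V 0 \<omega> - b x 0) \<partial>M)"
        proof (rule integral_cong_AE)
          show "AE \<omega> in M. (W r \<omega> - W 0 \<omega>) $ i *\<^sub>R (V 0 \<omega> - b x 0) = m W r \<omega> $ i *\<^sub>R (m V 0 \<omega> - b x 0)"
            using AE_N by eventually_elim (use r m_eq W_0 in auto)
        qed (use r in measurable)
        finally show ?thesis .
      qed
    qed (use T B p eps C3 C2 lip in \<open>auto simp: drift_correction_def\<close>)
  qed
qed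

text \<open>The moment bound K is fixed before C, so the constants may depend on it but are uniform
  over \<epsilon>, the couplings and the probability spaces of the given type. The threshold eps0 is
  taken to be 1 in both parts.\<close>

theorem theorem1p1:
  fixes b :: "real^'n \<Rightarrow> real \<Rightarrow> real^'n" and x :: "real^'n"
    and p T K :: real
  assumes "smooth (unc b)" and "zperiodic_t b"
    and "p \<ge> 4" and "T > 0"
  shows
   "(\<exists>C>0. \<exists>eps0>0. \<forall>eps (M::'a measure) F W X V Z.
       0 < eps \<and> eps < eps0 \<and> langevin_coupling eps b x M F W X V Z \<and>
       integrable M (\<lambda>\<omega>. V 0 \<omega> - b x 0) \<and>
       integral\<^sup>L M (\<lambda>\<omega>. V 0 \<omega> - b x 0) = 0 \<and>
       (\<integral>\<^sup>+\<omega>. ennreal (norm (V 0 \<omega> - b x 0) powr p) \<partial>M) \<le> ennreal K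
       \<longrightarrow> (\<forall>t\<in>{0..T}.
             (\<integral>\<^sup>+\<omega>. ennreal (norm (X t \<omega> - Z t \<omega>) powr p) \<partial>M)
               \<le> ennreal (C * (1 + T) * eps powr p)))
    \<and>
    (\<forall>\<phi> :: real^'n \<Rightarrow> real. smooth \<phi> \<and> zperiodic \<phi> \<longrightarrow>
      (\<exists>C>0. \<exists>eps0>0. \<forall>eps (M::'a measure) F W X V Z.
       0 < eps \<and> eps < eps0 \<and> langevin_coupling eps b x M F W X V Z \<and>
       integrable M (\<lambda>\<omega>. V 0 \<omega> - b x 0) \<and>
       integral\<^sup>L M (\<lambda>\<omega>. V 0 \<omega> - b x 0) = 0 \<and>
       (\<integral>\<^sup>+\<omega>. ennreal (norm (V 0 \<omega> - b x 0) powr p) \<partial>M) \<le> ennreal K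
       \<longrightarrow> (\<forall>t\<in>{0..T}.
             \<bar>(\<integral>\<omega>. \<phi> (X t \<omega>) \<partial>M) - (\<integral>\<omega>. \<phi> (Z t \<omega>) \<partial>M)\<bar> \<le> C * eps\<^sup>2)))"
proof -
  \<comment> \<open>The locale works on intervals of length at least 1; its estimates restrict to
    [0, T].\<close>
  define T' where "T' = max T 1"
  have T': "1 \<le> T'" "T \<le> T'" by (auto simp: T'_def)
  obtain B G' where B: "1 \<le> B" and C3: "C3_le T' B b (space_deriv b)" and C2: "C2_le T' B (drift_correction b) G'"
    and lip: "\<And>y y' t t'. t \<in> {0..T'} \<Longrightarrow> t' \<in> {0..T'} \<Longrightarrow> norm (b y t - b y' t') \<le> B * (norm (y - y') + \<bar>t - t'\<bar>)"
    using drift_regular[OF assms(1,2), where T = T'] by metis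
  define \<kappa> where "\<kappa> = max K 1 powr (1 / p)"
  define c where "c = max 1 (max (gauss_const CARD('n) p) ((gauss_const CARD('n) 2)\<^sup>2))"
  \<comment> \<open>The bound A is allowed to exceed B, because in the weak estimate it must also
    dominate the test function.\<close>
  have coupled: "\<exists>X' V' Z' W'. kinetic M b (drift_correction b) (time_deriv b) (space_deriv b) G' A T' p \<kappa> c eps x X' V' Z' W' \<and>
      (\<forall>t\<ge>0. (AE \<omega> in M. X' t \<omega> = X t \<omega>) \<and> (AE \<omega> in M. Z' t \<omega> = Z t \<omega>))"
    if "B \<le> A" "0 < eps" "eps < 1" "langevin_coupling eps b x M F W X V Z"
      "integral\<^sup>L M (\<lambda>\<omega>. V 0 \<omega> - b x 0) = 0"
      "(\<integral>\<^sup>+\<omega>. ennreal (norm (V 0 \<omega> - b x 0) powr p) \<partial>M) \<le> ennreal K"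
    for A eps and M :: "'a measure" and F W X V Z
  proof -
    have lip': "norm (b y t - b y' t') \<le> A * (norm (y - y') + \<bar>t - t'\<bar>)" if "t \<in> {0..T'}" "t' \<in> {0..T'}" for y y' t t'
      by (rule order_trans[OF lip[OF that] mult_right_mono[OF \<open>B \<le> A\<close>]]) simp
    have A1: "1 \<le> A" using B \<open>B \<le> A\<close> by simp
    show ?thesis
    proof (rule langevin_coupling_kinetic[OF assms(1,2) T'(1) A1 assms(3) that(2,3)
            C3_le_mono[OF C3 that(1)] C2_le_mono[OF C2 that(1)] lip' that(4-6)], assumption, assumption)
      fix X' V' Z' W'
      assume "kinetic M b (drift_correction b) (time_deriv b) (space_deriv b) G' A T' p (max K 1 powr (1 / p))
          (max 1 (max (gauss_const CARD('n) p) ((gauss_const CARD('n) 2)\<^sup>2))) eps x X' V' Z' W'"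
        and "\<And>t. 0 \<le> t \<Longrightarrow> AE \<omega> in M. X' t \<omega> = X t \<omega>" "\<And>t. 0 \<le> t \<Longrightarrow> AE \<omega> in M. Z' t \<omega> = Z t \<omega>"
      thus ?thesis unfolding \<kappa>_def c_def by blast
    qed
  qed
  \<comment> \<open>Outside the locale the constant is a function of B, T', \<kappa> and c alone,
    hence the same for all \<epsilon> and all couplings.\<close>
  let ?cD = "kinetic.cD B T' \<kappa> c"
  have strong: "(\<integral>\<^sup>+\<omega>. ennreal (norm (X t \<omega> - Z t \<omega>) powr p) \<partial>M) \<le> ennreal ((\<bar>?cD\<bar> powr p + 1) * (1 + T) * eps powr p)"
    if h: "0 < eps" "eps < 1" "langevin_coupling eps b x M F W X V Z"
      "integral\<^sup>L M (\<lambda>\<omega>. V 0 \<omega> - b x 0) = 0"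
      "(\<integral>\<^sup>+\<omega>. ennreal (norm (V 0 \<omega> - b x 0) powr p) \<partial>M) \<le> ennreal K" and t: "t \<in> {0..T}"
    for eps t and M :: "'a measure" and F W X V Z
  proof -
    obtain X' V' Z' W' where k: "kinetic M b (drift_correction b) (time_deriv b) (space_deriv b) G' B T' p \<kappa> c eps x X' V' Z' W'"
      and AE: "AE \<omega> in M. X' t \<omega> = X t \<omega>" "AE \<omega> in M. Z' t \<omega> = Z t \<omega>"
      using coupled[OF order_refl h] t by fastforce
    interpret k: kinetic M b "drift_correction b" "time_deriv b" "space_deriv b" G' B T' p \<kappa> c eps x X' V' Z' W'
      by (rule k)
    have "AE \<omega> in M. norm (X t \<omega> - Z t \<omega>) powr p = norm (k.D t \<omega>) powr p"
      using AE by eventually_elim (simp add: k.D_def)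
    hence "(\<integral>\<^sup>+\<omega>. ennreal (norm (X t \<omega> - Z t \<omega>) powr p) \<partial>M) = (\<integral>\<^sup>+\<omega>. ennreal (norm (k.D t \<omega>) powr p) \<partial>M)"
      by (intro nn_integral_cong_AE) auto
    also have "\<dots> \<le> ennreal ((?cD * eps) powr p)"
      using k.Lp_D[of t] t T' by (auto simp: Lp_le_def)
    also have "\<dots> \<le> ennreal ((\<bar>?cD\<bar> powr p + 1) * (1 + T) * eps powr p)"
    proof (rule ennreal_leI)
      \<comment> \<open>Positivity of the constant is available only inside a locale instance,
        whence the absolute value and the summand 1 in the final C. The growth in T already sits in
        \<open>?cD\<close>, and 1 \<le> 1 + T supplies the remaining factor.\<close>
      have "(?cD * eps) powr p = \<bar>?cD\<bar> powr p * 1 * eps powr p"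
        using k.cD_pos h(1) by (simp add: powr_mult)
      also have "\<dots> \<le> (\<bar>?cD\<bar> powr p + 1) * (1 + T) * eps powr p"
        using assms(4) by (intro mult_right_mono mult_mono) auto
      finally show "(?cD * eps) powr p \<le> (\<bar>?cD\<bar> powr p + 1) * (1 + T) * eps powr p" .
    qed
    finally show ?thesis .
  qed
  have weak: "\<exists>C>0. \<forall>eps (M::'a measure) F W X V Z t. 0 < eps \<longrightarrow> eps < 1 \<longrightarrow>
       langevin_coupling eps b x M F W X V Z \<longrightarrow> integral\<^sup>L M (\<lambda>\<omega>. V 0 \<omega> - b x 0) = 0 \<longrightarrow>
       (\<integral>\<^sup>+\<omega>. ennreal (norm (V 0 \<omega> - b x 0) powr p) \<partial>M) \<le> ennreal K \<longrightarrow> t \<in> {0..T} \<longrightarrow>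
       \<bar>(\<integral>\<omega>. \<phi> (X t \<omega>) \<partial>M) - (\<integral>\<omega>. \<phi> (Z t \<omega>) \<partial>M)\<bar> \<le> C * eps\<^sup>2"
    if phi: "smooth \<phi>" "zperiodic \<phi>" for \<phi> :: "real^'n \<Rightarrow> real"
  proof -
    have "xperiodic (\<lambda>z :: (real^'n) \<times> real. \<phi> (fst z))" using phi(2) by (auto simp: xperiodic_def zperiodic_def)
    then obtain B' where "C3_le T' B' (\<lambda>y t. \<phi> (fst (y, t))) (\<lambda>y t h. frechet_derivative (\<lambda>z :: (real^'n) \<times> real. \<phi> (fst z)) (at (y, t)) (h, 0))"
      by (rule smooth_xperiodic_C3_le[OF _ smooth_comp_fst[OF phi(1)]])
    then obtain f' where f': "C3_le T' B' (\<lambda>y t. \<phi> y) f'" unfolding fst_conv by blast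
    \<comment> \<open>\<open>weak_error\<close> wants drift and test function in the same class,
      with one constant.\<close>
    define A where "A = max B B'"
    have A: "B \<le> A" "C3_le T' A (\<lambda>y t. \<phi> y) f'" using C3_le_mono[OF f'] by (auto simp: A_def)
    \<comment> \<open>Again independent of \<epsilon> and the coupling; the type argument carries
      the dimension n.\<close>
    let ?C = "A * kinetic.cM TYPE('n) A T' \<kappa> c + kinetic.cF TYPE('n) A T' \<kappa> c"
    have "\<bar>(\<integral>\<omega>. \<phi> (X t \<omega>) \<partial>M) - (\<integral>\<omega>. \<phi> (Z t \<omega>) \<partial>M)\<bar> \<le> (\<bar>?C\<bar> + 1) * eps\<^sup>2"
      if h: "0 < eps" "eps < 1" "langevin_coupling eps b x M F W X V Z"
        "integral\<^sup>L M (\<lambda>\<omega>. V 0 \<omega> - b x 0) = 0"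
        "(\<integral>\<^sup>+\<omega>. ennreal (norm (V 0 \<omega> - b x 0) powr p) \<partial>M) \<le> ennreal K" and t: "t \<in> {0..T}"
      for eps t and M :: "'a measure" and F W X V Z
    proof -
      obtain X' V' Z' W' where k: "kinetic M b (drift_correction b) (time_deriv b) (space_deriv b) G' A T' p \<kappa> c eps x X' V' Z' W'"
        and AE: "AE \<omega> in M. X' t \<omega> = X t \<omega>" "AE \<omega> in M. Z' t \<omega> = Z t \<omega>"
        using coupled[OF A(1) h] t by fastforce
      interpret k: kinetic M b "drift_correction b" "time_deriv b" "space_deriv b" G' A T' p \<kappa> c eps x X' V' Z' W'
        by (rule k)
      have [measurable]: "X t \<in> borel_measurable M" "Z t \<in> borel_measurable M"
        using h(3) t by (auto simp: langevin_coupling_def)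
      have [measurable]: "\<phi> \<in> borel_measurable borel"
        by (rule borel_measurable_continuous_onI[OF smooth_continuous_on[OF phi(1)]])
      have "(\<integral>\<omega>. \<phi> (X t \<omega>) \<partial>M) = (\<integral>\<omega>. \<phi> (X' t \<omega>) \<partial>M)" "(\<integral>\<omega>. \<phi> (Z t \<omega>) \<partial>M) = (\<integral>\<omega>. \<phi> (Z' t \<omega>) \<partial>M)"
        using AE by (auto intro!: integral_cong_AE)
      hence "\<bar>(\<integral>\<omega>. \<phi> (X t \<omega>) \<partial>M) - (\<integral>\<omega>. \<phi> (Z t \<omega>) \<partial>M)\<bar> \<le> ?C * eps\<^sup>2"
        using k.weak_error[OF A(2), of t] t T' by simp
      also have "\<dots> \<le> (\<bar>?C\<bar> + 1) * eps\<^sup>2" by (intro mult_right_mono) auto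
      finally show ?thesis .
    qed
    moreover have "0 < \<bar>?C\<bar> + 1" by simp
    ultimately show ?thesis by blast
  qed
  have "\<bar>?cD\<bar> powr p + 1 > 0" by (simp add: add_nonneg_pos)
  show ?thesis
  proof (intro conjI allI impI)
    show "\<exists>C>0. \<exists>eps0>0. \<forall>eps (M::'a measure) F W X V Z.
       0 < eps \<and> eps < eps0 \<and> langevin_coupling eps b x M F W X V Z \<and>
       integrable M (\<lambda>\<omega>. V 0 \<omega> - b x 0) \<and>
       integral\<^sup>L M (\<lambda>\<omega>. V 0 \<omega> - b x 0) = 0 \<and>
       (\<integral>\<^sup>+\<omega>. ennreal (norm (V 0 \<omega> - b x 0) powr p) \<partial>M) \<le> ennreal K
       \<longrightarrow> (\<forall>t\<in>{0..T}.
             (\<integral>\<^sup>+\<omega>. ennreal (norm (X t \<omega> - Z t \<omega>) powr p) \<partial>M)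
               \<le> ennreal (C * (1 + T) * eps powr p))"
    proof (rule exI[of _ "\<bar>?cD\<bar> powr p + 1"], rule conjI[OF \<open>\<bar>?cD\<bar> powr p + 1 > 0\<close>], rule exI[of _ 1],
        intro conjI allI impI ballI)
      fix eps t and M :: "'a measure" and F W X V Z
      assume "0 < eps \<and> eps < 1 \<and> langevin_coupling eps b x M F W X V Z \<and>
         integrable M (\<lambda>\<omega>. V 0 \<omega> - b x 0) \<and>
         integral\<^sup>L M (\<lambda>\<omega>. V 0 \<omega> - b x 0) = 0 \<and>
         (\<integral>\<^sup>+\<omega>. ennreal (norm (V 0 \<omega> - b x 0) powr p) \<partial>M) \<le> ennreal K" and t: "t \<in> {0..T}"
      thus "(\<integral>\<^sup>+\<omega>. ennreal (norm (X t \<omega> - Z t \<omega>) powr p) \<partial>M) \<le> ennreal ((\<bar>?cD\<bar> powr p + 1) * (1 + T) * eps powr p)"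
        by (elim conjE) (rule strong)
    qed simp
  next
    fix \<phi> :: "real^'n \<Rightarrow> real" assume "smooth \<phi> \<and> zperiodic \<phi>"
    hence "smooth \<phi>" "zperiodic \<phi>" by auto
    from weak[OF this] obtain C where C: "C > 0" "\<And>eps (M::'a measure) F W X V Z t. 0 < eps \<Longrightarrow> eps < 1 \<Longrightarrow>
         langevin_coupling eps b x M F W X V Z \<Longrightarrow> integral\<^sup>L M (\<lambda>\<omega>. V 0 \<omega> - b x 0) = 0 \<Longrightarrow>
         (\<integral>\<^sup>+\<omega>. ennreal (norm (V 0 \<omega> - b x 0) powr p) \<partial>M) \<le> ennreal K \<Longrightarrow> t \<in> {0..T} \<Longrightarrow>
         \<bar>(\<integral>\<omega>. \<phi> (X t \<omega>) \<partial>M) - (\<integral>\<omega>. \<phi> (Z t \<omega>) \<partial>M)\<bar> \<le> C * eps\<^sup>2" by blast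
    show "\<exists>C>0. \<exists>eps0>0. \<forall>eps (M::'a measure) F W X V Z.
       0 < eps \<and> eps < eps0 \<and> langevin_coupling eps b x M F W X V Z \<and>
       integrable M (\<lambda>\<omega>. V 0 \<omega> - b x 0) \<and>
       integral\<^sup>L M (\<lambda>\<omega>. V 0 \<omega> - b x 0) = 0 \<and>
       (\<integral>\<^sup>+\<omega>. ennreal (norm (V 0 \<omega> - b x 0) powr p) \<partial>M) \<le> ennreal K
       \<longrightarrow> (\<forall>t\<in>{0..T}.
             \<bar>(\<integral>\<omega>. \<phi> (X t \<omega>) \<partial>M) - (\<integral>\<omega>. \<phi> (Z t \<omega>) \<partial>M)\<bar> \<le> C * eps\<^sup>2)"
    proof (rule exI[of _ C], rule conjI[OF C(1)], rule exI[of _ 1], intro conjI allI impI ballI)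
      fix eps t and M :: "'a measure" and F W X V Z
      assume "0 < eps \<and> eps < 1 \<and> langevin_coupling eps b x M F W X V Z \<and>
         integrable M (\<lambda>\<omega>. V 0 \<omega> - b x 0) \<and>
         integral\<^sup>L M (\<lambda>\<omega>. V 0 \<omega> - b x 0) = 0 \<and>
         (\<integral>\<^sup>+\<omega>. ennreal (norm (V 0 \<omega> - b x 0) powr p) \<partial>M) \<le> ennreal K" and t: "t \<in> {0..T}"
      thus "\<bar>(\<integral>\<omega>. \<phi> (X t \<omega>) \<partial>M) - (\<integral>\<omega>. \<phi> (Z t \<omega>) \<partial>M)\<bar> \<le> C * eps\<^sup>2"
        by (elim conjE) (rule C(2))
    qed simp
  qed
qed

end
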